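(* Let $n\geq 2$. The inclusion $O_n\subset O_n^*$ is maximal in the category of compact quantum groups. That is: let $A$ be a unitary Hopf algebra and let $$A_o^*(n)\overset{f}{\longrightarrow} A\overset{g}{\longrightarrow}\mathcal R(O_n)$$ be surjective Hopf $*$-algebra maps whose composition $g\circ f$ is the canonical surjection $A_o^*(n)\to\mathcal R(O_n)$ (sending the standard generators $u_{ij}$ of $A_o^*(n)$ to the coordinate functions $u_{ij}$ of $O_n$). Then $f$ is an isomorphism or $g$ is an isomorphism.
   Context: All algebras are unital and over $\mathbb C$. A unitary Hopf algebra is a $*$-algebra $A$ generated by elements $\{u_{ij}\mid 1\le i,j\le m\}$ (for some $m$) such that $u=(u_{ij})$ and $\overline u=(u_{ij}^* )$ are unitary matrices in $M_m(A)$, and such that there exist: a $*$-algebra map $\Delta:A\to A\otimes A$ with $\Delta(u_{ij})=\sum_{k}u_{ik}\otimes u_{kj}$; a $*$-algebra map $\varepsilon:A\to\mathbb C$ with $\varepsilon(u_{ij})=\delta_{ij}$; and a $*$-algebra map $S:A\to A^{op}$ with $S(u_{ij})=u_{ji}^*$. With $\Delta,\varepsilon,S$, $A$ is a Hopf $*$-algebra. For a compact subgroup $G\subset U_m$, $\mathcal R(G)$ denotes the algebra of representative functions on $G$, which is a unitary Hopf algebra with standard generators $u_{ij}$ the coordinate functions taking a matrix to its $(i,j)$-entry. More generally every unitary Hopf algebra is written $\mathcal R(G)$, with $G$ called a unitary compact quantum group; an inclusion $H\subset G$ of quantum groups means a surjective Hopf $*$-algebra map $\mathcal R(G)\to\mathcal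 R(H)$, and an intermediate quantum group of $O_n\subset O_n^*$ means a factorization of the canonical surjection as in the claim. $O_n$ is the group of real orthogonal $n\times n$ matrices. $A_o^*(n)=\mathcal R(O_n^* )$ is the universal $*$-algebra generated by self-adjoint elements $\{u_{ij}\mid 1\le i,j\le n\}$ which half-commute, in the sense that $abc=cba$ for all $a,b,c\in\{u_{ij}\}$, and such that the matrix $u=(u_{ij})$ in $M_n(A_o^*(n))$ is orthogonal (i.e. $uu^t=u^tu=I_n$). It is a unitary Hopf algebra with generators $u_{ij}$; $O_n^*$ is called the half-liberated orthogonal quantum group. *)

theory Defs
  imports "HOL-Analysis.Analysis"
begin

section \<open>Complex *-algebras\<close>

class complex_star_algebra = ring_1 +
  fixes scaleC :: "complex \<Rightarrow> 'a \<Rightarrow> 'a"  (infixr \<open>*\<^sub>C\<close> 75)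
    and star :: "'a \<Rightarrow> 'a"
  assumes scaleC_add_right: "c *\<^sub>C (x + y) = c *\<^sub>C x + c *\<^sub>C y"
    and scaleC_add_left: "(c + d) *\<^sub>C x = c *\<^sub>C x + d *\<^sub>C x"
    and scaleC_scaleC: "c *\<^sub>C d *\<^sub>C x = (c * d) *\<^sub>C x"
    and scaleC_one: "1 *\<^sub>C x = x"
    and mult_scaleC_left: "(c *\<^sub>C x) * y = c *\<^sub>C (x * y)"
    and mult_scaleC_right: "x * (c *\<^sub>C y) = c *\<^sub>C (x * y)"
    and star_star: "star (star x) = x"
    and star_add: "star (x + y) = star x + star y"
    and star_mult: "star (x * y) = star y * star x"
    and star_scaleC: "star (c *\<^sub>C x) = cnj c *\<^sub>C star x"
begin

lemma scaleC_zero_left: "0 *\<^sub>C x = 0"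
  using scaleC_add_left[of 0 0 x] by simp

lemma scaleC_zero_right: "c *\<^sub>C 0 = 0"
  using scaleC_add_right[of c 0 0] by simp

lemma scaleC_minus_one: "(-1) *\<^sub>C x = - x"
proof -
  have "x + (-1) *\<^sub>C x = (1 + (-1)) *\<^sub>C x"
    by (simp only: scaleC_add_left scaleC_one)
  then have "x + (-1) *\<^sub>C x = 0" by (simp add: scaleC_zero_left)
  then show ?thesis by (metis minus_unique)
qed

lemma star_zero: "star 0 = 0"
  using star_add[of 0 0] by simp

lemma star_one: "star 1 = 1"
  using star_mult[of "star 1" 1] star_star[of 1] by simp

lemma star_minus: "star (- x) = - star x"
  using star_add[of x "- x"] by (simp add: star_zero eq_neg_iff_add_eq_0 add.commute)

lemma star_diff: "star (x - y) = star x - star y"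
  using star_add[of x "- y"] by (simp add: star_minus)

lemma scaleC_diff_right: "c *\<^sub>C (x - y) = c *\<^sub>C x - c *\<^sub>C y"
  using scaleC_add_right[of c "x - y" y] by (simp add: eq_diff_eq)

end

instantiation complex :: complex_star_algebra
begin
definition scaleC_complex :: "complex \<Rightarrow> complex \<Rightarrow> complex" where "scaleC_complex = (*)"
definition star_complex :: "complex \<Rightarrow> complex" where "star_complex = cnj"
instance
  by standard (auto simp: scaleC_complex_def star_complex_def algebra_simps)
end

definition C_linear :: "('a::complex_star_algebra \<Rightarrow> 'b::complex_star_algebra) \<Rightarrow> bool" where
  "C_linear f \<longleftrightarrow> (\<forall>x y. f (x + y) = f x + f y) \<and> (\<forall>c x. f (c *\<^sub>C x) = c *\<^sub>C f x)"

definition star_hom :: "('a::complex_star_algebra \<Rightarrow> 'b::complex_star_algebra) \<Rightarrow> bool" where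
  "star_hom f \<longleftrightarrow> C_linear f \<and> f 1 = 1 \<and> (\<forall>x y. f (x * y) = f x * f y)
     \<and> (\<forall>x. f (star x) = star (f x))"

text \<open>A *-algebra map \<open>A \<rightarrow> B\<^sup>o\<^sup>p\<close>, written as a map into \<open>B\<close>: the opposite algebra
  differs from \<open>B\<close> only in the order of multiplication.\<close>

definition star_hom_op :: "('a::complex_star_algebra \<Rightarrow> 'b::complex_star_algebra) \<Rightarrow> bool" where
  "star_hom_op f \<longleftrightarrow> C_linear f \<and> f 1 = 1 \<and> (\<forall>x y. f (x * y) = f y * f x)
     \<and> (\<forall>x. f (star x) = star (f x))"

definition star_subalgebra :: "'a::complex_star_algebra set \<Rightarrow> bool" where
  "star_subalgebra B \<longleftrightarrow> 1 \<in> B \<and> (\<forall>x\<in>B. \<forall>y\<in>B. x + y \<in> B \<and> x * y \<in> B)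
     \<and> (\<forall>c. \<forall>x\<in>B. c *\<^sub>C x \<in> B) \<and> (\<forall>x\<in>B. star x \<in> B)"

definition star_ideal :: "'a::complex_star_algebra set \<Rightarrow> bool" where
  "star_ideal J \<longleftrightarrow> 0 \<in> J \<and> (\<forall>x\<in>J. \<forall>y\<in>J. x + y \<in> J)
     \<and> (\<forall>c. \<forall>x\<in>J. c *\<^sub>C x \<in> J) \<and> (\<forall>a. \<forall>x\<in>J. a * x \<in> J \<and> x * a \<in> J)
     \<and> (\<forall>x\<in>J. star x \<in> J)"

lemma C_linear_zero: "C_linear f \<Longrightarrow> f 0 = 0"
  unfolding C_linear_def by (metis add_cancel_right_right)

lemma C_linear_minus: "C_linear f \<Longrightarrow> f (- x) = - f x"
  unfolding C_linear_def by (metis scaleC_minus_one)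

lemma C_linear_diff: "C_linear f \<Longrightarrow> f (x - y) = f x - f y"
  using C_linear_minus[of f y] unfolding C_linear_def
  by (metis add_uminus_conv_diff)

lemma C_linear_sum: "C_linear f \<Longrightarrow> f (sum h S) = (\<Sum>k\<in>S. f (h k))"
  by (induction S rule: infinite_finite_induct) (auto simp: C_linear_zero, auto simp: C_linear_def)

lemma star_ideal_hull: "star_ideal (star_ideal hull S)"
  by (rule hull_in) (auto simp: star_ideal_def)

lemma star_ideal_minus: "star_ideal J \<Longrightarrow> x \<in> J \<Longrightarrow> - x \<in> J"
  unfolding star_ideal_def by (metis scaleC_minus_one)

lemma star_ideal_kernel: "star_hom f \<Longrightarrow> star_ideal {x. f x = 0}"
  unfolding star_hom_def star_ideal_def
  by (auto simp: C_linear_zero star_zero) (auto simp: C_linear_def scaleC_zero_right)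


section \<open>The tensor product of two *-algebras\<close>

text \<open>The list \<open>[(a\<^sub>1,b\<^sub>1), \<dots>, (a\<^sub>r,b\<^sub>r)]\<close> stands for the formal sum
  \<open>a\<^sub>1 \<otimes> b\<^sub>1 + \<dots> + a\<^sub>r \<otimes> b\<^sub>r\<close>; the relation is the congruence generated by
  commutativity of addition and by bilinearity over \<open>\<complex>\<close>.\<close>

inductive tensor_eq ::
  "('a::complex_star_algebra \<times> 'b::complex_star_algebra) list \<Rightarrow> ('a \<times> 'b) list \<Rightarrow> bool" where
  tensor_refl: "tensor_eq x x"
| tensor_sym: "tensor_eq x y \<Longrightarrow> tensor_eq y x"
| tensor_trans: "tensor_eq x y \<Longrightarrow> tensor_eq y z \<Longrightarrow> tensor_eq x z"
| tensor_append: "tensor_eq x x' \<Longrightarrow> tensor_eq y y' \<Longrightarrow> tensor_eq (x @ y) (x' @ y')"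
| tensor_comm: "tensor_eq (x @ y) (y @ x)"
| tensor_add_left: "tensor_eq [(a + a', b)] [(a, b), (a', b)]"
| tensor_add_right: "tensor_eq [(a, b + b')] [(a, b), (a, b')]"
| tensor_scale: "tensor_eq [(c *\<^sub>C a, b)] [(a, c *\<^sub>C b)]"
| tensor_zero: "tensor_eq [(0, b)] []"

quotient_type (overloaded) ('a, 'b) tensor =
  "('a::complex_star_algebra \<times> 'b::complex_star_algebra) list" / tensor_eq
  by (auto intro!: equivpI reflpI sympI transpI intro: tensor_eq.intros)

lift_definition pure_tensor ::
  "'a::complex_star_algebra \<Rightarrow> 'b::complex_star_algebra \<Rightarrow> ('a, 'b) tensor"  (infix \<open>\<otimes>\<^sub>C\<close> 76)
  is "\<lambda>a b. [(a, b)]" .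

lemma tensor_zero_right: "tensor_eq [(a, 0)] []"
  using tensor_scale[of 0 a 0] tensor_zero[of 0]
  unfolding scaleC_zero_left by (blast intro: tensor_sym tensor_trans)

text \<open>A map of formal sums that is additive and respects the bilinearity relations descends.\<close>

lemma tensor_eq_concat_map:
  fixes F :: "'a::complex_star_algebra \<times> 'b::complex_star_algebra
    \<Rightarrow> ('c::complex_star_algebra \<times> 'd::complex_star_algebra) list"
  assumes "tensor_eq x y"
    and "\<And>a a' b. tensor_eq (F (a + a', b)) (F (a, b) @ F (a', b))"
    and "\<And>a b b'. tensor_eq (F (a, b + b')) (F (a, b) @ F (a, b'))"
    and "\<And>c a b. tensor_eq (F (c *\<^sub>C a, b)) (F (a, c *\<^sub>C b))"
    and "\<And>b. tensor_eq (F (0, b)) []"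
  shows "tensor_eq (concat (map F x)) (concat (map F y))"
  using assms(1)
  by induction (auto intro: tensor_eq.intros assms(2-))

lemma tensor_eq_map:
  fixes F :: "'a::complex_star_algebra \<times> 'b::complex_star_algebra
    \<Rightarrow> 'c::complex_star_algebra \<times> 'd::complex_star_algebra"
  assumes "tensor_eq x y"
    and "\<And>a a' b. tensor_eq [F (a + a', b)] [F (a, b), F (a', b)]"
    and "\<And>a b b'. tensor_eq [F (a, b + b')] [F (a, b), F (a, b')]"
    and "\<And>c a b. tensor_eq [F (c *\<^sub>C a, b)] [F (a, c *\<^sub>C b)]"
    and "\<And>b. tensor_eq [F (0, b)] []"
  shows "tensor_eq (map F x) (map F y)"
  using tensor_eq_concat_map[OF assms(1), of "\<lambda>p. [F p]"] assms(2-) by simp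

definition tensor_times_list ::
  "('a::complex_star_algebra \<times> 'b::complex_star_algebra) list \<Rightarrow> ('a \<times> 'b) list \<Rightarrow> ('a \<times> 'b) list" where
  "tensor_times_list x y = concat (map (\<lambda>(a, b). map (\<lambda>(c, d). (a * c, b * d)) y) x)"

lemma tensor_times_list_simps [simp]:
  "tensor_times_list [] y = []"
  "tensor_times_list (p # x) y = map (\<lambda>(c, d). (fst p * c, snd p * d)) y @ tensor_times_list x y"
  "tensor_times_list (x @ x') y = tensor_times_list x y @ tensor_times_list x' y"
  by (auto simp: tensor_times_list_def case_prod_beta)

lemma tensor_swap_middle: "tensor_eq ((x @ y) @ (z @ w)) ((x @ z) @ (y @ w))"
proof -
  have "tensor_eq (x @ (y @ z) @ w) (x @ (z @ y) @ w)"
    by (intro tensor_append tensor_refl tensor_comm)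
  then show ?thesis by simp
qed

lemma tensor_map_add:
  "tensor_eq (map (\<lambda>(c, d). ((a + a') * c, b * d)) y)
     (map (\<lambda>(c, d). (a * c, b * d)) y @ map (\<lambda>(c, d). (a' * c, b * d)) y)"
proof (induction y)
  case (Cons p y)
  obtain c d where p: "p = (c, d)" by (cases p)
  have "tensor_eq ([((a + a') * c, b * d)] @ map (\<lambda>(c, d). ((a + a') * c, b * d)) y)
    (([(a * c, b * d)] @ [(a' * c, b * d)]) @
      (map (\<lambda>(c, d). (a * c, b * d)) y @ map (\<lambda>(c, d). (a' * c, b * d)) y))"
    by (intro tensor_append Cons) (simp add: distrib_right tensor_add_left)
  from tensor_trans[OF this tensor_swap_middle] show ?case by (simp add: p)
qed (simp add: tensor_refl)

lemma tensor_map_add':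
  "tensor_eq (map (\<lambda>(c, d). (a * c, (b + b') * d)) y)
     (map (\<lambda>(c, d). (a * c, b * d)) y @ map (\<lambda>(c, d). (a * c, b' * d)) y)"
proof (induction y)
  case (Cons p y)
  obtain c d where p: "p = (c, d)" by (cases p)
  have "tensor_eq ([(a * c, (b + b') * d)] @ map (\<lambda>(c, d). (a * c, (b + b') * d)) y)
    (([(a * c, b * d)] @ [(a * c, b' * d)]) @
      (map (\<lambda>(c, d). (a * c, b * d)) y @ map (\<lambda>(c, d). (a * c, b' * d)) y))"
    by (intro tensor_append Cons) (simp add: distrib_right tensor_add_right)
  from tensor_trans[OF this tensor_swap_middle] show ?case by (simp add: p)
qed (simp add: tensor_refl)

lemma tensor_eq_map_pointwise:
  assumes "\<And>p. tensor_eq [F p] [G p]"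
  shows "tensor_eq (map F y) (map G y)"
proof (induction y)
  case (Cons p y)
  from tensor_append[OF assms[of p] Cons] show ?case by simp
qed (simp add: tensor_refl)

lemma tensor_eq_map_zero:
  assumes "\<And>p. tensor_eq [F p] []"
  shows "tensor_eq (map F y) []"
proof (induction y)
  case (Cons p y)
  from tensor_append[OF assms[of p] Cons] show ?case by simp
qed (simp add: tensor_refl)

lemma tensor_times_list_cong_left:
  assumes "tensor_eq x x'"
  shows "tensor_eq (tensor_times_list x y) (tensor_times_list x' y)"
  unfolding tensor_times_list_def using assms
  by (rule tensor_eq_concat_map)
     (auto intro!: tensor_map_add tensor_map_add' tensor_eq_map_pointwise tensor_eq_map_zero
           simp: mult_scaleC_left tensor_scale tensor_zero split_beta)

lemma tensor_times_list_cong_right: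
  assumes "tensor_eq y y'"
  shows "tensor_eq (tensor_times_list x y) (tensor_times_list x y')"
proof (induction x)
  case (Cons p x)
  have "tensor_eq (map (\<lambda>(c, d). (fst p * c, snd p * d)) y) (map (\<lambda>(c, d). (fst p * c, snd p * d)) y')"
    using assms
    by (rule tensor_eq_map)
       (auto simp: distrib_left mult_scaleC_right intro: tensor_add_left tensor_add_right tensor_scale tensor_zero)
  from tensor_append[OF this Cons] show ?case by simp
qed (simp add: tensor_refl)

lemma tensor_times_list_append_right:
  "tensor_eq (tensor_times_list x (y @ y')) (tensor_times_list x y @ tensor_times_list x y')"
proof (induction x)
  case (Cons p x)
  let ?m = "map (\<lambda>(c, d). (fst p * c, snd p * d))"
  have "tensor_eq ((?m y @ ?m y') @ tensor_times_list x (y @ y'))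
     ((?m y @ ?m y') @ (tensor_times_list x y @ tensor_times_list x y'))"
    by (intro tensor_append tensor_refl Cons)
  from tensor_trans[OF this tensor_swap_middle] show ?case by simp
qed (simp add: tensor_refl)

lemma tensor_times_list_map:
  "tensor_times_list (map (\<lambda>(c, d). (a * c, b * d)) y) z
    = map (\<lambda>(c, d). (a * c, b * d)) (tensor_times_list y z)"
  by (induction y) (auto simp: mult.assoc)

lemma tensor_times_list_assoc:
  "tensor_times_list (tensor_times_list x y) z = tensor_times_list x (tensor_times_list y z)"
  by (induction x) (auto simp: tensor_times_list_map)

text \<open>Nontriviality of \<open>1 \<otimes> 1\<close> uses a linear functional that does not vanish on \<open>1\<close>.\<close>

lemma ex_functional:
  "\<exists>\<phi>::'a::complex_star_algebra \<Rightarrow> complex. C_linear \<phi> \<and> \<phi> 1 \<noteq> 0"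
proof -
  interpret vector_space_pair "scaleC :: complex \<Rightarrow> 'a \<Rightarrow> 'a" "(*) :: complex \<Rightarrow> complex \<Rightarrow> complex"
    by unfold_locales
       (auto simp: scaleC_add_right scaleC_add_left scaleC_scaleC scaleC_one algebra_simps)
  have "vs1.independent {1::'a}" by (simp add: vs1.independent_insert)
  from linear_independent_extend[OF this, of "\<lambda>_. 1"]
  obtain g :: "'a \<Rightarrow> complex" where g: "Vector_Spaces.linear scaleC (*) g" "g 1 = 1" by auto
  interpret g: Vector_Spaces.linear scaleC "(*)" g by fact
  from g(2) show ?thesis
    by (intro exI[of _ g]) (auto simp: C_linear_def scaleC_complex_def g.add g.scale)
qed

lemma tensor_eq_functional:
  assumes "tensor_eq x y" "C_linear \<phi>" "C_linear \<psi>"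
  shows "(\<Sum>(a, b)\<leftarrow>x. \<phi> a * \<psi> b :: complex) = (\<Sum>(a, b)\<leftarrow>y. \<phi> a * \<psi> b)"
  using assms
  by (induction) (auto simp: C_linear_def scaleC_complex_def algebra_simps C_linear_zero)

lemma tensor_eq_map_scale:
  assumes "tensor_eq x y"
  shows "tensor_eq (map (\<lambda>(a, b). (c *\<^sub>C a, b)) x) (map (\<lambda>(a, b). (c *\<^sub>C a, b)) y)"
  using assms
proof (rule tensor_eq_map, goal_cases)
  case (3 d a b)
  have "c *\<^sub>C d *\<^sub>C a = d *\<^sub>C c *\<^sub>C a" by (simp add: scaleC_scaleC mult.commute)
  then show ?case by (simp add: tensor_scale)
qed (simp_all add: scaleC_add_right scaleC_zero_right tensor_add_left tensor_add_right tensor_zero)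

lemma tensor_eq_map_uminus:
  assumes "tensor_eq x y"
  shows "tensor_eq (map (\<lambda>(a, b). (- a, b)) x) (map (\<lambda>(a, b). (- a, b)) y)"
  using tensor_eq_map_scale[OF assms, of "-1"] by (simp add: scaleC_minus_one)

instantiation tensor :: (complex_star_algebra, complex_star_algebra) complex_star_algebra
begin

lift_definition zero_tensor :: "('a, 'b) tensor" is "[]" .
lift_definition one_tensor :: "('a, 'b) tensor" is "[(1, 1)]" .
lift_definition plus_tensor :: "('a, 'b) tensor \<Rightarrow> ('a, 'b) tensor \<Rightarrow> ('a, 'b) tensor"
  is "(@)" by (rule tensor_append)
lift_definition uminus_tensor :: "('a, 'b) tensor \<Rightarrow> ('a, 'b) tensor"
  is "map (\<lambda>(a, b). (- a, b))"
  by (rule tensor_eq_map_uminus)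
definition minus_tensor :: "('a, 'b) tensor \<Rightarrow> ('a, 'b) tensor \<Rightarrow> ('a, 'b) tensor"
  where "minus_tensor x y = x + (- y)"
lift_definition times_tensor :: "('a, 'b) tensor \<Rightarrow> ('a, 'b) tensor \<Rightarrow> ('a, 'b) tensor"
  is tensor_times_list
  by (blast intro: tensor_trans tensor_times_list_cong_left tensor_times_list_cong_right)
lift_definition scaleC_tensor :: "complex \<Rightarrow> ('a, 'b) tensor \<Rightarrow> ('a, 'b) tensor"
  is "\<lambda>c. map (\<lambda>(a, b). (c *\<^sub>C a, b))"
  by (rule tensor_eq_map_scale)
lift_definition star_tensor :: "('a, 'b) tensor \<Rightarrow> ('a, 'b) tensor"
  is "map (\<lambda>(a, b). (star a, star b))"
  by (erule tensor_eq_map) (auto intro: tensor_eq.intros simp: star_add star_scaleC star_zero)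

instance
proof
  fix x y z :: "('a, 'b) tensor" and c d :: complex
  show "x + y + z = x + (y + z)" by transfer (simp add: tensor_refl)
  show "x + y = y + x" by transfer (rule tensor_comm)
  show "0 + x = x" by transfer (simp add: tensor_refl)
  show "- x + x = 0"
  proof transfer
    fix x :: "('a \<times> 'b) list"
    show "tensor_eq (map (\<lambda>(a, b). (- a, b)) x @ x) []"
    proof (induction x)
      case (Cons p x)
      obtain a b where p: "p = (a, b)" by (cases p)
      have "tensor_eq [(- a, b), (a, b)] []"
        using tensor_add_left[of "- a" a b] tensor_zero[of b]
        by simp (blast intro: tensor_sym tensor_trans)
      from tensor_append[OF this Cons]
      have "tensor_eq (([(- a, b)] @ [(a, b)]) @ (map (\<lambda>(a, b). (- a, b)) x @ x)) []" by simp
      from tensor_trans[OF tensor_swap_middle this] show ?case by (simp add: p)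
    qed (simp add: tensor_refl)
  qed
  show "x - y = x + - y" by (rule minus_tensor_def)
  show "x * y * z = x * (y * z)" by transfer (simp add: tensor_times_list_assoc tensor_refl)
  show "(x + y) * z = x * z + y * z" by transfer (simp add: tensor_refl)
  show "x * (y + z) = x * y + x * z" by transfer (rule tensor_times_list_append_right)
  show "1 * x = x" by transfer (simp add: tensor_refl case_prod_beta)
  show "x * 1 = x"
  proof transfer
    fix x :: "('a \<times> 'b) list"
    have "tensor_times_list x [(1, 1)] = x" by (induction x) auto
    then show "tensor_eq (tensor_times_list x [(1, 1)]) x" by (simp add: tensor_refl)
  qed
  show "(0::('a, 'b) tensor) \<noteq> 1"
  proof transfer
    obtain \<phi> :: "'a \<Rightarrow> complex" where \<phi>: "C_linear \<phi>" "\<phi> 1 \<noteq> 0" using ex_functional by blast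
    obtain \<psi> :: "'b \<Rightarrow> complex" where \<psi>: "C_linear \<psi>" "\<psi> 1 \<noteq> 0" using ex_functional by blast
    show "\<not> tensor_eq [] [(1::'a, 1::'b)]"
      using tensor_eq_functional[OF _ \<phi>(1) \<psi>(1), of "[]" "[(1, 1)]"] \<phi>(2) \<psi>(2) by auto
  qed
  show "c *\<^sub>C (x + y) = c *\<^sub>C x + c *\<^sub>C y" by transfer (simp add: tensor_refl)
  show "(c + d) *\<^sub>C x = c *\<^sub>C x + d *\<^sub>C x"
  proof transfer
    fix c d and x :: "('a \<times> 'b) list"
    show "tensor_eq (map (\<lambda>(a, b). ((c + d) *\<^sub>C a, b)) x)
      (map (\<lambda>(a, b). (c *\<^sub>C a, b)) x @ map (\<lambda>(a, b). (d *\<^sub>C a, b)) x)"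
    proof (induction x)
      case (Cons p x)
      obtain a b where p: "p = (a, b)" by (cases p)
      have "tensor_eq ([((c + d) *\<^sub>C a, b)] @ map (\<lambda>(a, b). ((c + d) *\<^sub>C a, b)) x)
        (([(c *\<^sub>C a, b)] @ [(d *\<^sub>C a, b)]) @
          (map (\<lambda>(a, b). (c *\<^sub>C a, b)) x @ map (\<lambda>(a, b). (d *\<^sub>C a, b)) x))"
        by (intro tensor_append Cons) (simp add: scaleC_add_left tensor_add_left)
      from tensor_trans[OF this tensor_swap_middle] show ?case by (simp add: p)
    qed (simp add: tensor_refl)
  qed
  show "c *\<^sub>C d *\<^sub>C x = (c * d) *\<^sub>C x"
    by transfer (simp add: scaleC_scaleC split_def comp_def tensor_refl)
  show "1 *\<^sub>C x = x" by transfer (simp add: scaleC_one tensor_refl)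
  show "(c *\<^sub>C x) * y = c *\<^sub>C (x * y)"
  proof transfer
    fix c and x y :: "('a \<times> 'b) list"
    have "tensor_times_list (map (\<lambda>(a, b). (c *\<^sub>C a, b)) x) y
      = map (\<lambda>(a, b). (c *\<^sub>C a, b)) (tensor_times_list x y)"
      by (induction x) (auto simp: mult_scaleC_left)
    then show "tensor_eq (tensor_times_list (map (\<lambda>(a, b). (c *\<^sub>C a, b)) x) y)
      (map (\<lambda>(a, b). (c *\<^sub>C a, b)) (tensor_times_list x y))" by (simp add: tensor_refl)
  qed
  show "x * (c *\<^sub>C y) = c *\<^sub>C (x * y)"
  proof transfer
    fix c and x y :: "('a \<times> 'b) list"
    have "tensor_times_list x (map (\<lambda>(a, b). (c *\<^sub>C a, b)) y)
      = map (\<lambda>(a, b). (c *\<^sub>C a, b)) (tensor_times_list x y)"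
      by (induction x) (auto simp: mult_scaleC_right)
    then show "tensor_eq (tensor_times_list x (map (\<lambda>(a, b). (c *\<^sub>C a, b)) y))
      (map (\<lambda>(a, b). (c *\<^sub>C a, b)) (tensor_times_list x y))" by (simp add: tensor_refl)
  qed
  show "star (star x) = x"
    by transfer (simp add: star_star split_def comp_def tensor_refl)
  show "star (x + y) = star x + star y" by transfer (simp add: tensor_refl)
  show "star (x * y) = star y * star x"
  proof transfer
    fix x y :: "('a \<times> 'b) list"
    let ?s = "map (\<lambda>(a::'a, b::'b). (star a, star b))"
    show "tensor_eq (?s (tensor_times_list x y)) (tensor_times_list (?s y) (?s x))"
    proof (induction x)
      case Nil
      have "tensor_times_list z [] = []" for z :: "('a \<times> 'b) list" by (induction z) auto
      then show ?case by (simp add: tensor_refl)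
    next
      case (Cons p x)
      have "?s (map (\<lambda>(c, d). (fst p * c, snd p * d)) y) = tensor_times_list (?s y) (?s [p])"
        by (induction y) (auto simp: star_mult split: prod.splits)
      then have "tensor_eq (?s (tensor_times_list (p # x) y))
        (tensor_times_list (?s y) (?s [p]) @ tensor_times_list (?s y) (?s x))"
        using tensor_append[OF tensor_refl Cons] by simp
      from tensor_trans[OF this tensor_sym[OF tensor_times_list_append_right]] show ?case by simp
    qed
  qed
  show "star (c *\<^sub>C x) = cnj c *\<^sub>C star x"
    by transfer (simp add: star_scaleC split_def comp_def tensor_refl)
qed

end

lemma pure_tensor_mult: "(a \<otimes>\<^sub>C b) * (c \<otimes>\<^sub>C d) = (a * c) \<otimes>\<^sub>C (b * d)"
  by transfer (simp add: tensor_refl)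

lemma pure_tensor_star: "star (a \<otimes>\<^sub>C b) = star a \<otimes>\<^sub>C star b"
  by transfer (simp add: tensor_refl)

text \<open>The map \<open>f \<otimes> g\<close>; it is independent of the representative for linear \<open>f\<close> and \<open>g\<close>.\<close>

definition tensor_map ::
  "('a::complex_star_algebra \<Rightarrow> 'c::complex_star_algebra) \<Rightarrow>
   ('b::complex_star_algebra \<Rightarrow> 'd::complex_star_algebra) \<Rightarrow> ('a, 'b) tensor \<Rightarrow> ('c, 'd) tensor" where
  "tensor_map f g t = (\<Sum>(a, b)\<leftarrow>rep_tensor t. f a \<otimes>\<^sub>C g b)"

lemma abs_tensor_eq_sum_list: "abs_tensor x = (\<Sum>(a, b)\<leftarrow>x. a \<otimes>\<^sub>C b)"
proof (induction x)
  case (Cons p x)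
  have "abs_tensor (p # x) = abs_tensor [p] + abs_tensor x" by (simp add: plus_tensor.abs_eq)
  with Cons show ?case by (simp add: pure_tensor.abs_eq split_beta)
qed (simp add: zero_tensor_def)

lemma tensor_map_abs:
  assumes "C_linear f" "C_linear g"
  shows "tensor_map f g (abs_tensor x) = (\<Sum>(a, b)\<leftarrow>x. f a \<otimes>\<^sub>C g b)"
proof -
  have *: "(\<Sum>(a, b)\<leftarrow>y. f a \<otimes>\<^sub>C g b) = abs_tensor (map (\<lambda>(a, b). (f a, g b)) y)" for y
    by (induction y) (auto simp: abs_tensor_eq_sum_list)
  have "tensor_eq (rep_tensor (abs_tensor x)) x"
    by (metis Quotient_rep_abs Quotient_tensor tensor_refl)
  then have "tensor_eq (map (\<lambda>(a, b). (f a, g b)) (rep_tensor (abs_tensor x)))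
      (map (\<lambda>(a, b). (f a, g b)) x)"
    by (rule tensor_eq_map)
       (use assms in \<open>auto intro: tensor_eq.intros simp: C_linear_zero\<close>,
        use assms in \<open>auto intro: tensor_eq.intros simp: C_linear_def\<close>)
  then show ?thesis
    by (simp add: tensor_map_def * tensor.abs_eq_iff)
qed

lemma tensor_map_pure:
  "C_linear f \<Longrightarrow> C_linear g \<Longrightarrow> tensor_map f g (a \<otimes>\<^sub>C b) = f a \<otimes>\<^sub>C g b"
  by (simp add: pure_tensor.abs_eq tensor_map_abs)


section \<open>Unitary Hopf algebras\<close>

text \<open>The pair \<open>(A, u)\<close> determines the Hopf structure, because a *-algebra map (into \<open>A \<otimes> A\<close>,
  \<open>\<complex>\<close> or \<open>A\<^sup>o\<^sup>p\<close>) is determined by its values on generators; see the uniqueness lemmas below.\<close>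

definition adjoint_matrix :: "'a::complex_star_algebra^'m^'n \<Rightarrow> 'a^'n^'m" where
  "adjoint_matrix u = (\<chi> i j. star (u $ j $ i))"

definition conjugate_matrix :: "'a::complex_star_algebra^'m^'n \<Rightarrow> 'a^'m^'n" where
  "conjugate_matrix u = (\<chi> i j. star (u $ i $ j))"

definition unitary_matrix :: "'a::complex_star_algebra^'m^'m \<Rightarrow> bool" where
  "unitary_matrix u \<longleftrightarrow> u ** adjoint_matrix u = mat 1 \<and> adjoint_matrix u ** u = mat 1"

definition is_comultiplication ::
  "'a::complex_star_algebra^'m^'m \<Rightarrow> ('a \<Rightarrow> ('a, 'a) tensor) \<Rightarrow> bool" where
  "is_comultiplication u \<Delta> \<longleftrightarrow>
     star_hom \<Delta> \<and> (\<forall>i j. \<Delta> (u $ i $ j) = (\<Sum>k\<in>UNIV. u $ i $ k \<otimes>\<^sub>C u $ k $ j))"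

definition is_counit :: "'a::complex_star_algebra^'m^'m \<Rightarrow> ('a \<Rightarrow> complex) \<Rightarrow> bool" where
  "is_counit u \<epsilon> \<longleftrightarrow> star_hom \<epsilon> \<and> (\<forall>i j. \<epsilon> (u $ i $ j) = (if i = j then 1 else 0))"

definition is_antipode :: "'a::complex_star_algebra^'m^'m \<Rightarrow> ('a \<Rightarrow> 'a) \<Rightarrow> bool" where
  "is_antipode u S \<longleftrightarrow> star_hom_op S \<and> (\<forall>i j. S (u $ i $ j) = star (u $ j $ i))"

definition generates :: "'a::complex_star_algebra^'m^'m \<Rightarrow> bool" where
  "generates u \<longleftrightarrow> star_subalgebra hull {u $ i $ j | i j. True} = UNIV"

definition unitary_hopf_algebra :: "'a::complex_star_algebra^'m^'m \<Rightarrow> bool" where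
  "unitary_hopf_algebra u \<longleftrightarrow>
     generates u \<and> unitary_matrix u \<and> unitary_matrix (conjugate_matrix u)
     \<and> (\<exists>\<Delta>. is_comultiplication u \<Delta>) \<and> (\<exists>\<epsilon>. is_counit u \<epsilon>) \<and> (\<exists>S. is_antipode u S)"

definition comultiplication :: "'a::complex_star_algebra^'m^'m \<Rightarrow> 'a \<Rightarrow> ('a, 'a) tensor" where
  "comultiplication u = (THE \<Delta>. is_comultiplication u \<Delta>)"

definition counit :: "'a::complex_star_algebra^'m^'m \<Rightarrow> 'a \<Rightarrow> complex" where
  "counit u = (THE \<epsilon>. is_counit u \<epsilon>)"

definition antipode :: "'a::complex_star_algebra^'m^'m \<Rightarrow> 'a \<Rightarrow> 'a" where
  "antipode u = (THE S. is_antipode u S)"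

lemma star_subalgebra_equalizer:
  "star_hom f \<Longrightarrow> star_hom g \<Longrightarrow> star_subalgebra {x. f x = g x}"
  "star_hom_op f \<Longrightarrow> star_hom_op g \<Longrightarrow> star_subalgebra {x. f x = g x}"
  by (auto simp: star_subalgebra_def star_hom_def star_hom_op_def C_linear_def)

lemma generates_induct:
  assumes "generates u" "star_subalgebra {x. P x}" "\<And>i j. P (u $ i $ j)"
  shows "P x"
proof (rule hull_induct[where Q = star_subalgebra and S = "{u $ i $ j | i j. True}"])
  show "x \<in> star_subalgebra hull {u $ i $ j |i j. True}"
    using assms(1) by (simp add: generates_def)
qed (use assms in auto)

lemma comultiplication_unique:
  assumes "generates u" "is_comultiplication u \<Delta>"
  shows "comultiplication u = \<Delta>"
  unfolding comultiplication_def
proof (rule the_equality)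
  fix \<Delta>' assume "is_comultiplication u \<Delta>'"
  then have *: "star_subalgebra {x. \<Delta>' x = \<Delta> x}" "\<And>i j. \<Delta>' (u $ i $ j) = \<Delta> (u $ i $ j)"
    using assms(2) by (auto simp: is_comultiplication_def intro: star_subalgebra_equalizer)
  show "\<Delta>' = \<Delta>"
    by (rule ext) (rule generates_induct[OF assms(1) *])
qed fact

lemma counit_unique:
  assumes "generates u" "is_counit u \<epsilon>"
  shows "counit u = \<epsilon>"
  unfolding counit_def
proof (rule the_equality)
  fix \<epsilon>' assume "is_counit u \<epsilon>'"
  then have *: "star_subalgebra {x. \<epsilon>' x = \<epsilon> x}" "\<And>i j. \<epsilon>' (u $ i $ j) = \<epsilon> (u $ i $ j)"
    using assms(2) by (auto simp: is_counit_def intro: star_subalgebra_equalizer)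
  show "\<epsilon>' = \<epsilon>"
    by (rule ext) (rule generates_induct[OF assms(1) *])
qed fact

lemma antipode_unique:
  assumes "generates u" "is_antipode u S"
  shows "antipode u = S"
  unfolding antipode_def
proof (rule the_equality)
  fix S' assume "is_antipode u S'"
  then have *: "star_subalgebra {x. S' x = S x}" "\<And>i j. S' (u $ i $ j) = S (u $ i $ j)"
    using assms(2) by (auto simp: is_antipode_def intro: star_subalgebra_equalizer)
  show "S' = S"
    by (rule ext) (rule generates_induct[OF assms(1) *])
qed fact

definition hopf_star_hom ::
  "'a::complex_star_algebra^'m^'m \<Rightarrow> 'b::complex_star_algebra^'k^'k \<Rightarrow> ('a \<Rightarrow> 'b) \<Rightarrow> bool" where
  "hopf_star_hom u v f \<longleftrightarrow> star_hom f
     \<and> (\<forall>x. comultiplication v (f x) = tensor_map f f (comultiplication u x))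
     \<and> (\<forall>x. counit v (f x) = counit u x)
     \<and> (\<forall>x. antipode v (f x) = f (antipode u x))"


section \<open>The half-liberated orthogonal quantum group\<close>

subsection \<open>The free *-algebra on a set of generators\<close>

datatype 'x star_term =
    Gen 'x | Zero | One | Scale complex "'x star_term" | Neg "'x star_term"
  | Add "'x star_term" "'x star_term" | Mul "'x star_term" "'x star_term" | Star "'x star_term"

text \<open>The congruence generated by the axioms of complex *-algebras.\<close>

inductive star_term_eq :: "'x star_term \<Rightarrow> 'x star_term \<Rightarrow> bool"  (infix \<open>\<approx>\<^sub>s\<close> 50) where
  refl: "x \<approx>\<^sub>s x"
| sym: "x \<approx>\<^sub>s y \<Longrightarrow> y \<approx>\<^sub>s x"
| trans: "x \<approx>\<^sub>s y \<Longrightarrow> y \<approx>\<^sub>s z \<Longrightarrow> x \<approx>\<^sub>s z"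
| Scale: "x \<approx>\<^sub>s y \<Longrightarrow> Scale c x \<approx>\<^sub>s Scale c y"
| Neg: "x \<approx>\<^sub>s y \<Longrightarrow> Neg x \<approx>\<^sub>s Neg y"
| Add: "x \<approx>\<^sub>s x' \<Longrightarrow> y \<approx>\<^sub>s y' \<Longrightarrow> Add x y \<approx>\<^sub>s Add x' y'"
| Mul: "x \<approx>\<^sub>s x' \<Longrightarrow> y \<approx>\<^sub>s y' \<Longrightarrow> Mul x y \<approx>\<^sub>s Mul x' y'"
| Star: "x \<approx>\<^sub>s y \<Longrightarrow> Star x \<approx>\<^sub>s Star y"
| add_assoc: "Add (Add x y) z \<approx>\<^sub>s Add x (Add y z)"
| add_comm: "Add x y \<approx>\<^sub>s Add y x"
| add_zero: "Add Zero x \<approx>\<^sub>s x"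
| add_neg: "Add (Neg x) x \<approx>\<^sub>s Zero"
| mul_assoc: "Mul (Mul x y) z \<approx>\<^sub>s Mul x (Mul y z)"
| one_mul: "Mul One x \<approx>\<^sub>s x"
| mul_one: "Mul x One \<approx>\<^sub>s x"
| distrib_right: "Mul (Add x y) z \<approx>\<^sub>s Add (Mul x z) (Mul y z)"
| distrib_left: "Mul x (Add y z) \<approx>\<^sub>s Add (Mul x y) (Mul x z)"
| scale_add_right: "Scale c (Add x y) \<approx>\<^sub>s Add (Scale c x) (Scale c y)"
| scale_add_left: "Scale (c + d) x \<approx>\<^sub>s Add (Scale c x) (Scale d x)"
| scale_scale: "Scale c (Scale d x) \<approx>\<^sub>s Scale (c * d) x"
| scale_one: "Scale 1 x \<approx>\<^sub>s x"
| scale_mul_left: "Mul (Scale c x) y \<approx>\<^sub>s Scale c (Mul x y)"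
| scale_mul_right: "Mul x (Scale c y) \<approx>\<^sub>s Scale c (Mul x y)"
| star_star: "Star (Star x) \<approx>\<^sub>s x"
| star_add: "Star (Add x y) \<approx>\<^sub>s Add (Star x) (Star y)"
| star_mul: "Star (Mul x y) \<approx>\<^sub>s Mul (Star y) (Star x)"
| star_scale: "Star (Scale c x) \<approx>\<^sub>s Scale (cnj c) (Star x)"

hide_fact (open) refl sym trans Scale Neg Add Mul Star add_assoc add_comm add_zero add_neg mul_assoc
  one_mul mul_one distrib_right distrib_left scale_add_right scale_add_left scale_scale
  scale_one scale_mul_left scale_mul_right star_star star_add star_mul star_scale

primrec eval_term :: "('x \<Rightarrow> 'a) \<Rightarrow> 'x star_term \<Rightarrow> 'a::complex_star_algebra" where
  "eval_term \<rho> (Gen i) = \<rho> i"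
| "eval_term \<rho> Zero = 0"
| "eval_term \<rho> One = 1"
| "eval_term \<rho> (Scale c x) = c *\<^sub>C eval_term \<rho> x"
| "eval_term \<rho> (Neg x) = - eval_term \<rho> x"
| "eval_term \<rho> (Add x y) = eval_term \<rho> x + eval_term \<rho> y"
| "eval_term \<rho> (Mul x y) = eval_term \<rho> x * eval_term \<rho> y"
| "eval_term \<rho> (Star x) = star (eval_term \<rho> x)"

lemma eval_term_cong: "x \<approx>\<^sub>s y \<Longrightarrow> eval_term \<rho> x = eval_term \<rho> y"
  by (induction rule: star_term_eq.induct)
     (auto simp: algebra_simps scaleC_add_left scaleC_add_right scaleC_scaleC scaleC_one
        mult_scaleC_left mult_scaleC_right star_star star_add star_mult star_scaleC)

quotient_type 'x free_star_algebra = "'x star_term" / star_term_eq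
  by (auto intro!: equivpI reflpI sympI transpI intro: star_term_eq.intros)

lift_definition free_gen :: "'x \<Rightarrow> 'x free_star_algebra" is Gen .

instantiation free_star_algebra :: (type) complex_star_algebra
begin

lift_definition zero_free_star_algebra :: "'a free_star_algebra" is Zero .
lift_definition one_free_star_algebra :: "'a free_star_algebra" is One .
lift_definition plus_free_star_algebra ::
  "'a free_star_algebra \<Rightarrow> 'a free_star_algebra \<Rightarrow> 'a free_star_algebra" is Add
  by (rule star_term_eq.Add)
lift_definition uminus_free_star_algebra :: "'a free_star_algebra \<Rightarrow> 'a free_star_algebra" is Neg
  by (rule star_term_eq.Neg)
definition minus_free_star_algebra ::
  "'a free_star_algebra \<Rightarrow> 'a free_star_algebra \<Rightarrow> 'a free_star_algebra"
  where "minus_free_star_algebra x y = x + (- y)"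
lift_definition times_free_star_algebra ::
  "'a free_star_algebra \<Rightarrow> 'a free_star_algebra \<Rightarrow> 'a free_star_algebra" is Mul
  by (rule star_term_eq.Mul)
lift_definition scaleC_free_star_algebra ::
  "complex \<Rightarrow> 'a free_star_algebra \<Rightarrow> 'a free_star_algebra" is Scale
  by (rule star_term_eq.Scale)
lift_definition star_free_star_algebra :: "'a free_star_algebra \<Rightarrow> 'a free_star_algebra" is Star
  by (rule star_term_eq.Star)

instance
proof
  show "(0::'a free_star_algebra) \<noteq> 1"
  proof transfer
    show "\<not> Zero \<approx>\<^sub>s (One :: 'a star_term)"
      using eval_term_cong[of Zero One "\<lambda>_. 0::complex"] by auto
  qed
  fix x y z :: "'a free_star_algebra" and c d :: complex
  show "x - y = x + - y" by (rule minus_free_star_algebra_def)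
  show "x + y + z = x + (y + z)" by transfer (rule star_term_eq.add_assoc)
  show "x + y = y + x" by transfer (rule star_term_eq.add_comm)
  show "0 + x = x" by transfer (rule star_term_eq.add_zero)
  show "- x + x = 0" by transfer (rule star_term_eq.add_neg)
  show "x * y * z = x * (y * z)" by transfer (rule star_term_eq.mul_assoc)
  show "1 * x = x" by transfer (rule star_term_eq.one_mul)
  show "x * 1 = x" by transfer (rule star_term_eq.mul_one)
  show "(x + y) * z = x * z + y * z" by transfer (rule star_term_eq.distrib_right)
  show "x * (y + z) = x * y + x * z" by transfer (rule star_term_eq.distrib_left)
  show "c *\<^sub>C (x + y) = c *\<^sub>C x + c *\<^sub>C y" by transfer (rule star_term_eq.scale_add_right)
  show "(c + d) *\<^sub>C x = c *\<^sub>C x + d *\<^sub>C x" by transfer (rule star_term_eq.scale_add_left)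
  show "c *\<^sub>C d *\<^sub>C x = (c * d) *\<^sub>C x" by transfer (rule star_term_eq.scale_scale)
  show "1 *\<^sub>C x = x" by transfer (rule star_term_eq.scale_one)
  show "(c *\<^sub>C x) * y = c *\<^sub>C (x * y)" by transfer (rule star_term_eq.scale_mul_left)
  show "x * (c *\<^sub>C y) = c *\<^sub>C (x * y)" by transfer (rule star_term_eq.scale_mul_right)
  show "star (star x) = x" by transfer (rule star_term_eq.star_star)
  show "star (x + y) = star x + star y" by transfer (rule star_term_eq.star_add)
  show "star (x * y) = star y * star x" by transfer (rule star_term_eq.star_mul)
  show "star (c *\<^sub>C x) = cnj c *\<^sub>C star x" by transfer (rule star_term_eq.star_scale)
qed

end

lift_definition free_lift :: "('x \<Rightarrow> 'a::complex_star_algebra) \<Rightarrow> 'x free_star_algebra \<Rightarrow> 'a"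
  is eval_term by (rule eval_term_cong)

lemma free_lift_gen [simp]: "free_lift \<rho> (free_gen i) = \<rho> i"
  by transfer simp

lemma star_hom_free_lift: "star_hom (free_lift \<rho>)"
  unfolding star_hom_def C_linear_def by (intro conjI allI; transfer; simp)

lemma star_hom_free_unique:
  assumes "star_hom h" "\<And>i. h (free_gen i) = \<rho> i"
  shows "h = free_lift \<rho>"
proof
  fix x
  have "h (abs_free_star_algebra t) = eval_term \<rho> t" for t
  proof (induction t)
    case (Gen i)
    then show ?case using assms(2)[of i] by (simp add: free_gen.abs_eq)
  next
    case Zero
    then show ?case using assms(1)
      by (simp add: star_hom_def C_linear_zero flip: zero_free_star_algebra_def)
  next
    case One
    then show ?case using assms(1) by (simp add: star_hom_def flip: one_free_star_algebra_def)
  next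
    case (Scale c t)
    then show ?case using assms(1)
      by (simp add: star_hom_def C_linear_def flip: scaleC_free_star_algebra.abs_eq)
  next
    case (Neg t)
    then show ?case using assms(1)
      by (simp add: star_hom_def C_linear_minus flip: uminus_free_star_algebra.abs_eq)
  next
    case (Add s t)
    then show ?case using assms(1)
      by (simp add: star_hom_def C_linear_def flip: plus_free_star_algebra.abs_eq)
  next
    case (Mul s t)
    then show ?case using assms(1)
      by (simp add: star_hom_def flip: times_free_star_algebra.abs_eq)
  next
    case (Star t)
    then show ?case using assms(1)
      by (simp add: star_hom_def flip: star_free_star_algebra.abs_eq)
  qed
  then show "h x = free_lift \<rho> x"
    by (induction x rule: free_star_algebra.abs_induct) (simp add: free_lift.abs_eq)
qed

hide_const (open) Gen Zero One Scale Neg Add Mul Star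

subsection \<open>The algebra \<open>A\<^sub>o\<^sup>*(n)\<close>\<close>

text \<open>The matrix size \<open>n\<close> is \<open>CARD('n)\<close>.\<close>

definition half_liberated_relation :: "'a::complex_star_algebra^'n^'n \<Rightarrow> bool" where
  "half_liberated_relation u \<longleftrightarrow>
     (\<forall>i j. star (u $ i $ j) = u $ i $ j) \<and>
     (\<forall>i j k l p q. u $ i $ j * u $ k $ l * u $ p $ q = u $ p $ q * u $ k $ l * u $ i $ j) \<and>
     orthogonal_matrix u"

definition free_matrix :: "('n \<times> 'n) free_star_algebra^'n^'n" where
  "free_matrix = (\<chi> i j. free_gen (i, j))"

definition half_liberated_relators :: "('n::finite \<times> 'n) free_star_algebra set" where
  "half_liberated_relators = (let u = (free_matrix :: ('n \<times> 'n) free_star_algebra^'n^'n) in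
     {star (u $ i $ j) - u $ i $ j | i j. True}
   \<union> {u $ i $ j * u $ k $ l * u $ p $ q - u $ p $ q * u $ k $ l * u $ i $ j | i j k l p q. True}
   \<union> {(u ** transpose u) $ i $ j - mat 1 $ i $ j | i j. True}
   \<union> {(transpose u ** u) $ i $ j - mat 1 $ i $ j | i j. True})"

definition half_liberated_ideal :: "('n::finite \<times> 'n) free_star_algebra set" where
  "half_liberated_ideal = star_ideal hull half_liberated_relators"

lemma half_liberated_ideal: "star_ideal half_liberated_ideal"
  unfolding half_liberated_ideal_def by (rule star_ideal_hull)

lemma half_liberated_ideal_closed:
  "0 \<in> half_liberated_ideal"
  "x \<in> half_liberated_ideal \<Longrightarrow> y \<in> half_liberated_ideal \<Longrightarrow> x + y \<in> half_liberated_ideal"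
  "x \<in> half_liberated_ideal \<Longrightarrow> - x \<in> half_liberated_ideal"
  "x \<in> half_liberated_ideal \<Longrightarrow> c *\<^sub>C x \<in> half_liberated_ideal"
  "x \<in> half_liberated_ideal \<Longrightarrow> a * x \<in> half_liberated_ideal"
  "x \<in> half_liberated_ideal \<Longrightarrow> x * a \<in> half_liberated_ideal"
  "x \<in> half_liberated_ideal \<Longrightarrow> star x \<in> half_liberated_ideal"
  using half_liberated_ideal star_ideal_minus[OF half_liberated_ideal] by (auto simp: star_ideal_def)

lemma half_liberated_ideal_eq: "x = y \<Longrightarrow> x - y \<in> half_liberated_ideal"
  by (simp add: half_liberated_ideal_closed)

lemma half_liberated_ideal_eval:
  fixes v :: "'a::complex_star_algebra^'n::finite^'n"
  assumes "half_liberated_relation v" "x \<in> half_liberated_ideal"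
  shows "free_lift (\<lambda>(i, j). v $ i $ j) x = 0"
proof (rule hull_induct[OF assms(2)[unfolded half_liberated_ideal_def]])
  let ?h = "free_lift (\<lambda>(i, j). v $ i $ j)"
  have h: "star_hom ?h" by (rule star_hom_free_lift)
  then have lin: "C_linear ?h" by (simp add: star_hom_def)
  show "star_ideal {x. ?h x = 0}" by (rule star_ideal_kernel[OF h])
  have [simp]: "?h (free_matrix $ i $ j) = v $ i $ j" for i j by (simp add: free_matrix_def)
  have mult: "?h (x * y) = ?h x * ?h y" "?h (star x) = star (?h x)" "?h 1 = 1" "?h 0 = 0" for x y
    using h by (auto simp: star_hom_def C_linear_zero)
  have v: "transpose v ** v = mat 1" "v ** transpose v = mat 1"
    using assms(1) by (auto simp: half_liberated_relation_def orthogonal_matrix_def)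
  have "(\<Sum>k\<in>UNIV. v $ i $ k * v $ j $ k) = (if i = j then 1 else 0)" for i j
    using arg_cong[OF v(2), of "\<lambda>m. m $ i $ j"]
    by (simp add: matrix_matrix_mult_def transpose_def mat_def)
  moreover have "(\<Sum>k\<in>UNIV. v $ k $ i * v $ k $ j) = (if i = j then 1 else 0)" for i j
    using arg_cong[OF v(1), of "\<lambda>m. m $ i $ j"]
    by (simp add: matrix_matrix_mult_def transpose_def mat_def)
  ultimately show "x \<in> half_liberated_relators \<Longrightarrow> ?h x = 0" for x
    using assms(1)
    by (auto simp: half_liberated_relators_def Let_def C_linear_diff[OF lin] mult
          C_linear_sum[OF lin] half_liberated_relation_def matrix_matrix_mult_def transpose_def mat_def)
qed

quotient_type 'n half_liberated =
  "('n::finite \<times> 'n) free_star_algebra" / "\<lambda>x y. x - y \<in> half_liberated_ideal"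
proof (intro equivpI reflpI sympI transpI)
  fix x y z :: "('n \<times> 'n) free_star_algebra"
  show "x - x \<in> half_liberated_ideal" by (simp add: half_liberated_ideal_closed)
  show "x - y \<in> half_liberated_ideal \<Longrightarrow> y - x \<in> half_liberated_ideal"
    using half_liberated_ideal_closed(3)[of "x - y"] by simp
  show "x - y \<in> half_liberated_ideal \<Longrightarrow> y - z \<in> half_liberated_ideal \<Longrightarrow> x - z \<in> half_liberated_ideal"
    using half_liberated_ideal_closed(2)[of "x - y" "y - z"] by simp
qed

instantiation half_liberated :: (finite) complex_star_algebra
begin

lift_definition zero_half_liberated :: "'a half_liberated" is 0 .
lift_definition one_half_liberated :: "'a half_liberated" is 1 .
lift_definition plus_half_liberated :: "'a half_liberated \<Rightarrow> 'a half_liberated \<Rightarrow> 'a half_liberated"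
  is "(+)"
proof -
  fix x x' y y' :: "('a \<times> 'a) free_star_algebra"
  assume "x - x' \<in> half_liberated_ideal" "y - y' \<in> half_liberated_ideal"
  then have "(x - x') + (y - y') \<in> half_liberated_ideal"
    by (rule half_liberated_ideal_closed(2))
  then show "x + y - (x' + y') \<in> half_liberated_ideal" by (simp add: algebra_simps)
qed
lift_definition uminus_half_liberated :: "'a half_liberated \<Rightarrow> 'a half_liberated" is uminus
proof -
  fix x x' :: "('a \<times> 'a) free_star_algebra"
  assume "x - x' \<in> half_liberated_ideal"
  then have "- (x - x') \<in> half_liberated_ideal" by (rule half_liberated_ideal_closed(3))
  then show "- x - - x' \<in> half_liberated_ideal" by simp
qed
definition minus_half_liberated :: "'a half_liberated \<Rightarrow> 'a half_liberated \<Rightarrow> 'a half_liberated"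
  where "minus_half_liberated x y = x + (- y)"
lift_definition times_half_liberated :: "'a half_liberated \<Rightarrow> 'a half_liberated \<Rightarrow> 'a half_liberated"
  is "(*)"
proof -
  fix x x' y y' :: "('a \<times> 'a) free_star_algebra"
  assume "x - x' \<in> half_liberated_ideal" "y - y' \<in> half_liberated_ideal"
  then have "(x - x') * y + x' * (y - y') \<in> half_liberated_ideal"
    by (intro half_liberated_ideal_closed)
  then show "x * y - x' * y' \<in> half_liberated_ideal" by (simp add: algebra_simps)
qed
lift_definition scaleC_half_liberated :: "complex \<Rightarrow> 'a half_liberated \<Rightarrow> 'a half_liberated" is scaleC
  by (metis half_liberated_ideal_closed(4) scaleC_diff_right)
lift_definition star_half_liberated :: "'a half_liberated \<Rightarrow> 'a half_liberated" is star
  by (metis half_liberated_ideal_closed(7) star_diff)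

instance
proof
  show "(0::'a half_liberated) \<noteq> 1"
  proof transfer
    have "half_liberated_relation (mat 1 :: complex^'a^'a)"
      by (auto simp: half_liberated_relation_def mat_def star_complex_def)
         (auto simp: orthogonal_matrix_id simp flip: mat_def)
    from half_liberated_ideal_eval[OF this]
    have "free_lift (\<lambda>(i, j). (mat 1 :: complex^'a^'a) $ i $ j) (0 - 1) = 0"
      if "(0::('a \<times> 'a) free_star_algebra) - 1 \<in> half_liberated_ideal" using that .
    moreover have "free_lift (\<lambda>(i, j). (mat 1 :: complex^'a^'a) $ i $ j) (0 - 1) = - 1"
      using star_hom_free_lift[of "\<lambda>(i, j). (mat 1 :: complex^'a^'a) $ i $ j"]
      by (simp add: star_hom_def C_linear_minus)
    ultimately show "(0::('a \<times> 'a) free_star_algebra) - 1 \<notin> half_liberated_ideal" by force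
  qed
  fix x y z :: "'a half_liberated" and c d :: complex
  show "x - y = x + - y" by (rule minus_half_liberated_def)
  show "x + y + z = x + (y + z)"
    by transfer (rule half_liberated_ideal_eq, rule add.assoc)
  show "x + y = y + x"
    by transfer (rule half_liberated_ideal_eq, rule add.commute)
  show "0 + x = x"
    by transfer (rule half_liberated_ideal_eq, rule add_0_left)
  show "- x + x = 0"
    by transfer (rule half_liberated_ideal_eq, rule left_minus)
  show "x * y * z = x * (y * z)"
    by transfer (rule half_liberated_ideal_eq, rule mult.assoc)
  show "1 * x = x"
    by transfer (rule half_liberated_ideal_eq, rule mult_1_left)
  show "x * 1 = x"
    by transfer (rule half_liberated_ideal_eq, rule mult_1_right)
  show "(x + y) * z = x * z + y * z"
    by transfer (rule half_liberated_ideal_eq, rule distrib_right)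
  show "x * (y + z) = x * y + x * z"
    by transfer (rule half_liberated_ideal_eq, rule distrib_left)
  show "c *\<^sub>C (x + y) = c *\<^sub>C x + c *\<^sub>C y"
    by transfer (rule half_liberated_ideal_eq, rule scaleC_add_right)
  show "(c + d) *\<^sub>C x = c *\<^sub>C x + d *\<^sub>C x"
    by transfer (rule half_liberated_ideal_eq, rule scaleC_add_left)
  show "c *\<^sub>C d *\<^sub>C x = (c * d) *\<^sub>C x"
    by transfer (rule half_liberated_ideal_eq, rule scaleC_scaleC)
  show "1 *\<^sub>C x = x"
    by transfer (rule half_liberated_ideal_eq, rule scaleC_one)
  show "(c *\<^sub>C x) * y = c *\<^sub>C (x * y)"
    by transfer (rule half_liberated_ideal_eq, rule mult_scaleC_left)
  show "x * (c *\<^sub>C y) = c *\<^sub>C (x * y)"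
    by transfer (rule half_liberated_ideal_eq, rule mult_scaleC_right)
  show "star (star x) = x"
    by transfer (rule half_liberated_ideal_eq, rule star_star)
  show "star (x + y) = star x + star y"
    by transfer (rule half_liberated_ideal_eq, rule star_add)
  show "star (x * y) = star y * star x"
    by transfer (rule half_liberated_ideal_eq, rule star_mult)
  show "star (c *\<^sub>C x) = cnj c *\<^sub>C star x"
    by transfer (rule half_liberated_ideal_eq, rule star_scaleC)
qed

end

definition half_liberated_matrix :: "'n half_liberated^'n::finite^'n" where
  "half_liberated_matrix = (\<chi> i j. abs_half_liberated (free_matrix $ i $ j))"

lemma rep_abs_half_liberated:
  "rep_half_liberated (abs_half_liberated x) - x \<in> half_liberated_ideal"
  using Quotient_rep_abs[OF Quotient_half_liberated, of x]
  by (simp add: half_liberated_ideal_closed)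

lemma star_hom_abs_half_liberated: "star_hom abs_half_liberated"
  unfolding star_hom_def C_linear_def
  by (simp add: plus_half_liberated.abs_eq scaleC_half_liberated.abs_eq one_half_liberated_def
      times_half_liberated.abs_eq star_half_liberated.abs_eq)

lemma half_liberated_relation_matrix:
  "half_liberated_relation (half_liberated_matrix :: 'a half_liberated^'a::finite^'a)"
proof -
  have h: "star_hom (abs_half_liberated :: _ \<Rightarrow> 'a half_liberated)"
    by (rule star_hom_abs_half_liberated)
  then have lin: "C_linear (abs_half_liberated :: _ \<Rightarrow> 'a half_liberated)"
    by (simp add: star_hom_def)
  have eq: "abs_half_liberated x = abs_half_liberated y"
    if "x - y \<in> half_liberated_relators" for x y :: "('a \<times> 'a) free_star_algebra"
    unfolding half_liberated.abs_eq_iff half_liberated_ideal_def by (rule hull_inc) fact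
  let ?u = "free_matrix :: ('a \<times> 'a) free_star_algebra^'a^'a"
  have "abs_half_liberated (star (?u $ i $ j)) = abs_half_liberated (?u $ i $ j)" for i j
    by (rule eq) (auto simp: half_liberated_relators_def Let_def)
  moreover have "abs_half_liberated (?u $ i $ j * ?u $ k $ l * ?u $ p $ q)
      = abs_half_liberated (?u $ p $ q * ?u $ k $ l * ?u $ i $ j)" for i j k l p q
    by (rule eq) (unfold half_liberated_relators_def Let_def, blast)
  moreover have "abs_half_liberated ((?u ** transpose ?u) $ i $ j) = abs_half_liberated (mat 1 $ i $ j)"
    and "abs_half_liberated ((transpose ?u ** ?u) $ i $ j) = abs_half_liberated (mat 1 $ i $ j)" for i j
    by (rule eq; unfold half_liberated_relators_def Let_def; blast)+
  ultimately show ?thesis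
    using h
    by (simp add: half_liberated_relation_def half_liberated_matrix_def orthogonal_matrix_def vec_eq_iff
        star_hom_def matrix_matrix_mult_def transpose_def mat_def C_linear_sum[OF lin] C_linear_zero
        if_distrib[of abs_half_liberated])
qed

lemma half_liberated_universal:
  fixes v :: "'a::complex_star_algebra^'n::finite^'n"
  assumes "half_liberated_relation v"
  shows "\<exists>!h. star_hom h \<and> (\<forall>i j. h (half_liberated_matrix $ i $ j) = v $ i $ j)"
proof -
  let ?e = "free_lift (\<lambda>(i, j). v $ i $ j)"
  let ?h = "\<lambda>x. ?e (rep_half_liberated x)"
  have e: "star_hom ?e" by (rule star_hom_free_lift)
  then have lin: "C_linear ?e" by (simp add: star_hom_def)
  have abs: "?h (abs_half_liberated x) = ?e x" for x
    using half_liberated_ideal_eval[OF assms rep_abs_half_liberated, of x] C_linear_diff[OF lin]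
    by simp
  note ops = plus_half_liberated.abs_eq times_half_liberated.abs_eq scaleC_half_liberated.abs_eq
    star_half_liberated.abs_eq
  have "?h (x + y) = ?h x + ?h y" "?h (x * y) = ?h x * ?h y" for x y
    by (induction x rule: half_liberated.abs_induct, induction y rule: half_liberated.abs_induct,
        use e in \<open>simp add: ops abs star_hom_def C_linear_def\<close>)+
  moreover have "?h (c *\<^sub>C x) = c *\<^sub>C ?h x" "?h (star x) = star (?h x)" for c x
    by (induction x rule: half_liberated.abs_induct,
        use e in \<open>simp add: ops abs star_hom_def C_linear_def\<close>)+
  moreover have "?h 1 = 1" using e by (simp add: one_half_liberated_def abs star_hom_def)
  ultimately have hom: "star_hom ?h" by (simp add: star_hom_def C_linear_def)
  have gen: "?h (half_liberated_matrix $ i $ j) = v $ i $ j" for i j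
    by (simp add: half_liberated_matrix_def abs free_matrix_def)
  show ?thesis
  proof (rule ex1I[of _ ?h])
    fix h assume h: "star_hom h \<and> (\<forall>i j. h (half_liberated_matrix $ i $ j) = v $ i $ j)"
    have "(\<lambda>x. h (abs_half_liberated x)) = ?e"
    proof (rule star_hom_free_unique)
      show "star_hom (\<lambda>x. h (abs_half_liberated x))"
        using h star_hom_abs_half_liberated[where 'a='n] by (simp add: star_hom_def C_linear_def)
      show "h (abs_half_liberated (free_gen p)) = (case p of (i, j) \<Rightarrow> v $ i $ j)" for p
        using h by (cases p) (simp add: half_liberated_matrix_def free_matrix_def)
    qed
    then have eq: "h (abs_half_liberated x) = ?e x" for x by (rule fun_cong)
    show "h = ?h"
    proof
      fix x show "h x = ?h x"
        by (induction x rule: half_liberated.abs_induct) (simp only: eq abs)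
    qed
  qed (use hom gen in auto)
qed


section \<open>Representative functions on the orthogonal group\<close>

definition orthogonal_group :: "(real^'n^'n) set" where
  "orthogonal_group = {Q. orthogonal_matrix Q}"

text \<open>Continuous functions on \<open>G\<close> whose right translates \<open>Q \<mapsto> \<phi> (Q P)\<close>, \<open>P \<in> G\<close>, span a
  finite-dimensional space.  A function on \<open>G\<close> is represented by its extension by zero.\<close>

definition representative_function :: "(real^'n^'n) set \<Rightarrow> (real^'n^'n \<Rightarrow> complex) \<Rightarrow> bool" where
  "representative_function G \<phi> \<longleftrightarrow>
     (\<forall>Q. Q \<notin> G \<longrightarrow> \<phi> Q = 0) \<and> continuous_on G \<phi>
     \<and> (\<exists>B. finite B \<and> (\<forall>P\<in>G. \<exists>c. \<forall>Q\<in>G. \<phi> (Q ** P) = (\<Sum>b\<in>B. c b * b Q)))"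

lemma finite_translates_indexed:
  fixes b :: "'i \<Rightarrow> real^'n^'n \<Rightarrow> complex"
  assumes "finite J" "\<And>P. P \<in> G \<Longrightarrow> \<exists>c. \<forall>Q\<in>G. \<phi> (Q ** P) = (\<Sum>j\<in>J. c j * b j Q)"
  shows "\<exists>B. finite B \<and> (\<forall>P\<in>G. \<exists>c. \<forall>Q\<in>G. \<phi> (Q ** P) = (\<Sum>b\<in>B. c b * b Q))"
proof (rule exI[of _ "b ` J"], intro conjI ballI)
  show "finite (b ` J)" using assms(1) by simp
  fix P assume "P \<in> G"
  from assms(2)[OF this] obtain c where c: "\<forall>Q\<in>G. \<phi> (Q ** P) = (\<Sum>j\<in>J. c j * b j Q)" by blast
  show "\<exists>d. \<forall>Q\<in>G. \<phi> (Q ** P) = (\<Sum>\<beta>\<in>b ` J. d \<beta> * \<beta> Q)"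
  proof (intro exI[of _ "\<lambda>\<beta>. \<Sum>j\<in>{j\<in>J. b j = \<beta>}. c j"] ballI)
    fix Q assume "Q \<in> G"
    have "(\<Sum>j\<in>J. c j * b j Q) = (\<Sum>\<beta>\<in>b ` J. \<Sum>j\<in>{j\<in>J. b j = \<beta>}. c j * b j Q)"
      by (rule sum.image_gen) fact
    also have "\<dots> = (\<Sum>\<beta>\<in>b ` J. (\<Sum>j\<in>{j\<in>J. b j = \<beta>}. c j) * \<beta> Q)"
      unfolding sum_distrib_right by (intro sum.cong) auto
    finally show "\<phi> (Q ** P) = (\<Sum>\<beta>\<in>b ` J. (\<Sum>j\<in>{j\<in>J. b j = \<beta>}. c j) * \<beta> Q)"
      using c \<open>Q \<in> G\<close> by simp
  qed
qed

lemma representative_functionE: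
  assumes "representative_function G \<phi>"
  obtains B c where "finite B"
    "\<And>P Q. P \<in> G \<Longrightarrow> Q \<in> G \<Longrightarrow> \<phi> (Q ** P) = (\<Sum>b\<in>B. c P b * b Q)"
proof -
  from assms obtain B where B: "finite B"
    "\<forall>P\<in>G. \<exists>c. \<forall>Q\<in>G. \<phi> (Q ** P) = (\<Sum>b\<in>B. c b * b Q)"
    unfolding representative_function_def by blast
  from bchoice[OF B(2)] obtain c where
    "\<forall>P\<in>G. \<forall>Q\<in>G. \<phi> (Q ** P) = (\<Sum>b\<in>B. c P b * b Q)" by blast
  with B(1) show thesis by (intro that[of B c]) auto
qed

lemma representative_function_add:
  assumes "representative_function G \<phi>" "representative_function G \<psi>"
  shows "representative_function G (\<lambda>Q. \<phi> Q + \<psi> Q)"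
proof -
  obtain B c where B: "finite B" "\<And>P Q. P \<in> G \<Longrightarrow> Q \<in> G \<Longrightarrow> \<phi> (Q ** P) = (\<Sum>b\<in>B. c P b * b Q)"
    using representative_functionE[OF assms(1)] by blast
  obtain D d where D: "finite D" "\<And>P Q. P \<in> G \<Longrightarrow> Q \<in> G \<Longrightarrow> \<psi> (Q ** P) = (\<Sum>b\<in>D. d P b * b Q)"
    using representative_functionE[OF assms(2)] by blast
  have "\<exists>B. finite B \<and> (\<forall>P\<in>G. \<exists>c. \<forall>Q\<in>G. \<phi> (Q ** P) + \<psi> (Q ** P) = (\<Sum>b\<in>B. c b * b Q))"
  proof (rule finite_translates_indexed[where J = "B <+> D" and b = "case_sum id id" and
          \<phi> = "\<lambda>Q. \<phi> Q + \<psi> Q"])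
    fix P assume "P \<in> G"
    then show "\<exists>e. \<forall>Q\<in>G. \<phi> (Q ** P) + \<psi> (Q ** P) = (\<Sum>j\<in>B <+> D. e j * case_sum id id j Q)"
      by (intro exI[of _ "case_sum (c P) (d P)"]) (simp add: B D sum.Plus)
  qed (use B D in auto)
  then show ?thesis
    using assms by (auto simp: representative_function_def intro: continuous_on_add)
qed

lemma representative_function_mult:
  assumes "representative_function G \<phi>" "representative_function G \<psi>"
  shows "representative_function G (\<lambda>Q. \<phi> Q * \<psi> Q)"
proof -
  obtain B c where B: "finite B" "\<And>P Q. P \<in> G \<Longrightarrow> Q \<in> G \<Longrightarrow> \<phi> (Q ** P) = (\<Sum>b\<in>B. c P b * b Q)"
    using representative_functionE[OF assms(1)] by blast
  obtain D d where D: "finite D" "\<And>P Q. P \<in> G \<Longrightarrow> Q \<in> G \<Longrightarrow> \<psi> (Q ** P) = (\<Sum>b\<in>D. d P b * b Q)"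
    using representative_functionE[OF assms(2)] by blast
  have "\<exists>B. finite B \<and> (\<forall>P\<in>G. \<exists>c. \<forall>Q\<in>G. \<phi> (Q ** P) * \<psi> (Q ** P) = (\<Sum>b\<in>B. c b * b Q))"
  proof (rule finite_translates_indexed[where J = "B \<times> D" and b = "\<lambda>(x, y) Q. x Q * y Q" and
          \<phi> = "\<lambda>Q. \<phi> Q * \<psi> Q"])
    fix P assume "P \<in> G"
    then show "\<exists>e. \<forall>Q\<in>G. \<phi> (Q ** P) * \<psi> (Q ** P)
        = (\<Sum>j\<in>B \<times> D. e j * (case j of (x, y) \<Rightarrow> \<lambda>Q. x Q * y Q) Q)"
      by (intro exI[of _ "\<lambda>(x, y). c P x * d P y"])
         (simp add: B D sum_product sum.cartesian_product case_prod_beta mult_ac)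
  qed (use B D in auto)
  then show ?thesis
    using assms by (auto simp: representative_function_def intro: continuous_on_mult)
qed

lemma representative_function_scale:
  assumes "representative_function G \<phi>"
  shows "representative_function G (\<lambda>Q. a * \<phi> Q)"
proof -
  obtain B c where B: "finite B" "\<And>P Q. P \<in> G \<Longrightarrow> Q \<in> G \<Longrightarrow> \<phi> (Q ** P) = (\<Sum>b\<in>B. c P b * b Q)"
    using representative_functionE[OF assms(1)] by blast
  have "\<exists>B. finite B \<and> (\<forall>P\<in>G. \<exists>c. \<forall>Q\<in>G. a * \<phi> (Q ** P) = (\<Sum>b\<in>B. c b * b Q))"
  proof (intro exI[of _ B] conjI ballI B(1))
    fix P assume "P \<in> G"
    then show "\<exists>d. \<forall>Q\<in>G. a * \<phi> (Q ** P) = (\<Sum>b\<in>B. d b * b Q)"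
      by (intro exI[of _ "\<lambda>b. a * c P b"]) (simp add: B sum_distrib_left mult_ac)
  qed
  then show ?thesis
    using assms by (auto simp: representative_function_def intro: continuous_on_mult)
qed

lemma representative_function_cnj:
  assumes "representative_function G \<phi>"
  shows "representative_function G (\<lambda>Q. cnj (\<phi> Q))"
proof -
  obtain B c where B: "finite B" "\<And>P Q. P \<in> G \<Longrightarrow> Q \<in> G \<Longrightarrow> \<phi> (Q ** P) = (\<Sum>b\<in>B. c P b * b Q)"
    using representative_functionE[OF assms(1)] by blast
  have "\<exists>B. finite B \<and> (\<forall>P\<in>G. \<exists>c. \<forall>Q\<in>G. cnj (\<phi> (Q ** P)) = (\<Sum>b\<in>B. c b * b Q))"
  proof (rule finite_translates_indexed[where J = B and b = "\<lambda>b Q. cnj (b Q)" and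
          \<phi> = "\<lambda>Q. cnj (\<phi> Q)"])
    fix P assume "P \<in> G"
    then show "\<exists>e. \<forall>Q\<in>G. cnj (\<phi> (Q ** P)) = (\<Sum>j\<in>B. e j * cnj (j Q))"
      by (intro exI[of _ "\<lambda>b. cnj (c P b)"]) (simp add: B)
  qed (use B in auto)
  then show ?thesis
    using assms by (auto simp: representative_function_def intro: continuous_on_cnj)
qed

lemma orthogonal_group_mult:
  "P \<in> orthogonal_group \<Longrightarrow> Q \<in> orthogonal_group \<Longrightarrow> P ** Q \<in> orthogonal_group"
  by (simp add: orthogonal_group_def orthogonal_matrix_mul)

lemma representative_function_coordinate:
  fixes i j :: "'n::finite"
  shows "representative_function orthogonal_group
    (\<lambda>Q::real^'n^'n. if Q \<in> orthogonal_group then complex_of_real (Q $ i $ j) else 0)"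
proof -
  let ?x = "\<lambda>i j (Q::real^'n^'n). if Q \<in> orthogonal_group then complex_of_real (Q $ i $ j) else 0"
  have "\<exists>B. finite B \<and> (\<forall>P\<in>orthogonal_group. \<exists>c. \<forall>Q\<in>orthogonal_group.
      ?x i j (Q ** P) = (\<Sum>b\<in>B. c b * b Q))"
  proof (rule finite_translates_indexed[where J = UNIV and b = "\<lambda>k. ?x i k"])
    fix P :: "real^'n^'n" assume "P \<in> orthogonal_group"
    then show "\<exists>c. \<forall>Q\<in>orthogonal_group. ?x i j (Q ** P) = (\<Sum>k\<in>UNIV. c k * ?x i k Q)"
    proof (intro exI[of _ "\<lambda>k. of_real (P $ k $ j)"] ballI)
      fix Q :: "real^'n^'n" assume "Q \<in> orthogonal_group"
      moreover have "(Q ** P) $ i $ j = (\<Sum>k\<in>UNIV. P $ k $ j * Q $ i $ k)"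
        by (simp add: matrix_matrix_mult_def mult.commute)
      ultimately show "?x i j (Q ** P) = (\<Sum>k\<in>UNIV. of_real (P $ k $ j) * ?x i k Q)"
        using \<open>P \<in> orthogonal_group\<close> by (simp add: orthogonal_group_mult)
    qed
  qed simp
  moreover have "continuous_on orthogonal_group (?x i j)"
    by (subst continuous_on_cong[OF refl, of _ _ "\<lambda>Q. of_real (Q $ i $ j)"])
       (auto intro!: continuous_intros)
  ultimately show ?thesis by (auto simp: representative_function_def)
qed

lemma representative_function_one:
  "representative_function orthogonal_group (\<lambda>Q::real^'n^'n. if Q \<in> orthogonal_group then 1 else 0)"
proof -
  let ?x = "\<lambda>Q::real^'n^'n. if Q \<in> orthogonal_group then 1 else 0 :: complex"
  have "continuous_on orthogonal_group ?x"
    by (subst continuous_on_cong[OF refl, of _ _ "\<lambda>_. 1"]) auto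
  moreover have "\<exists>B. finite B \<and> (\<forall>P\<in>orthogonal_group. \<exists>c. \<forall>Q\<in>orthogonal_group.
      ?x (Q ** P) = (\<Sum>b\<in>B. c b * b Q))"
    by (rule exI[of _ "{\<lambda>_. 1}"]) (auto simp: orthogonal_group_mult)
  ultimately show ?thesis by (auto simp: representative_function_def)
qed

text \<open>The algebra \<open>\<R>(O\<^sub>n)\<close> with \<open>n = CARD('n)\<close> and pointwise operations.\<close>

typedef 'n rep_orthogonal =
  "{\<phi> :: real^'n::finite^'n \<Rightarrow> complex. representative_function orthogonal_group \<phi>}"
  by (rule exI, rule CollectI, rule representative_function_one)

setup_lifting type_definition_rep_orthogonal

instantiation rep_orthogonal :: (finite) complex_star_algebra
begin

lift_definition zero_rep_orthogonal :: "'a rep_orthogonal" is "\<lambda>_. 0"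
  using representative_function_scale[OF representative_function_one, of 0] by simp
lift_definition one_rep_orthogonal :: "'a rep_orthogonal"
  is "\<lambda>Q. if Q \<in> orthogonal_group then 1 else 0"
  by (rule representative_function_one)
lift_definition plus_rep_orthogonal :: "'a rep_orthogonal \<Rightarrow> 'a rep_orthogonal \<Rightarrow> 'a rep_orthogonal"
  is "\<lambda>\<phi> \<psi> Q. \<phi> Q + \<psi> Q" by (rule representative_function_add)
lift_definition uminus_rep_orthogonal :: "'a rep_orthogonal \<Rightarrow> 'a rep_orthogonal"
  is "\<lambda>\<phi> Q. - \<phi> Q" using representative_function_scale[of _ _ "-1"] by simp
definition minus_rep_orthogonal :: "'a rep_orthogonal \<Rightarrow> 'a rep_orthogonal \<Rightarrow> 'a rep_orthogonal"
  where "minus_rep_orthogonal x y = x + (- y)"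
lift_definition times_rep_orthogonal :: "'a rep_orthogonal \<Rightarrow> 'a rep_orthogonal \<Rightarrow> 'a rep_orthogonal"
  is "\<lambda>\<phi> \<psi> Q. \<phi> Q * \<psi> Q" by (rule representative_function_mult)
lift_definition scaleC_rep_orthogonal :: "complex \<Rightarrow> 'a rep_orthogonal \<Rightarrow> 'a rep_orthogonal"
  is "\<lambda>c \<phi> Q. c * \<phi> Q" by (rule representative_function_scale)
lift_definition star_rep_orthogonal :: "'a rep_orthogonal \<Rightarrow> 'a rep_orthogonal"
  is "\<lambda>\<phi> Q. cnj (\<phi> Q)" by (rule representative_function_cnj)

instance
proof
  show "(0::'a rep_orthogonal) \<noteq> 1"
  proof transfer
    have "(mat 1 :: real^'a^'a) \<in> orthogonal_group"
      by (simp add: orthogonal_group_def orthogonal_matrix_id)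
    then show "(\<lambda>_::real^'a^'a. 0::complex) \<noteq> (\<lambda>Q. if Q \<in> orthogonal_group then 1 else 0)"
      by (metis zero_neq_one)
  qed
  fix x y z :: "'a rep_orthogonal" and c d :: complex
  show "x - y = x + - y" by (rule minus_rep_orthogonal_def)
  show "1 * x = x" and "x * 1 = x"
    by (transfer, force simp: representative_function_def)+
  show "x + y + z = x + (y + z)" by transfer (simp add: add.assoc)
  show "x + y = y + x" by transfer (simp add: add.commute)
  show "0 + x = x" by transfer simp
  show "- x + x = 0" by transfer simp
  show "x * y * z = x * (y * z)" by transfer (simp add: mult.assoc)
  show "(x + y) * z = x * z + y * z" by transfer (simp add: distrib_right)
  show "x * (y + z) = x * y + x * z" by transfer (simp add: distrib_left)
  show "c *\<^sub>C (x + y) = c *\<^sub>C x + c *\<^sub>C y" by transfer (simp add: distrib_left)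
  show "(c + d) *\<^sub>C x = c *\<^sub>C x + d *\<^sub>C x" by transfer (simp add: distrib_right)
  show "c *\<^sub>C d *\<^sub>C x = (c * d) *\<^sub>C x" by transfer (simp add: mult.assoc)
  show "1 *\<^sub>C x = x" by transfer simp
  show "(c *\<^sub>C x) * y = c *\<^sub>C (x * y)" by transfer (simp add: mult.assoc)
  show "x * (c *\<^sub>C y) = c *\<^sub>C (x * y)" by transfer (simp add: mult.left_commute)
  show "star (star x) = x" by transfer simp
  show "star (x + y) = star x + star y" by transfer simp
  show "star (x * y) = star y * star x" by transfer (simp add: mult.commute)
  show "star (c *\<^sub>C x) = cnj c *\<^sub>C star x" by transfer simp
qed

end

lift_definition coordinate_function :: "'n::finite \<Rightarrow> 'n \<Rightarrow> 'n rep_orthogonal"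
  is "\<lambda>i j Q. if Q \<in> orthogonal_group then complex_of_real (Q $ i $ j) else 0"
  by (rule representative_function_coordinate)

definition coordinate_matrix :: "'n rep_orthogonal^'n::finite^'n" where
  "coordinate_matrix = (\<chi> i j. coordinate_function i j)"

end

theory Submission
  imports Defs
begin

text \<open>
  Let \<open>J\<close> be the kernel of \<open>f\<close>.  It is a Hopf ideal contained in the kernel of the canonical map
  \<open>A\<^sub>o\<^sup>*(n) \<rightarrow> \<R>(O\<^sub>n)\<close>, and the claim is that it is either \<open>0\<close> or that whole kernel.

  The words of even length in the generators \<open>u\<^sub>i\<^sub>j\<close> span a commutative subalgebra, the even part, in
  which \<open>u\<^sub>i\<^sub>j u\<^sub>k\<^sub>l\<close> behaves like the function \<open>w\<^sub>i\<^sub>j (w\<^sup>-\<^sup>t)\<^sub>k\<^sub>l\<close> of an invertible matrix \<open>w\<close>: it is the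
  coordinate algebra of \<open>PGL\<^sub>n\<close>.  The ideal \<open>J\<close> is graded, and its even part describes an algebraic
  group \<open>H\<close> with \<open>PO\<^sub>n \<subseteq> H \<subseteq> PGL\<^sub>n\<close>.  The tangent space of \<open>H\<close> at the identity contains the
  antisymmetric matrices and is stable under conjugation by \<open>O\<^sub>n\<close>.  As the traceless symmetric
  matrices are irreducible under this action (\<open>traceless_symmetric_irreducible\<close>), there are only two
  possibilities.

  \<^item> Every derivation at the identity vanishes on \<open>J\<close>.  Then the even part of \<open>J\<close> is stable under all
    invariant derivations, so its elements vanish to infinite order at the identity along every line
    \<open>1 + t Z\<close>.  Such lines separate the elements of the even part (\<open>line_chars_separate\<close>), hence
    \<open>J = 0\<close> and \<open>f\<close> is injective.

  \<^item> The tangent space of \<open>H\<close> consists of the antisymmetric matrices (modulo scalars).  Because \<open>H\<close>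
    acts on its tangent space, the generic matrix \<open>u\<close> normalizes the antisymmetric matrices modulo
    \<open>J\<close> (\<open>kernel_normalizer\<close>), which means that \<open>[u\<^sub>i\<^sub>s, u\<^sub>j\<^sub>t] + [u\<^sub>j\<^sub>s, u\<^sub>i\<^sub>t]\<close> lies in \<open>J\<close>.  The antipode turns this
    into the relation with the roles of rows and columns exchanged, and the two together put every
    commutator into \<open>J\<close>.  So the quotient is commutative and generated by the entries of an
    orthogonal matrix, and then it has no elements that vanish at all points of \<open>O\<^sub>n\<close>
    (\<open>orthogonal_point_determined\<close>): \<open>g\<close> is injective.

  Both separation results are statements about algebras given by generators and relations.  They are
  reduced to statements about polynomial functions by a rational retraction of an affine space onto
  the group in question: \<open>t \<mapsto> t \<otimes> t\<^sup>-\<^sup>t\<close> for \<open>PGL\<^sub>n\<close> and a Cayley transform for \<open>O\<^sub>n\<close>.  The denominators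
  are handled by \<open>clear_denominators\<close>, and by \<open>partition_of_unity_nilpotent\<close> it suffices to work
  where a denominator is invertible.
\<close>

section \<open>Polynomial functions and their evaluation at commuting elements\<close>

inductive polynomial_fun :: "(('i \<Rightarrow> complex) \<Rightarrow> complex) \<Rightarrow> bool" where
  const: "polynomial_fun (\<lambda>_. c)"
| var: "polynomial_fun (\<lambda>x. x i)"
| add: "polynomial_fun F \<Longrightarrow> polynomial_fun G \<Longrightarrow> polynomial_fun (\<lambda>x. F x + G x)"
| mult: "polynomial_fun F \<Longrightarrow> polynomial_fun G \<Longrightarrow> polynomial_fun (\<lambda>x. F x * G x)"

typedef 'i polyfun = "{F :: ('i \<Rightarrow> complex) \<Rightarrow> complex. polynomial_fun F}"
  morphisms peval Abs_polyfun
  by (rule exI, rule CollectI, rule polynomial_fun.const)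

setup_lifting type_definition_polyfun

instantiation polyfun :: (type) comm_ring_1
begin

lift_definition zero_polyfun :: "'a polyfun" is "\<lambda>_. 0" by (rule polynomial_fun.const)
lift_definition one_polyfun :: "'a polyfun" is "\<lambda>_. 1" by (rule polynomial_fun.const)
lift_definition plus_polyfun :: "'a polyfun \<Rightarrow> 'a polyfun \<Rightarrow> 'a polyfun"
  is "\<lambda>F G x. F x + G x" by (rule polynomial_fun.add)
lift_definition times_polyfun :: "'a polyfun \<Rightarrow> 'a polyfun \<Rightarrow> 'a polyfun"
  is "\<lambda>F G x. F x * G x" by (rule polynomial_fun.mult)
lift_definition uminus_polyfun :: "'a polyfun \<Rightarrow> 'a polyfun"
  is "\<lambda>F x. - F x"
  using polynomial_fun.mult[OF polynomial_fun.const[of "-1"]] by simp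
lift_definition minus_polyfun :: "'a polyfun \<Rightarrow> 'a polyfun \<Rightarrow> 'a polyfun"
  is "\<lambda>F G x. F x - G x"
  using polynomial_fun.add[OF _ polynomial_fun.mult[OF polynomial_fun.const[of "-1"]]] by simp

instance
proof
  fix a b c :: "'a polyfun"
  show "a * b * c = a * (b * c)" by transfer (simp add: mult.assoc)
  show "a * b = b * a" by transfer (simp add: mult.commute)
  show "1 * a = a" by transfer simp
  show "a + b + c = a + (b + c)" by transfer (simp add: add.assoc)
  show "a + b = b + a" by transfer (simp add: add.commute)
  show "0 + a = a" by transfer simp
  show "- a + a = 0" by transfer simp
  show "a - b = a + - b" by transfer simp
  show "(a + b) * c = a * c + b * c" by transfer (simp add: distrib_right)
  show "(0::'a polyfun) \<noteq> 1" by transfer (metis zero_neq_one)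
qed

end

lift_definition Const :: "complex \<Rightarrow> 'i polyfun" is "\<lambda>c _. c" by (rule polynomial_fun.const)
lift_definition Var :: "'i \<Rightarrow> 'i polyfun" is "\<lambda>i x. x i" by (rule polynomial_fun.var)

lemma peval_simps [simp]:
  "peval (F + G) x = peval F x + peval G x" "peval (F - G) x = peval F x - peval G x"
  "peval (F * G) x = peval F x * peval G x" "peval (- F) x = - peval F x"
  "peval 0 x = 0" "peval 1 x = 1" "peval (Const c) x = c" "peval (Var i) x = x i"
  by (transfer, simp)+

lemma peval_eqI: "(\<And>x. peval F x = peval G x) \<Longrightarrow> F = G"
  by (transfer) auto

lemma polyfun_induct [case_names Const Var add mult, induct type: polyfun]:
  assumes "\<And>c. P (Const c)" "\<And>i. P (Var i)"
    and "\<And>F G. P F \<Longrightarrow> P G \<Longrightarrow> P (F + G)" "\<And>F G. P F \<Longrightarrow> P G \<Longrightarrow> P (F * G)"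
  shows "P F"
proof -
  have "polynomial_fun H \<Longrightarrow> P (Abs_polyfun H)" for H
  proof (induction rule: polynomial_fun.induct)
    case (const c)
    then show ?case using assms(1)[of c] by (simp add: Const_def)
  next
    case (var i)
    then show ?case using assms(2)[of i] by (simp add: Var_def)
  next
    case (add F G)
    moreover have "Abs_polyfun F + Abs_polyfun G = Abs_polyfun (\<lambda>x. F x + G x)"
      using add by (intro peval_eqI) (simp add: Abs_polyfun_inverse polynomial_fun.add)
    ultimately show ?case using assms(3) by metis
  next
    case (mult F G)
    moreover have "Abs_polyfun F * Abs_polyfun G = Abs_polyfun (\<lambda>x. F x * G x)"
      using mult by (intro peval_eqI) (simp add: Abs_polyfun_inverse polynomial_fun.mult)
    ultimately show ?case using assms(4) by metis
  qed
  from this[of "peval F"] show ?thesis using peval[of F] by (simp add: peval_inverse)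
qed

definition poly_hom :: "('i polyfun \<Rightarrow> 'a::complex_star_algebra) \<Rightarrow> bool" where
  "poly_hom h \<longleftrightarrow> (\<forall>F G. h (F + G) = h F + h G) \<and> (\<forall>F G. h (F * G) = h F * h G)
     \<and> (\<forall>c. h (Const c) = c *\<^sub>C 1)"

lemma one_eq_Const: "1 = Const 1" and zero_eq_Const: "0 = Const 0"
  and minus_eq_Const: "- F = Const (- 1) * F"
  by (rule peval_eqI, simp)+

lemma poly_hom_simps:
  assumes "poly_hom h"
  shows "h (F + G) = h F + h G" "h (F * G) = h F * h G" "h (Const c) = c *\<^sub>C 1"
    "h 0 = 0" "h 1 = 1" "h (- F) = - h F" "h (F - G) = h F - h G" "h (F ^ k) = h F ^ k"
proof -
  show *: "h (F + G) = h F + h G" "h (F * G) = h F * h G" "h (Const c) = c *\<^sub>C 1" for F G c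
    using assms by (auto simp: poly_hom_def)
  show "h 0 = 0" by (simp add: zero_eq_Const * scaleC_zero_left)
  show one: "h 1 = 1" by (simp add: one_eq_Const * scaleC_one)
  show m: "h (- F) = - h F" for F
    by (simp add: minus_eq_Const[of F] * mult_scaleC_left scaleC_minus_one)
  show "h (F - G) = h F - h G" using *(1)[of F "- G"] by (simp add: m)
  show "h (F ^ k) = h F ^ k" by (induction k) (auto simp: one *)
qed

lemma poly_hom_sum: "poly_hom h \<Longrightarrow> h (sum F S) = (\<Sum>k\<in>S. h (F k))"
  by (induction S rule: infinite_finite_induct) (auto simp: poly_hom_simps)

lemma poly_hom_commute:
  assumes "poly_hom h" shows "h F * h G = h G * h F"
  using poly_hom_simps(2)[OF assms] by (metis mult.commute)

lemma scaleC_sum_right: "c *\<^sub>C (sum g S :: 'a::complex_star_algebra) = (\<Sum>k\<in>S. c *\<^sub>C g k)"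
  by (induction S rule: infinite_finite_induct) (auto simp: scaleC_zero_right scaleC_add_right)

lemma scaleC_diff_left: "(x - y) *\<^sub>C z = x *\<^sub>C z - y *\<^sub>C (z :: 'a::complex_star_algebra)"
  using scaleC_add_left[of "x - y" y z] by (simp add: eq_diff_eq)

lemma scaleC_power: "((c *\<^sub>C (1::'a::complex_star_algebra)) ^ k) = (c ^ k) *\<^sub>C 1"
  by (induction k) (auto simp: scaleC_one mult_scaleC_left scaleC_scaleC)

lemma separating_functional:
  fixes x :: "'a::complex_star_algebra"
  assumes "x \<noteq> 0"
  obtains \<phi> :: "'a \<Rightarrow> complex" where "C_linear \<phi>" "\<phi> x \<noteq> 0"
proof -
  interpret vector_space_pair "scaleC :: complex \<Rightarrow> 'a \<Rightarrow> 'a" "(*) :: complex \<Rightarrow> complex \<Rightarrow> complex"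
    by unfold_locales
       (auto simp: scaleC_add_right scaleC_add_left scaleC_scaleC scaleC_one algebra_simps)
  have "vs1.independent {x}" using assms by (simp add: vs1.independent_insert)
  from linear_independent_extend[OF this, of "\<lambda>_. 1"]
  obtain g :: "'a \<Rightarrow> complex" where g: "Vector_Spaces.linear scaleC (*) g" "g x = 1" by auto
  interpret g: Vector_Spaces.linear scaleC "(*)" g by fact
  from g(2) show ?thesis
    by (intro that[of g]) (auto simp: C_linear_def scaleC_complex_def g.add g.scale)
qed

lemma power_sum_coeffs_zero:
  fixes r :: "nat \<Rightarrow> 'a::complex_star_algebra"
  assumes "\<And>t::real. (\<Sum>k<N. of_real (t ^ k) *\<^sub>C r k) = 0" "k < N"
  shows "r k = 0"
proof (rule ccontr)
  assume "r k \<noteq> 0"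
  then obtain \<phi> :: "'a \<Rightarrow> complex" where \<phi>: "C_linear \<phi>" "\<phi> (r k) \<noteq> 0"
    by (rule separating_functional)
  define p where "p = (\<Sum>k<N. monom (\<phi> (r k)) k)"
  have "poly p (of_real t) = 0" for t
  proof -
    have "\<phi> (\<Sum>k<N. of_real (t ^ k) *\<^sub>C r k) = 0" by (simp only: assms(1) C_linear_zero[OF \<phi>(1)])
    then show ?thesis using \<phi>(1)
      by (simp add: p_def poly_sum poly_monom C_linear_sum C_linear_def scaleC_complex_def mult.commute)
  qed
  then have "range (of_real :: real \<Rightarrow> complex) \<subseteq> {x. poly p x = 0}" by auto
  moreover have "infinite (range (of_real :: real \<Rightarrow> complex))"
    using finite_imageD[OF _ inj_of_real] infinite_UNIV_char_0 by blast
  ultimately have "p = 0" using poly_roots_finite finite_subset by blast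
  moreover have "coeff p k = \<phi> (r k)"
    using assms(2) by (simp add: p_def coeff_sum)
  ultimately show False using \<phi>(2) by simp
qed

text \<open>An expression for the polynomial function \<open>F\<close>, evaluated in an algebra as \<open>\<phi>\<close>.  Different
  expressions for the same \<open>F\<close> give different \<open>\<phi>\<close>; they agree only at commuting arguments.\<close>

inductive realizes :: "'i polyfun \<Rightarrow> (('i \<Rightarrow> 'a::complex_star_algebra) \<Rightarrow> 'a) \<Rightarrow> bool" where
  const: "realizes (Const c) (\<lambda>_. c *\<^sub>C 1)"
| var: "realizes (Var i) (\<lambda>\<rho>. \<rho> i)"
| add: "realizes F \<phi> \<Longrightarrow> realizes G \<psi> \<Longrightarrow> realizes (F + G) (\<lambda>\<rho>. \<phi> \<rho> + \<psi> \<rho>)"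
| mult: "realizes F \<phi> \<Longrightarrow> realizes G \<psi> \<Longrightarrow> realizes (F * G) (\<lambda>\<rho>. \<phi> \<rho> * \<psi> \<rho>)"

lemma realizes_exists: "\<exists>\<phi>. realizes F \<phi>"
  by (induction F) (blast intro: realizes.intros)+

lemma realizes_scalar:
  "realizes F \<phi> \<Longrightarrow> \<phi> (\<lambda>i. x i *\<^sub>C 1) = peval F x *\<^sub>C (1::'a::complex_star_algebra)"
  by (induction rule: realizes.induct)
     (auto simp: scaleC_add_left mult_scaleC_left scaleC_scaleC)

definition commuting :: "('i \<Rightarrow> 'a::times) \<Rightarrow> bool" where
  "commuting \<rho> \<longleftrightarrow> (\<forall>i j. \<rho> i * \<rho> j = \<rho> j * \<rho> i)"

lemma power_sum_pad:
  fixes r :: "nat \<Rightarrow> 'a::ring_1"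
  assumes "N \<le> M"
  shows "(\<Sum>k<N. r k * y ^ k) = (\<Sum>k<M. (if k < N then r k else 0) * y ^ k)"
  by (rule sum.mono_neutral_cong_left) (use assms in auto)

text \<open>For products the coefficients have to commute with the argument, which is what \<open>Q\<close> provides.\<close>

lemma power_sum_closed:
  fixes \<psi> \<psi>' :: "'a::ring_1 \<Rightarrow> 'a"
  assumes "\<exists>N r. (\<forall>k. Q (r k)) \<and> (\<forall>y\<in>Y. \<psi> y = (\<Sum>k<N. r k * y ^ k))"
    and "\<exists>N r. (\<forall>k. Q (r k)) \<and> (\<forall>y\<in>Y. \<psi>' y = (\<Sum>k<N. r k * y ^ k))"
    and Q: "Q 0" "\<And>a b. Q a \<Longrightarrow> Q b \<Longrightarrow> Q (a + b)" "\<And>a b. Q a \<Longrightarrow> Q b \<Longrightarrow> Q (a * b)"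
    and comm: "\<And>a y. Q a \<Longrightarrow> y \<in> Y \<Longrightarrow> a * y = y * a"
  shows "\<exists>N r. (\<forall>k. Q (r k)) \<and> (\<forall>y\<in>Y. \<psi> y + \<psi>' y = (\<Sum>k<N. r k * y ^ k))" (is ?add)
    and "\<exists>N r. (\<forall>k. Q (r k)) \<and> (\<forall>y\<in>Y. \<psi> y * \<psi>' y = (\<Sum>k<N. r k * y ^ k))" (is ?mult)
proof -
  have add: "\<exists>N r. (\<forall>k. Q (r k)) \<and> (\<forall>y\<in>Y. f y + g y = (\<Sum>k<N. r k * y ^ k))"
    if f: "\<exists>N r. (\<forall>k. Q (r k)) \<and> (\<forall>y\<in>Y. f y = (\<Sum>k<N. r k * y ^ k))"
      and g: "\<exists>N r. (\<forall>k. Q (r k)) \<and> (\<forall>y\<in>Y. g y = (\<Sum>k<N. r k * y ^ k))" for f g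
  proof -
    obtain N r where N: "\<forall>k. Q (r k)" "\<forall>y\<in>Y. f y = (\<Sum>k<N. r k * y ^ k)" using f by blast
    obtain M s where M: "\<forall>k. Q (s k)" "\<forall>y\<in>Y. g y = (\<Sum>k<M. s k * y ^ k)" using g by blast
    let ?L = "max N M"
    let ?r = "\<lambda>k. (if k < N then r k else 0) + (if k < M then s k else 0)"
    have "f y + g y = (\<Sum>k<?L. ?r k * y ^ k)" if "y \<in> Y" for y
      using N(2) M(2) that power_sum_pad[of N ?L r y] power_sum_pad[of M ?L s y]
      by (simp add: distrib_right sum.distrib)
    moreover have "Q (?r k)" for k using N M Q by auto
    ultimately show ?thesis by (intro exI[of _ ?L] exI[of _ ?r]) auto
  qed
  show ?add by (rule add[OF assms(1,2)])
  obtain M s where M: "\<forall>k. Q (s k)" "\<forall>y\<in>Y. \<psi>' y = (\<Sum>k<M. s k * y ^ k)" using assms(2) by blast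
  obtain N r where N: "\<forall>k. Q (r k)" "\<forall>y\<in>Y. \<psi> y = (\<Sum>k<N. r k * y ^ k)" using assms(1) by blast
  have pw: "b * y ^ k = y ^ k * b" if "Q b" "y \<in> Y" for b y k
    by (induction k) (auto, metis comm that mult.assoc)
  have one: "\<exists>K t. (\<forall>k. Q (t k)) \<and> (\<forall>y\<in>Y. \<psi> y * (b * y ^ m) = (\<Sum>k<K. t k * y ^ k))" if "Q b" for b m
  proof -
    let ?t = "\<lambda>k. if k < m then 0 else r (k - m) * b"
    have "\<psi> y * (b * y ^ m) = (\<Sum>k<N + m. ?t k * y ^ k)" if y: "y \<in> Y" for y
    proof -
      have "\<psi> y * (b * y ^ m) = (\<Sum>k<N. r k * (y ^ k * b) * y ^ m)"
        using N y by (simp add: sum_distrib_right mult.assoc)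
      also have "\<dots> = (\<Sum>k<N. (r k * b) * y ^ (k + m))"
        by (simp add: pw[symmetric, OF \<open>Q b\<close> y] power_add mult.assoc)
      also have "\<dots> = (\<Sum>k\<in>{m..<N + m}. (r (k - m) * b) * y ^ k)"
        by (rule sum.reindex_bij_witness[where i = "\<lambda>k. k - m" and j = "\<lambda>k. k + m"]) auto
      also have "\<dots> = (\<Sum>k<N + m. ?t k * y ^ k)"
        by (rule sum.mono_neutral_cong_left) auto
      finally show ?thesis .
    qed
    moreover have "Q (?t k)" for k using Q N \<open>Q b\<close> by auto
    ultimately show ?thesis by (intro exI[of _ "N + m"] exI[of _ ?t]) auto
  qed
  have "\<exists>K t. (\<forall>k. Q (t k)) \<and> (\<forall>y\<in>Y. \<psi> y * (\<Sum>k<m. s k * y ^ k) = (\<Sum>k<K. t k * y ^ k))" for m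
  proof (induction m)
    case 0
    show ?case by (rule exI[of _ 0], rule exI[of _ "\<lambda>_. 0"]) (simp add: Q)
  next
    case (Suc m)
    from add[OF this one[of "s m" m]] show ?case using M(1) by (simp add: distrib_left)
  qed
  from this[of M] show ?mult using M(2) by simp
qed

text \<open>In one argument \<open>y\<close>, the others being fixed, a realization is a polynomial whose coefficients lie
  in the algebra.\<close>

lemma realizes_one_variable:
  fixes \<rho> :: "'i \<Rightarrow> 'a::complex_star_algebra"
  assumes "realizes F \<phi>"
  defines "Y \<equiv> {y. \<forall>j. y * \<rho> j = \<rho> j * y}"
  assumes "commuting \<rho>"
  shows "\<exists>N r. \<forall>y\<in>Y. \<phi> (\<rho>(i := y)) = (\<Sum>k<N. r k * y ^ k)"
proof -
  define Q where "Q r \<longleftrightarrow> (\<forall>y\<in>Y. r * y = y * r)" for r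
  have Q: "Q 0" "\<And>a b. Q a \<Longrightarrow> Q b \<Longrightarrow> Q (a + b)" "\<And>a b. Q a \<Longrightarrow> Q b \<Longrightarrow> Q (a * b)"
    and comm: "\<And>a y. Q a \<Longrightarrow> y \<in> Y \<Longrightarrow> a * y = y * a"
    by (auto simp: Q_def distrib_left distrib_right) (metis mult.assoc)
  have "\<exists>N r. (\<forall>k. Q (r k)) \<and> (\<forall>y\<in>Y. \<phi> (\<rho>(i := y)) = (\<Sum>k<N. r k * y ^ k))"
    using assms(1)
  proof (induction rule: realizes.induct)
    case (const c)
    show ?case
      by (rule exI[of _ "Suc 0"], rule exI[of _ "\<lambda>_. c *\<^sub>C 1"])
         (simp add: Q_def mult_scaleC_left mult_scaleC_right)
  next
    case (var j)
    have "\<exists>N r. (\<forall>k. Q (r k)) \<and> (\<forall>y\<in>Y. y = (\<Sum>k<N. r k * y ^ k))"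
      by (rule exI[of _ "Suc (Suc 0)"], rule exI[of _ "\<lambda>k. if k = 0 then 0 else 1"]) (auto simp: Q_def)
    moreover have "\<exists>N r. (\<forall>k. Q (r k)) \<and> (\<forall>y\<in>Y. \<rho> j = (\<Sum>k<N. r k * y ^ k))"
      by (rule exI[of _ "Suc 0"], rule exI[of _ "\<lambda>_. \<rho> j"]) (auto simp: Q_def Y_def)
    ultimately show ?case by (cases "j = i") auto
  next
    case (add F \<phi> G \<psi>)
    from power_sum_closed(1)[OF this(3,4) Q comm] show ?case by simp
  next
    case (mult F \<phi> G \<psi>)
    from power_sum_closed(2)[OF this(3,4) Q comm] show ?case by simp
  qed
  then show ?thesis by blast
qed

text \<open>Permanence of identities: the arguments are moved from real scalars to arbitrary commuting
  elements one at a time; a polynomial in one argument that vanishes at all real scalars has zero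
  coefficients.\<close>

lemma realizes_permanence:
  fixes \<rho> :: "'i::finite \<Rightarrow> 'a::complex_star_algebra"
  assumes \<phi>: "realizes F \<phi>" and F: "\<And>x::'i \<Rightarrow> real. peval F (\<lambda>i. of_real (x i)) = 0"
    and \<rho>: "commuting \<rho>"
  shows "\<phi> \<rho> = 0"
proof -
  have "\<phi> (\<lambda>i. if i \<in> S then \<rho> i else of_real (x i) *\<^sub>C 1) = 0" for S and x :: "'i \<Rightarrow> real"
  proof (induction S arbitrary: x rule: finite_induct[OF finite])
    case (1 x)
    then show ?case using realizes_scalar[OF \<phi>, of "\<lambda>i. of_real (x i)"] by (simp add: F scaleC_zero_left)
  next
    case (2 i S x)
    let ?\<rho> = "\<lambda>y. \<lambda>j. if j \<in> S then \<rho> j else of_real (y j) *\<^sub>C 1"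
    have c: "commuting (?\<rho> x)"
      using \<rho> by (auto simp: commuting_def mult_scaleC_left mult_scaleC_right)
    from realizes_one_variable[OF \<phi> c, of i] obtain N r where
      r: "\<And>y. (\<forall>j. y * ?\<rho> x j = ?\<rho> x j * y) \<Longrightarrow> \<phi> ((?\<rho> x)(i := y)) = (\<Sum>k<N. r k * y ^ k)"
      by auto
    have "(\<Sum>k<N. of_real (t ^ k) *\<^sub>C r k) = 0" for t
    proof -
      have "(?\<rho> x)(i := of_real t *\<^sub>C 1) = ?\<rho> (x(i := t))" using 2 by (auto simp: fun_eq_iff)
      then have "0 = \<phi> ((?\<rho> x)(i := of_real t *\<^sub>C 1))" by (simp only: 2)
      also have "\<dots> = (\<Sum>k<N. r k * (of_real t *\<^sub>C 1) ^ k)"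
        by (rule r) (auto simp: mult_scaleC_left mult_scaleC_right)
      finally show ?thesis by (simp add: scaleC_power mult_scaleC_right)
    qed
    then have "r k = 0" if "k < N" for k using power_sum_coeffs_zero that by blast
    moreover have "(\<lambda>j. if j \<in> insert i S then \<rho> j else of_real (x j) *\<^sub>C 1) = (?\<rho> x)(i := \<rho> i)"
      by auto
    moreover have "\<phi> ((?\<rho> x)(i := \<rho> i)) = (\<Sum>k<N. r k * \<rho> i ^ k)"
      using \<rho> by (intro r) (auto simp: commuting_def mult_scaleC_left mult_scaleC_right)
    ultimately show ?case by simp
  qed
  from this[of UNIV] show ?thesis by simp
qed

definition poly_lift :: "('i \<Rightarrow> 'a::complex_star_algebra) \<Rightarrow> 'i polyfun \<Rightarrow> 'a" where
  "poly_lift \<rho> F = (SOME \<phi>. realizes F \<phi>) \<rho>"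

lemma poly_lift_eq:
  fixes \<rho> :: "'i::finite \<Rightarrow> 'a::complex_star_algebra"
  assumes "commuting \<rho>" "realizes F \<phi>"
  shows "poly_lift \<rho> F = \<phi> \<rho>"
proof -
  let ?\<psi> = "SOME \<psi>. realizes F (\<psi> :: ('i \<Rightarrow> 'a) \<Rightarrow> 'a)"
  have \<psi>: "realizes F ?\<psi>" using realizes_exists by (rule someI_ex)
  have "realizes (F + Const (-1) * F) (\<lambda>\<rho>. ?\<psi> \<rho> + ((-1) *\<^sub>C 1) * \<phi> \<rho>)"
    by (intro realizes.intros \<psi> assms)
  from realizes_permanence[OF this _ assms(1)] show ?thesis
    by (simp add: mult_scaleC_left scaleC_minus_one poly_lift_def)
qed

lemma poly_hom_lift:
  fixes \<rho> :: "'i::finite \<Rightarrow> 'a::complex_star_algebra"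
  assumes "commuting \<rho>"
  shows "poly_hom (poly_lift \<rho>)" and poly_lift_Var: "poly_lift \<rho> (Var i) = \<rho> i"
proof -
  show "poly_lift \<rho> (Var i) = \<rho> i" by (rule poly_lift_eq[OF assms realizes.var])
  have "poly_lift \<rho> (F + G) = poly_lift \<rho> F + poly_lift \<rho> G
      \<and> poly_lift \<rho> (F * G) = poly_lift \<rho> F * poly_lift \<rho> G" for F G
  proof -
    obtain \<phi> \<psi> :: "('i \<Rightarrow> 'a) \<Rightarrow> 'a" where r: "realizes F \<phi>" "realizes G \<psi>"
      using realizes_exists by metis
    then show ?thesis
      using poly_lift_eq[OF assms r(1)] poly_lift_eq[OF assms r(2)]
        poly_lift_eq[OF assms realizes.add[OF r]] poly_lift_eq[OF assms realizes.mult[OF r]] by simp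
  qed
  then show "poly_hom (poly_lift \<rho>)"
    unfolding poly_hom_def using poly_lift_eq[OF assms realizes.const] by blast
qed

lemma poly_hom_peval: "poly_hom (\<lambda>F. peval F x)"
  by (simp add: poly_hom_def scaleC_complex_def)

lemma polyfun_eq_zero:
  fixes F :: "'i::finite polyfun"
  assumes "\<And>x::'i \<Rightarrow> real. peval F (\<lambda>i. of_real (x i)) = 0"
  shows "F = 0"
proof (rule peval_eqI)
  fix x :: "'i \<Rightarrow> complex"
  obtain \<phi> :: "('i \<Rightarrow> complex) \<Rightarrow> complex" where \<phi>: "realizes F \<phi>" using realizes_exists by blast
  have "commuting x" by (simp add: commuting_def mult.commute)
  from realizes_permanence[OF \<phi> assms this] realizes_scalar[OF \<phi>, of x]
  show "peval F x = peval 0 x" by (simp add: scaleC_complex_def)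
qed

text \<open>Let \<open>r / \<delta>\<close> be a rational map that is the identity at the point \<open>\<Lambda>\<close> up to the annihilator
  of \<open>e\<close>.  Clearing denominators in \<open>F(r / \<delta>)\<close> gives a polynomial \<open>G\<close> that represents \<open>\<delta>\<^sup>k F\<close> at the
  point \<open>\<Lambda>\<close>, while its values at any other point only involve \<open>F\<close> on the image of the rational map.\<close>

lemma clear_denominators:
  fixes \<Lambda> :: "'i polyfun \<Rightarrow> 'a::complex_star_algebra"
  assumes \<Lambda>: "poly_hom \<Lambda>" and r: "\<And>i. \<Lambda> (e * (r i - \<delta> * Var i)) = 0"
  shows "\<exists>k G. \<Lambda> (e * (G - \<delta> ^ k * F)) = 0 \<and>
    (\<forall>h h' :: 'i polyfun \<Rightarrow> 'b::{comm_ring_1, complex_star_algebra}.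
       poly_hom h \<longrightarrow> poly_hom h' \<longrightarrow> (\<forall>i. h (r i) = h \<delta> * h' (Var i)) \<longrightarrow>
       h G = h \<delta> ^ k * h' F)"
  (is "\<exists>k G. ?P k G F")
proof (induction F)
  case (Const c)
  have "?P 0 (Const c) (Const c)" by (simp add: poly_hom_simps[OF \<Lambda>]) (simp add: poly_hom_simps)
  then show ?case by blast
next
  case (Var i)
  have "?P 1 (r i) (Var i)" using r by simp
  then show ?case by blast
next
  case (add F F')
  from add obtain k G k' G' where P: "?P k G F" "?P k' G' F'" by blast
  have "?P (k + k') (\<delta> ^ k' * G + \<delta> ^ k * G') (F + F')"
  proof (intro conjI allI impI)
    have "e * (\<delta> ^ k' * G + \<delta> ^ k * G' - \<delta> ^ (k + k') * (F + F'))
        = \<delta> ^ k' * (e * (G - \<delta> ^ k * F)) + \<delta> ^ k * (e * (G' - \<delta> ^ k' * F'))"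
      by (simp add: algebra_simps power_add)
    then show "\<Lambda> (e * (\<delta> ^ k' * G + \<delta> ^ k * G' - \<delta> ^ (k + k') * (F + F'))) = 0"
      using P by (simp only: poly_hom_simps(1,2)[OF \<Lambda>]) simp
    fix h h' :: "'i polyfun \<Rightarrow> 'b"
    assume h: "poly_hom h" "poly_hom h'" "\<forall>i. h (r i) = h \<delta> * h' (Var i)"
    then have "h G = h \<delta> ^ k * h' F" "h G' = h \<delta> ^ k' * h' F'" using P by blast+
    then show "h (\<delta> ^ k' * G + \<delta> ^ k * G') = h \<delta> ^ (k + k') * h' (F + F')"
      by (simp add: poly_hom_simps[OF h(1)] poly_hom_simps[OF h(2)] power_add distrib_left mult_ac)
  qed
  then show ?case by blast
next
  case (mult F F')
  from mult obtain k G k' G' where P: "?P k G F" "?P k' G' F'" by blast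
  have "?P (k + k') (G * G') (F * F')"
  proof (intro conjI allI impI)
    have "e * (G * G' - \<delta> ^ (k + k') * (F * F'))
        = G * (e * (G' - \<delta> ^ k' * F')) + \<delta> ^ k' * F' * (e * (G - \<delta> ^ k * F))"
      by (simp add: algebra_simps power_add)
    then show "\<Lambda> (e * (G * G' - \<delta> ^ (k + k') * (F * F'))) = 0"
      using P by (simp only: poly_hom_simps(1,2)[OF \<Lambda>]) simp
    fix h h' :: "'i polyfun \<Rightarrow> 'b"
    assume h: "poly_hom h" "poly_hom h'" "\<forall>i. h (r i) = h \<delta> * h' (Var i)"
    then have *: "h G = h \<delta> ^ k * h' F" "h G' = h \<delta> ^ k' * h' F'" using P by blast+
    then show "h (G * G') = h \<delta> ^ (k + k') * h' (F * F')"
      by (simp add: poly_hom_simps[OF h(1)] poly_hom_simps[OF h(2)] * power_add mult_ac)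
  qed
  then show ?case by blast
qed

text \<open>If elements \<open>x i\<close> with sum \<open>1\<close> all act nilpotently on \<open>y\<close>, then \<open>y = 0\<close>: otherwise
  multiply \<open>y\<close> by the largest powers that leave it nonzero.\<close>

lemma partition_of_unity_nilpotent:
  fixes y :: "'a::ring_1"
  assumes "finite S" "(\<Sum>i\<in>S. x i) = 1" and comm: "\<And>i j. x i * x j = x j * x i"
    and nil: "\<And>i. i \<in> S \<Longrightarrow> \<exists>N. x i ^ N * y = 0"
  shows "y = 0"
proof (rule ccontr)
  assume "y \<noteq> 0"
  have "\<exists>z. z \<noteq> 0 \<and> (\<forall>i\<in>T. x i * z = 0) \<and> (\<forall>i\<in>S. \<exists>N. x i ^ N * z = 0)" if "T \<subseteq> S" for T
    using finite_subset[OF that assms(1)] that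
  proof (induction T rule: finite_induct)
    case empty
    then show ?case using \<open>y \<noteq> 0\<close> nil by auto
  next
    case (insert i T)
    then have "T \<subseteq> S" "i \<in> S" by auto
    from insert.IH[OF this(1)]
    obtain z where z: "z \<noteq> 0" "\<forall>i\<in>T. x i * z = 0" "\<forall>i\<in>S. \<exists>N. x i ^ N * z = 0" by blast
    define N where "N = (LEAST N. x i ^ N * z = 0)"
    have N: "x i ^ N * z = 0" unfolding N_def
      by (rule LeastI_ex[where P = "\<lambda>N. x i ^ N * z = 0"]) (use z(3) \<open>i \<in> S\<close> in blast)
    obtain M where M: "N = Suc M" using N z(1) by (cases N) auto
    have nz: "x i ^ M * z \<noteq> 0" 
      using not_less_Least[of M "\<lambda>N. x i ^ N * z = 0"] M unfolding N_def[symmetric] by simp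
    have pw: "x j ^ K * x i ^ M = x i ^ M * x j ^ K" for j K
    proof -
      have "x j * x i ^ M = x i ^ M * x j" by (rule power_commuting_commutes[symmetric]) (rule comm)
      then show ?thesis by (rule power_commuting_commutes)
    qed
    have kill: "x j ^ K * (x i ^ M * z) = 0" if "x j ^ K * z = 0" for j K
    proof -
      have "x j ^ K * (x i ^ M * z) = x i ^ M * (x j ^ K * z)"
        by (simp only: mult.assoc[symmetric] pw)
      then show ?thesis by (simp add: that)
    qed
    show ?case
    proof (intro exI[of _ "x i ^ M * z"] conjI ballI nz)
      fix j assume "j \<in> insert i T"
      then show "x j * (x i ^ M * z) = 0"
        using N M kill[of j 1] z(2) by (auto simp: mult.assoc)
    next
      fix j assume "j \<in> S"
      then show "\<exists>N. x j ^ N * (x i ^ M * z) = 0" using z(3) kill by blast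
    qed
  qed
  from this[of S] obtain z where z: "z \<noteq> 0" "\<forall>i\<in>S. x i * z = 0" by auto
  have "(\<Sum>i\<in>S. x i) * z = (\<Sum>i\<in>S. x i * z)" by (rule sum_distrib_right)
  with z assms(2) show False by simp
qed

section \<open>Adjugates and the Cayley transform over a commutative ring\<close>

definition cofactor_matrix :: "'a::comm_ring_1^'n^'n \<Rightarrow> 'a^'n^'n" where
  "cofactor_matrix M = (\<chi> k l. det (\<chi> i. if i = k then axis l 1 else M $ i))"

lemma mat_mult_entry:
  fixes A :: "'a::semiring_1^'m^'n"
  shows "(mat c ** A) $ i $ j = c * A $ i $ j" "(A ** mat c) $ i $ j = A $ i $ j * c"
  by (simp_all add: matrix_matrix_mult_def mat_def if_distrib[of "\<lambda>x. x * _"]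
      if_distrib[of "\<lambda>x. _ * x"] cong: if_cong)

lemma mat_mult_commute: "mat c ** A = A ** mat (c::'a::comm_semiring_1)"
  by (simp add: vec_eq_iff mat_mult_entry mult.commute)

lemma transpose_entry [simp]: "transpose A $ i $ j = A $ j $ i"
  by (simp add: transpose_def)

lemma matrix_add_rdistrib': "(A + B) ** C = A ** C + B ** (C :: 'a::semiring_1^'m^'n)"
  by (simp add: vec_eq_iff matrix_matrix_mult_def sum.distrib distrib_right)

lemma matrix_diff_distrib:
  fixes A :: "'a::ring_1^'m^'n"
  shows "A ** (B - C) = A ** B - A ** C" "(A' - B') ** A = A' ** A - B' ** A"
  by (simp_all add: vec_eq_iff matrix_matrix_mult_def sum_subtractf right_diff_distrib left_diff_distrib)

lemma transpose_simps:
  "transpose (A + B) = transpose A + transpose B" "transpose (A - B :: 'a::ring_1^'m^'n) = transpose A - transpose B"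
  "transpose (mat c) = mat c"
  by (auto simp: vec_eq_iff mat_def)

lemma cofactor_matrix_right:
  fixes M :: "'a::comm_ring_1^'n^'n"
  shows "M ** transpose (cofactor_matrix M) = mat (det M)"
proof -
  have "(M ** transpose (cofactor_matrix M)) $ i $ k = mat (det M) $ i $ k" for i k
  proof -
    have "(M ** transpose (cofactor_matrix M)) $ i $ k
        = (\<Sum>l\<in>UNIV. M $ i $ l * det (\<chi> r. if r = k then axis l 1 else M $ r))"
      by (simp add: matrix_matrix_mult_def cofactor_matrix_def)
    also have "\<dots> = (\<Sum>l\<in>UNIV. det (\<chi> r. if r = k then M $ i $ l *s axis l 1 else M $ r))"
      by (simp add: det_row_mul)
    also have "\<dots> = det (\<chi> r. if r = k then (\<Sum>l\<in>UNIV. M $ i $ l *s axis l 1) else M $ r)"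
      by (rule det_linear_row_sum[symmetric]) simp
    also have "\<dots> = det (\<chi> r. if r = k then M $ i else M $ r)"
      by (simp only: basis_expansion)
    also have "\<dots> = (if i = k then det M else 0)"
    proof (cases "i = k")
      case True
      then have "(\<chi> r. if r = k then M $ i else M $ r) = M" by (simp add: vec_eq_iff)
      with True show ?thesis by simp
    next
      case False
      then show ?thesis
        by (intro det_identical_rows[of i k, THEN trans]) (auto simp: row_def vec_eq_iff)
    qed
    finally show ?thesis by (simp add: mat_def)
  qed
  then show ?thesis by (simp add: vec_eq_iff)
qed

lemma cofactor_matrix_left:
  fixes M :: "'a::comm_ring_1^'n^'n"
  shows "cofactor_matrix (transpose M) ** M = mat (det M)"
  using arg_cong[OF cofactor_matrix_right[of "transpose M"], of transpose]
  by (simp add: matrix_transpose_mul transpose_transpose transpose_simps det_transpose)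

definition ring_ideal :: "'a::comm_ring_1 set \<Rightarrow> bool" where
  "ring_ideal N \<longleftrightarrow> 0 \<in> N \<and> (\<forall>a\<in>N. \<forall>b\<in>N. a + b \<in> N) \<and> (\<forall>r. \<forall>a\<in>N. r * a \<in> N)"

lemma ring_ideal_sum: "ring_ideal N \<Longrightarrow> (\<And>k. k \<in> S \<Longrightarrow> h k \<in> N) \<Longrightarrow> sum h S \<in> N"
  by (induction S rule: infinite_finite_induct) (auto simp: ring_ideal_def)

lemma ring_ideal_diff: "ring_ideal N \<Longrightarrow> a \<in> N \<Longrightarrow> b \<in> N \<Longrightarrow> a - b \<in> N"
  unfolding ring_ideal_def by (metis add_uminus_conv_diff mult_minus1)

lemma ring_ideal_prod_cong:
  assumes "ring_ideal N" "\<And>i. i \<in> S \<Longrightarrow> a i - b i \<in> N"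
  shows "prod a S - prod b S \<in> N"
  using assms(2)
proof (induction S rule: infinite_finite_induct)
  case (insert i S)
  have "a i * prod a S - b i * prod b S = prod a S * (a i - b i) + b i * (prod a S - prod b S)"
    by (simp add: algebra_simps)
  then show ?case using insert assms(1) by (auto simp: ring_ideal_def)
qed (use assms(1) in \<open>auto simp: ring_ideal_def\<close>)

lemma det_cong_ideal:
  assumes "ring_ideal N" "\<And>i j. A $ i $ j - B $ i $ j \<in> N"
  shows "det A - det B \<in> N"
proof -
  have "of_int (sign p) * prod (\<lambda>i. A $ i $ p i) UNIV - of_int (sign p) * prod (\<lambda>i. B $ i $ p i) UNIV \<in> N" for p
    using ring_ideal_prod_cong[OF assms(1), of UNIV "\<lambda>i. A $ i $ p i" "\<lambda>i. B $ i $ p i"] assms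
    by (auto simp: ring_ideal_def simp flip: right_diff_distrib)
  then show ?thesis
    unfolding det_def sum_subtractf[symmetric] by (intro ring_ideal_sum[OF assms(1)]) blast
qed

lemma cofactor_cong_ideal:
  assumes "ring_ideal N" "\<And>i j. A $ i $ j - B $ i $ j \<in> N"
  shows "cofactor_matrix A $ k $ l - cofactor_matrix B $ k $ l \<in> N"
  unfolding cofactor_matrix_def vec_lambda_beta
  by (rule det_cong_ideal[OF assms(1)]) (use assms in \<open>auto simp: ring_ideal_def\<close>)

lemma matrix_mult_cong_ideal:
  assumes "ring_ideal N" "\<And>i j. A $ i $ j - A' $ i $ j \<in> N" "\<And>i j. B $ i $ j - B' $ i $ j \<in> N"
  shows "(A ** B) $ i $ j - (A' ** B') $ i $ j \<in> N"
proof -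
  have "A $ i $ k * B $ k $ j - A' $ i $ k * B' $ k $ j
      = B $ k $ j * (A $ i $ k - A' $ i $ k) + A' $ i $ k * (B $ k $ j - B' $ k $ j)" for k
    by (simp add: algebra_simps)
  then have "A $ i $ k * B $ k $ j - A' $ i $ k * B' $ k $ j \<in> N" for k
    using assms by (simp add: ring_ideal_def)
  then show ?thesis
    by (simp add: matrix_matrix_mult_def sum_subtractf[symmetric] ring_ideal_sum[OF assms(1)])
qed

definition unital_ring_hom :: "('a::comm_ring_1 \<Rightarrow> 'b::comm_ring_1) \<Rightarrow> bool" where
  "unital_ring_hom h \<longleftrightarrow> (\<forall>x y. h (x + y) = h x + h y) \<and> (\<forall>x y. h (x * y) = h x * h y) \<and> h 1 = 1"

definition map_entries :: "('a \<Rightarrow> 'b) \<Rightarrow> 'a^'n^'m \<Rightarrow> 'b^'n^'m" where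
  "map_entries h M = (\<chi> i j. h (M $ i $ j))"

lemma map_entries_entry [simp]: "map_entries h M $ i $ j = h (M $ i $ j)"
  by (simp add: map_entries_def)

lemma unital_ring_hom_simps:
  assumes "unital_ring_hom h"
  shows "h (x + y) = h x + h y" "h (x * y) = h x * h y" "h 1 = 1" "h 0 = 0" "h (- x) = - h x"
    "h (x - y) = h x - h y"
proof -
  show *: "h (x + y) = h x + h y" "h (x * y) = h x * h y" "h 1 = 1" for x y
    using assms by (auto simp: unital_ring_hom_def)
  show z: "h 0 = 0" using *(1)[of 0 0] by simp
  show m: "h (- x) = - h x" for x using *(1)[of "- x" x] by (simp add: z eq_neg_iff_add_eq_0)
  show "h (x - y) = h x - h y" using *(1)[of x "- y"] by (simp add: m)
qed

lemma unital_ring_hom_sum: "unital_ring_hom h \<Longrightarrow> h (sum a S) = (\<Sum>i\<in>S. h (a i))"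
  and unital_ring_hom_prod: "unital_ring_hom h \<Longrightarrow> h (prod a S) = (\<Prod>i\<in>S. h (a i))"
  by (induction S rule: infinite_finite_induct) (simp_all add: unital_ring_hom_simps)

lemma det_map_entries:
  fixes M :: "'a::comm_ring_1^'n^'n"
  assumes "unital_ring_hom h"
  shows "det (map_entries h M) = h (det M)"
proof -
  have "h (of_int (sign p)) = of_int (sign p)" for p :: "'n \<Rightarrow> 'n"
    by (simp add: sign_def unital_ring_hom_simps[OF assms])
  then show ?thesis
    by (simp add: det_def unital_ring_hom_sum[OF assms] unital_ring_hom_prod[OF assms]
        unital_ring_hom_simps[OF assms])
qed

lemma map_entries_simps:
  assumes "unital_ring_hom h"
  shows "map_entries h (A + B) = map_entries h A + map_entries h B"
    "map_entries h (A - B) = map_entries h A - map_entries h B"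
    "map_entries h (C ** D) = map_entries h C ** map_entries h D"
    "map_entries h (transpose C) = transpose (map_entries h C)"
    "map_entries h (mat c) = mat (h c)"
    "map_entries h (cofactor_matrix E) = cofactor_matrix (map_entries h E)"
proof -
  have "map_entries h (cofactor_matrix E) $ k $ l = cofactor_matrix (map_entries h E) $ k $ l" for k l
    unfolding map_entries_entry cofactor_matrix_def vec_lambda_beta det_map_entries[OF assms, symmetric]
    by (rule arg_cong[of _ _ det])
       (auto simp: vec_eq_iff axis_def unital_ring_hom_simps[OF assms])
  then show "map_entries h (cofactor_matrix E) = cofactor_matrix (map_entries h E)"
    by (simp add: vec_eq_iff)
qed (auto simp: vec_eq_iff matrix_matrix_mult_def mat_def unital_ring_hom_simps[OF assms]
      unital_ring_hom_sum[OF assms])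

text \<open>With \<open>T = 1 + X\<close>, \<open>d = det T\<close> and \<open>m\<close> the adjugate of \<open>T\<close>, the matrix \<open>S = d + (m - m\<^sup>t)\<close> is
  a scalar plus an antisymmetric matrix, so \<open>S\<^sup>t S\<^sup>-\<^sup>1\<close> is orthogonal; if \<open>X\<close> is orthogonal, it is
  \<open>X\<close> itself.  This makes \<open>S\<^sup>t S\<^sup>-\<^sup>1\<close> a rational retraction of all matrices onto the orthogonal
  ones.\<close>

definition cayley_factor :: "'a::comm_ring_1^'n^'n \<Rightarrow> 'a^'n^'n" where
  "cayley_factor T = (let m = transpose (cofactor_matrix T) in mat (det T) + (m - transpose m))"

definition cayley_numerator :: "'a::comm_ring_1^'n^'n \<Rightarrow> 'a^'n^'n" where
  "cayley_numerator T = transpose (cayley_factor T) ** transpose (cofactor_matrix (cayley_factor T))"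

lemma map_entries_cayley:
  assumes "unital_ring_hom h"
  shows "map_entries h (cayley_factor T) = cayley_factor (map_entries h T)"
    "map_entries h (cayley_numerator T) = cayley_numerator (map_entries h T)"
  by (simp_all add: cayley_factor_def cayley_numerator_def Let_def map_entries_simps[OF assms]
      det_map_entries[OF assms])

lemma cayley_orthogonal:
  fixes T :: "real^'n^'n"
  assumes "det (cayley_factor T) \<noteq> 0"
  shows "orthogonal_matrix ((1 / det (cayley_factor T)) *\<^sub>R cayley_numerator T)"
proof -
  let ?S = "cayley_factor T"
  define K where "K = (1 / det ?S) *\<^sub>R transpose (cofactor_matrix ?S)"
  have SK: "?S ** K = mat 1"
  proof -
    have "?S ** K = (1 / det ?S) *\<^sub>R (?S ** transpose (cofactor_matrix ?S))"
      by (simp add: K_def vec_eq_iff matrix_matrix_mult_def sum_distrib_left mult_ac)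
    then show ?thesis using assms by (simp add: cofactor_matrix_right vec_eq_iff mat_def)
  qed
  define A where "A = transpose (cofactor_matrix T) - transpose (transpose (cofactor_matrix T))"
  have S: "?S = mat (det T) + A" by (simp add: cayley_factor_def A_def Let_def)
  have A: "transpose A = - A" by (simp add: A_def vec_eq_iff)
  have neg: "A ** (- A) = - (A ** A)" "(- A) ** A = - (A ** A)"
    by (auto simp: vec_eq_iff matrix_matrix_mult_def sum_negf)
  have normal: "?S ** transpose ?S = transpose ?S ** ?S"
    by (simp add: S transpose_simps A matrix_add_ldistrib matrix_add_rdistrib' neg
        mat_mult_commute[of "det T" A] mat_mult_commute[of "det T" "- A"] del: add_uminus_conv_diff)
  have R: "(1 / det ?S) *\<^sub>R cayley_numerator T = transpose ?S ** K"
    by (simp add: K_def cayley_numerator_def vec_eq_iff matrix_matrix_mult_def sum_distrib_left mult_ac)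
  have "transpose (transpose ?S ** K) ** (transpose ?S ** K)
      = transpose K ** (?S ** transpose ?S) ** K"
    by (simp add: matrix_transpose_mul transpose_transpose matrix_mul_assoc)
  also have "\<dots> = transpose (?S ** K) ** (?S ** K)"
    by (simp add: normal matrix_transpose_mul matrix_mul_assoc)
  finally show ?thesis unfolding R orthogonal_matrix by (simp add: SK transpose_simps)
qed

text \<open>The computation behind the retraction property: if \<open>X\<close> is orthogonal, then
  \<open>T (m + m\<^sup>t - d) T\<^sup>t = d (T\<^sup>t + T - T T\<^sup>t) = 0\<close>, hence \<open>m\<^sup>t = d - m\<close> up to the factor \<open>d\<^sup>2\<close>,
  and the antisymmetric part of \<open>T\<^sup>-\<^sup>1\<close> determines \<open>T\<^sup>-\<^sup>1\<close>.  The ideal \<open>I\<close> stands for the relations that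
  hold at a point, so that the identity is available without dividing by \<open>d\<close>.\<close>

lemma cayley_retraction:
  fixes X :: "'a::comm_ring_1^'n^'n"
  assumes I: "ring_ideal I" and X: "\<And>i j. (X ** transpose X - mat 1) $ i $ j \<in> I"
  defines "T \<equiv> mat 1 + X"
  shows "(det T)\<^sup>2 * (cayley_numerator T $ i $ j - det (cayley_factor T) * X $ i $ j) \<in> I"
    and "(det T)\<^sup>2 * (det (cayley_factor T)
           - det (transpose (cofactor_matrix T) + transpose (cofactor_matrix T))) \<in> I"
proof -
  define d where "d = det T"
  define m where "m = transpose (cofactor_matrix T)"
  define C where "C = cofactor_matrix (transpose T)"
  define E where "E = X ** transpose X - mat 1"
  define N where "N = {a. d\<^sup>2 * a \<in> I}"
  have N: "ring_ideal N"
    using I by (auto simp: ring_ideal_def N_def distrib_left mult.left_commute)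
  have Tm: "T ** m = mat d" by (simp add: m_def d_def cofactor_matrix_right)
  have CT: "C ** T = mat d" by (simp add: C_def d_def cofactor_matrix_left)
  have TC: "transpose T ** transpose C = mat d"
    using arg_cong[OF CT, of transpose] by (simp add: matrix_transpose_mul transpose_simps)
  have mT: "transpose m ** transpose T = mat d"
    using arg_cong[OF Tm, of transpose] by (simp add: matrix_transpose_mul transpose_simps)
  define Y where "Y = m + transpose m - mat d"
  have "T ** Y ** transpose T
      = (T ** m) ** transpose T + T ** (transpose m ** transpose T) - (T ** mat d) ** transpose T"
    by (simp add: Y_def matrix_add_ldistrib matrix_add_rdistrib' matrix_diff_distrib matrix_mul_assoc)
  also have "\<dots> = mat d ** (transpose T + T - T ** transpose T)"
    by (simp add: Tm mT matrix_add_ldistrib matrix_diff_distrib mat_mult_commute[of d T, symmetric] matrix_mul_assoc)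
  also have "\<dots> = mat d ** (- E)"
    by (simp add: E_def T_def transpose_simps matrix_add_ldistrib matrix_add_rdistrib' algebra_simps)
  finally have "C ** (T ** Y ** transpose T) ** transpose C = C ** (mat d ** (- E)) ** transpose C" by simp
  moreover have "C ** (T ** Y ** transpose T) ** transpose C = (C ** T) ** Y ** (transpose T ** transpose C)"
    by (simp add: matrix_mul_assoc)
  ultimately have "mat d ** Y ** mat d = C ** (mat d ** (- E)) ** transpose C" by (simp add: CT TC)
  moreover have "(C ** (mat d ** (- E)) ** transpose C) $ i $ j \<in> I" for i j
  proof -
    have "(mat d ** (- E)) $ k $ l \<in> I" for k l
    proof -
      have "(mat d ** (- E)) $ k $ l = (- d) * E $ k $ l" by (simp add: mat_mult_entry)
      moreover have "E $ k $ l \<in> I" unfolding E_def by (rule X)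
      ultimately show ?thesis using I unfolding ring_ideal_def by metis
    qed
    then have "(C ** (mat d ** (- E))) $ k $ l \<in> I" for k l
      using I unfolding matrix_matrix_mult_def[of C] vec_lambda_beta
      by (intro ring_ideal_sum[OF I]) (auto simp: ring_ideal_def)
    then show ?thesis
      using I unfolding matrix_matrix_mult_def[of _ "transpose C"] vec_lambda_beta
      by (intro ring_ideal_sum[OF I]) (auto simp: ring_ideal_def mult.commute)
  qed
  ultimately have Y: "Y $ i $ j \<in> N" for i j
    by (simp add: N_def vec_eq_iff mat_mult_entry power2_eq_square mult_ac)
  let ?S = "cayley_factor T"
  have S: "?S = mat d + (m - transpose m)" by (simp add: cayley_factor_def Let_def d_def m_def)
  have 1: "?S $ i $ j - (m + m) $ i $ j \<in> N" for i j
  proof -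
    have "?S $ i $ j - (m + m) $ i $ j = 0 - Y $ i $ j" by (simp add: S Y_def)
    moreover have "0 \<in> N" using N by (simp add: ring_ideal_def)
    ultimately show ?thesis using ring_ideal_diff[OF N _ Y] by metis
  qed
  have 2: "transpose ?S $ i $ j - (X ** (m + m)) $ i $ j \<in> N" for i j
  proof -
    have "m + X ** m = mat d" using Tm by (simp add: T_def matrix_add_rdistrib')
    then have "X ** m = mat d - m" by (simp add: eq_diff_eq add.commute)
    then have "X ** (m + m) = (mat d - m) + (mat d - m)" by (simp only: matrix_add_ldistrib)
    then have "transpose ?S $ i $ j - (X ** (m + m)) $ i $ j = Y $ i $ j"
      by (simp only:) (simp add: S Y_def, simp add: mat_def)
    then show ?thesis using Y by simp
  qed
  have 3: "transpose (cofactor_matrix ?S) $ i $ j - transpose (cofactor_matrix (m + m)) $ i $ j \<in> N" for i j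
    unfolding transpose_entry by (rule cofactor_cong_ideal[OF N 1])
  have det: "det ?S - det (m + m) \<in> N" by (rule det_cong_ideal[OF N 1])
  then show "(det T)\<^sup>2 * (det ?S - det (transpose (cofactor_matrix T) + transpose (cofactor_matrix T))) \<in> I"
    by (simp add: N_def d_def m_def)
  have "cayley_numerator T $ i $ j - (X ** (m + m) ** transpose (cofactor_matrix (m + m))) $ i $ j \<in> N"
    unfolding cayley_numerator_def by (rule matrix_mult_cong_ideal[OF N 2 3])
  then have "cayley_numerator T $ i $ j - det (m + m) * X $ i $ j \<in> N"
    by (simp add: matrix_mul_assoc[symmetric] cofactor_matrix_right mat_mult_entry mult.commute)
  moreover have "X $ i $ j * (det ?S - det (m + m)) \<in> N" using N det by (simp add: ring_ideal_def)
  ultimately have "(cayley_numerator T $ i $ j - det (m + m) * X $ i $ j)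
      - X $ i $ j * (det ?S - det (m + m)) \<in> N"
    by (rule ring_ideal_diff[OF N])
  then show "(det T)\<^sup>2 * (cayley_numerator T $ i $ j - det ?S * X $ i $ j) \<in> I"
    by (simp add: N_def d_def algebra_simps)
qed

text \<open>The rows of \<open>1 \<plusminus> X\<close> average to the rows of the identity matrix, so by multilinearity the
  determinants of \<open>1 + D X\<close>, with \<open>D\<close> running over the diagonal sign matrices, have sum \<open>2\<^sup>n\<close>.  Over
  the complex numbers they therefore generate the unit ideal.\<close>

lemma sum_det_signs:
  fixes X :: "'a::comm_ring_1^'n^'n" and c :: "'n \<Rightarrow> 'a^'n"
  shows "(\<Sum>B\<in>Pow S. det (\<chi> i. if i \<in> S then (if i \<in> B then axis i 1 - X $ i else axis i 1 + X $ i) else c i))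
    = 2 ^ card S * det (\<chi> i. if i \<in> S then axis i 1 else c i)"
proof (induction S arbitrary: c rule: finite_induct[OF finite])
  case (2 a S)
  let ?e = "\<lambda>B i. if i \<in> B then axis i 1 - X $ i else axis i 1 + X $ i"
  let ?D = "\<lambda>r. \<Sum>B\<in>Pow S. det (\<chi> i. if i \<in> S then ?e B i else (if i = a then r else c i))"
  have "(\<Sum>B\<in>Pow (insert a S). det (\<chi> i. if i \<in> insert a S then ?e B i else c i))
     = ?D (axis a 1 + X $ a) + ?D (axis a 1 - X $ a)"
  proof -
    have inj: "inj_on (insert a) (Pow S)" by (rule inj_onI, subst (asm) insert_ident) (use 2 in auto)
    have "(\<Sum>B\<in>Pow (insert a S). det (\<chi> i. if i \<in> insert a S then ?e B i else c i))
        = (\<Sum>B\<in>Pow S. det (\<chi> i. if i \<in> insert a S then ?e B i else c i))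
          + (\<Sum>B\<in>Pow S. det (\<chi> i. if i \<in> insert a S then ?e (insert a B) i else c i))"
      unfolding Pow_insert using 2
      by (subst sum.union_disjoint) (auto simp: sum.reindex[OF inj])
    also have "(\<Sum>B\<in>Pow S. det (\<chi> i. if i \<in> insert a S then ?e B i else c i)) = ?D (axis a 1 + X $ a)"
      by (intro sum.cong refl arg_cong[of _ _ det]) (use 2 in \<open>auto simp: vec_eq_iff\<close>)
    also have "(\<Sum>B\<in>Pow S. det (\<chi> i. if i \<in> insert a S then ?e (insert a B) i else c i)) = ?D (axis a 1 - X $ a)"
      by (intro sum.cong refl arg_cong[of _ _ det]) (use 2 in \<open>auto simp: vec_eq_iff\<close>)
    finally show ?thesis .
  qed
  also have "\<dots> = 2 ^ card S * (det (\<chi> i. if i = a then axis a 1 + X $ a else (if i \<in> S then axis i 1 else c i))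
      + det (\<chi> i. if i = a then axis a 1 - X $ a else (if i \<in> S then axis i 1 else c i)))"
  proof -
    have "(\<chi> i. if i \<in> S then axis i 1 else (if i = a then r else c i))
        = (\<chi> i. if i = a then r else (if i \<in> S then axis i 1 else c i))" for r :: "'a^'n"
      using 2 by (auto simp: vec_eq_iff)
    then show ?thesis unfolding 2(3) distrib_left by simp
  qed
  also have "\<dots> = 2 ^ card S * det (\<chi> i. if i = a then (axis a 1 + X $ a) + (axis a 1 - X $ a) else (if i \<in> S then axis i 1 else c i))"
    by (simp only: det_row_add)
  also have "(axis a 1 + X $ a) + (axis a 1 - X $ a) = 2 *s axis a 1"
    by (simp add: vec_eq_iff)
  also have "det (\<chi> i. if i = a then 2 *s axis a 1 else (if i \<in> S then axis i 1 else c i))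
      = 2 * det (\<chi> i. if i = a then axis a 1 else (if i \<in> S then axis i 1 else c i))"
    by (rule det_row_mul)
  also have "(\<chi> i. if i = a then axis a 1 else (if i \<in> S then axis i 1 else c i))
      = (\<chi> i. if i \<in> insert a S then axis i 1 else c i)"
    by (auto simp: vec_eq_iff)
  finally show ?case using 2 by simp
qed simp

section \<open>Relations among the entries of a commuting orthogonal matrix\<close>

lemma peval_power [simp]: "peval (F ^ k) x = peval F x ^ k"
  by (induction k) auto

lemma peval_numeral [simp]: "peval (numeral k) x = numeral k"
proof -
  have "peval (of_nat n) x = of_nat n" for n by (induction n) auto
  from this[of "numeral k"] show ?thesis by simp
qed

lemma unital_ring_hom_peval: "unital_ring_hom (\<lambda>F. peval F x)"
  by (simp add: unital_ring_hom_def)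

lemma unital_ring_hom_of_real: "unital_ring_hom (of_real :: real \<Rightarrow> complex)"
  by (simp add: unital_ring_hom_def)

lemma poly_hom_kernel_ideal: "poly_hom \<Lambda> \<Longrightarrow> ring_ideal {F. \<Lambda> F = 0}"
  by (auto simp: ring_ideal_def poly_hom_simps)

lemma det_mat: "det (mat c :: 'a::comm_ring_1^'n^'n) = c ^ CARD('n)"
  by (subst det_diagonal) (auto simp: mat_def)

text \<open>A polynomial that vanishes on the real orthogonal group vanishes at every orthogonal matrix with
  commuting entries: compose it with the Cayley retraction, which makes it vanish at all real
  matrices, and evaluate at the given matrix, which the retraction fixes.  The retraction for \<open>D X\<close>
  is defined where \<open>1 + D X\<close> is invertible, and these sets cover when \<open>D\<close> runs over the sign
  matrices.\<close>

lemma orthogonal_point_determined: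
  fixes \<rho> :: "'n::finite \<times> 'n \<Rightarrow> 'a::complex_star_algebra"
  assumes \<rho>: "commuting \<rho>"
    and rows: "\<And>i j. (\<Sum>k\<in>UNIV. \<rho> (i, k) * \<rho> (j, k)) = (if i = j then 1 else 0)"
    and F: "\<And>Q::real^'n^'n. orthogonal_matrix Q \<Longrightarrow> peval F (\<lambda>(i, j). of_real (Q $ i $ j)) = 0"
  shows "poly_lift \<rho> F = 0"
proof -
  let ?\<Lambda> = "poly_lift \<rho>"
  note hom = poly_hom_lift(1)[OF \<rho>]
  note \<Lambda> = poly_hom_simps[OF hom] poly_lift_Var[OF \<rho>]
  define V :: "('n \<times> 'n) polyfun^'n^'n" where "V = (\<chi> i j. Var (i, j))"
  define s where "s B i = (if i \<in> B then - 1 else 1 :: real)" for B and i :: 'n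
  define X where "X B = (\<chi> i j. Const (of_real (s B i)) * V $ i $ j)" for B
  define d where "d B = det (mat 1 + X B)" for B
  have ss [simp]: "s B i * s B i = 1" for B i by (simp add: s_def)
  have ssc [simp]: "complex_of_real (s B i) * complex_of_real (s B i) = 1" for B i
    by (simp flip: of_real_mult)
  have CC [simp]: "Const a * Const b = (Const (a * b) :: ('n \<times> 'n) polyfun)" for a b
    by (rule peval_eqI) simp
  define c where "c = Const (1 / 2 ^ CARD('n)) * (1 :: ('n \<times> 'n) polyfun)"
  have "(\<Sum>B\<in>Pow UNIV. d B) = 2 ^ CARD('n)"
  proof -
    have m: "mat 1 + X B = (\<chi> i. if i \<in> UNIV then (if i \<in> B then axis i 1 - V $ i else axis i 1 + V $ i) else 0)" for B
      by (auto simp: vec_eq_iff X_def s_def mat_def axis_def minus_eq_Const[symmetric] intro!: peval_eqI)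
    have "(\<chi> i. if i \<in> UNIV then axis i 1 else 0) = (mat 1 :: ('n \<times> 'n) polyfun^'n^'n)"
      by (auto simp: vec_eq_iff mat_def axis_def)
    with sum_det_signs[where X = V and S = UNIV and c = "\<lambda>_. 0"] show ?thesis unfolding d_def m by (simp add: det_I)
  qed
  then have "(\<Sum>B\<in>Pow UNIV. c * d B) = c * 2 ^ CARD('n)" by (simp flip: sum_distrib_left)
  also have "\<dots> = 1"
  proof (rule peval_eqI)
    show "peval (c * 2 ^ CARD('n)) x = peval 1 x" for x by (simp add: c_def)
  qed
  finally have "(\<Sum>B\<in>Pow UNIV. ?\<Lambda> (c * d B)) = 1"
    by (simp add: \<Lambda>(5) flip: poly_hom_sum[OF hom])
  then show ?thesis
  proof (rule partition_of_unity_nilpotent[rotated])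
    show "?\<Lambda> (c * d B) * ?\<Lambda> (c * d B') = ?\<Lambda> (c * d B') * ?\<Lambda> (c * d B)" for B B'
      by (rule poly_hom_commute[OF hom])
    fix B :: "'n set"
    let ?I = "{F. ?\<Lambda> F = 0}"
    note I = poly_hom_kernel_ideal[OF hom]
    define T where "T = mat 1 + X B"
    define \<delta> where "\<delta> = det (cayley_factor T)"
    define m where "m = transpose (cofactor_matrix T)"
    define r where "r = (\<lambda>(i, j). Const (of_real (s B i)) * cayley_numerator T $ i $ j)"
    have XI: "(X B ** transpose (X B) - mat 1) $ i $ j \<in> ?I" for i j
    proof -
      have "(X B ** transpose (X B) - mat 1) $ i $ j = Const (of_real (s B i * s B j))
          * (\<Sum>k\<in>UNIV. Var (i, k) * Var (j, k)) - mat 1 $ i $ j"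
        by (simp add: X_def V_def matrix_matrix_mult_def sum_distrib_left mult.assoc CC[symmetric]
            mult.left_commute del: CC)
      moreover have "?\<Lambda> (mat 1 $ i $ j) = (if i = j then 1 else 0)" by (simp add: mat_def \<Lambda>)
      moreover have "?\<Lambda> (\<Sum>k\<in>UNIV. Var (i, k) * Var (j, k)) = (if i = j then 1 else 0)"
        by (simp add: poly_hom_sum[OF hom] \<Lambda> rows)
      ultimately show ?thesis by (auto simp: \<Lambda> scaleC_one mult_scaleC_left scaleC_zero_right)
    qed
    note ret = cayley_retraction[OF I XI, folded T_def]
    have "?\<Lambda> ((det T)\<^sup>2 * (r q - \<delta> * Var q)) = 0" for q
    proof (cases q)
      case (Pair i j)
      have "(det T)\<^sup>2 * (r q - \<delta> * Var q) = Const (of_real (s B i)) *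
          ((det T)\<^sup>2 * (cayley_numerator T $ i $ j - \<delta> * X B $ i $ j))"
      proof -
        have "Var (i, j) = Const (of_real (s B i)) * X B $ i $ j"
          by (rule peval_eqI) (simp add: X_def V_def mult.assoc[symmetric] flip: of_real_mult)
        then show ?thesis by (simp add: Pair r_def algebra_simps)
      qed
      then show ?thesis using ret(1)[of i j] by (simp add: \<Lambda>(2) \<delta>_def)
    qed
    from clear_denominators[OF hom this, where F = F and 'b = complex] obtain k G where
      G: "?\<Lambda> ((det T)\<^sup>2 * (G - \<delta> ^ k * F)) = 0"
      and ev: "\<And>h h' :: ('n \<times> 'n) polyfun \<Rightarrow> complex. poly_hom h \<Longrightarrow> poly_hom h' \<Longrightarrow>
         (\<And>i. h (r i) = h \<delta> * h' (Var i)) \<Longrightarrow> h G = h \<delta> ^ k * h' F"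
      by (auto simp: mult.commute)
    \<comment> \<open>The factor \<open>\<delta>\<close> takes care of the real matrices at which the retraction is undefined.\<close>
    have "\<delta> * G = 0"
    proof (rule polyfun_eq_zero)
      fix x :: "'n \<times> 'n \<Rightarrow> real"
      let ?x = "\<lambda>q. complex_of_real (x q)"
      define T' where "T' = mat 1 + (\<chi> i j. s B i * x (i, j))"
      have "map_entries (\<lambda>F. peval F ?x) T = map_entries of_real T'"
        by (simp add: vec_eq_iff T_def T'_def X_def V_def mat_def)
      then have num: "map_entries (\<lambda>F. peval F ?x) (cayley_numerator T)
            = map_entries of_real (cayley_numerator T')"
          and "map_entries (\<lambda>F. peval F ?x) (cayley_factor T) = map_entries of_real (cayley_factor T')"
        by (simp_all add: map_entries_cayley[OF unital_ring_hom_peval] map_entries_cayley[OF unital_ring_hom_of_real])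
      then have \<delta>: "peval \<delta> ?x = of_real (det (cayley_factor T'))"
        by (simp add: \<delta>_def flip: det_map_entries[OF unital_ring_hom_peval] det_map_entries[OF unital_ring_hom_of_real])
      show "peval (\<delta> * G) ?x = 0"
      proof (cases "det (cayley_factor T') = 0")
        case False
        define R where "R = (1 / det (cayley_factor T')) *\<^sub>R cayley_numerator T'"
        define Q where "Q = (\<chi> i j. s B i * R $ i $ j)"
        have "transpose R ** R = mat 1" using cayley_orthogonal[OF False] by (simp add: R_def orthogonal_matrix)
        moreover have "transpose Q ** Q = transpose R ** R"
        proof -
          have "s B k * a * (s B k * b) = a * b" for k a b by (simp add: s_def)
          from this[of _ "R $ _ $ _" "R $ _ $ _"] show ?thesis
            by (simp only: vec_eq_iff matrix_matrix_mult_def Q_def vec_lambda_beta transpose_entry) simp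
        qed
        ultimately have "orthogonal_matrix Q" by (simp add: orthogonal_matrix)
        note F = F[OF this]
        have "peval (r (i, j)) ?x = peval \<delta> ?x * of_real (Q $ i $ j)" for i j
          using arg_cong[OF num, of "\<lambda>M. M $ i $ j"] False by (simp add: r_def \<delta> Q_def R_def)
        then have "peval G ?x = peval \<delta> ?x ^ k * peval F (\<lambda>(i, j). of_real (Q $ i $ j))"
          by (intro ev poly_hom_peval) auto
        then show ?thesis by (simp add: F)
      qed (simp add: \<delta>)
    qed
    \<comment> \<open>At the given point \<open>\<delta>\<close> may be replaced by \<open>w\<close>, and \<open>w\<close> divides a power of \<open>2 det T\<close>; so only
      the denominator \<open>det T\<close> remains.\<close>
    define w where "w = det (m + m)"
    define N where "N = {a. (det T)\<^sup>2 * a \<in> ?I}"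
    have N: "ring_ideal N"
      using I by (auto simp: ring_ideal_def N_def distrib_left mult.left_commute)
    have "(\<Prod>_\<in>{..<Suc k}. \<delta>) - (\<Prod>_\<in>{..<Suc k}. w) \<in> N"
      using ret(2) by (intro ring_ideal_prod_cong[OF N]) (simp add: N_def w_def m_def \<delta>_def)
    then have "?\<Lambda> ((det T)\<^sup>2 * (\<delta> ^ Suc k - w ^ Suc k)) = 0" by (simp add: N_def)
    moreover have "(det T)\<^sup>2 * (w ^ Suc k * F) = (det T)\<^sup>2 * (\<delta> * G)
        - \<delta> * ((det T)\<^sup>2 * (G - \<delta> ^ k * F)) - F * ((det T)\<^sup>2 * (\<delta> ^ Suc k - w ^ Suc k))"
      by (simp add: algebra_simps)
    ultimately have "?\<Lambda> ((det T)\<^sup>2 * (w ^ Suc k * F)) = 0"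
      using G \<open>\<delta> * G = 0\<close> by (simp only: \<Lambda>(2,7)) (simp add: \<Lambda>)
    then have "?\<Lambda> ((det T) ^ Suc k * ((det T)\<^sup>2 * (w ^ Suc k * F))) = 0" by (simp add: \<Lambda>(2))
    moreover have "det T * w = (2 * det T) ^ CARD('n)"
    proof -
      have "(mat (det T) + mat (det T)) $ i $ j = mat (2 * det T) $ i $ j" for i j :: 'n
        by (simp only: vector_add_component mat_def vec_lambda_beta) simp
      then have "T ** (m + m) = mat (2 * det T)"
        by (simp only: matrix_add_ldistrib m_def cofactor_matrix_right vec_eq_iff) simp
      then show ?thesis by (metis det_mat det_mul w_def)
    qed
    then have "(det T) ^ Suc k * ((det T)\<^sup>2 * (w ^ Suc k * F))
        = ((2 * det T) ^ CARD('n)) ^ Suc k * (det T)\<^sup>2 * F"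
      by (metis (no_types, lifting) mult.assoc mult.commute power_mult_distrib)
    ultimately have 0: "?\<Lambda> ((2 * det T) ^ (CARD('n) * Suc k) * (det T)\<^sup>2 * F) = 0"
      by (simp only: power_mult)
    define M where "M = CARD('n) * Suc k"
    have half: "2 * Const (1 / 2) = (1 :: ('n \<times> 'n) polyfun)"
      by (rule peval_eqI) simp
    have "Const (1/2) ^ M * ((2 * det T) ^ M * (det T)\<^sup>2 * F) = (det T) ^ (M + 2) * F"
    proof -
      have "Const (1/2) ^ M * (2 * det T) ^ M = det T ^ M"
        using half by (metis mult.assoc mult.commute mult_1 power_mult_distrib)
      then have "Const (1/2) ^ M * (2 * det T) ^ M * ((det T)\<^sup>2 * F) = det T ^ M * ((det T)\<^sup>2 * F)"
        by (simp only:)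
      then show ?thesis by (simp only: power_add mult.assoc)
    qed
    then have "?\<Lambda> ((det T) ^ (M + 2) * F) = 0" using 0 by (metis M_def \<Lambda>(2) mult_zero_right)
    then have "?\<Lambda> (c * d B) ^ (M + 2) * ?\<Lambda> F = 0"
      by (simp only: \<Lambda>(2,8)[symmetric] power_mult_distrib mult.assoc d_def T_def) (simp add: \<Lambda>(2))
    then show "\<exists>N. ?\<Lambda> (c * d B) ^ N * ?\<Lambda> F = 0" by blast
  qed simp
qed

section \<open>Auxiliary star-algebras\<close>

lemma star_hom_simps:
  assumes "star_hom h"
  shows "h (x + y) = h x + h y" "h (x * y) = h x * h y" "h 1 = 1" "h 0 = 0" "h (- x) = - h x"
    "h (x - y) = h x - h y" "h (c *\<^sub>C x) = c *\<^sub>C h x" "h (star x) = star (h x)"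
  using assms by (auto simp: star_hom_def C_linear_zero C_linear_minus C_linear_diff)
     (auto simp: C_linear_def)

lemma star_hom_sum: "star_hom h \<Longrightarrow> h (sum a S) = (\<Sum>k\<in>S. h (a k))"
  by (simp add: star_hom_def C_linear_sum)

lemma star_sum: "star (sum a S :: 'a::complex_star_algebra) = (\<Sum>k\<in>S. star (a k))"
  by (induction S rule: infinite_finite_induct) (auto simp: star_zero star_add)

text \<open>The opposite algebra as a type, so that the antipode of \<open>A\<^sub>o\<^sup>*(n)\<close> comes from the universal property
  for homomorphisms.\<close>

datatype 'a opp = Opp (unopp: 'a)

instantiation opp :: (complex_star_algebra) complex_star_algebra
begin
definition "0 = Opp 0"
definition "1 = Opp 1"
definition "x + y = Opp (unopp x + unopp y)"
definition "x - y = Opp (unopp x - unopp y)"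
definition "- x = Opp (- unopp x)"
definition "x * y = Opp (unopp y * unopp x)"
definition "c *\<^sub>C x = Opp (c *\<^sub>C unopp x)"
definition "star x = Opp (star (unopp x))"
instance
  by standard
     (auto simp: zero_opp_def one_opp_def plus_opp_def minus_opp_def uminus_opp_def times_opp_def
       scaleC_opp_def star_opp_def mult.assoc distrib_left distrib_right scaleC_add_left
       scaleC_add_right scaleC_scaleC scaleC_one mult_scaleC_left mult_scaleC_right star_star
       star_add star_mult star_scaleC add.assoc add.commute)
end

lemma unopp_simps [simp]:
  "unopp 0 = 0" "unopp 1 = 1" "unopp (x + y) = unopp x + unopp y" "unopp (x * y) = unopp y * unopp x"
  "unopp (c *\<^sub>C x) = c *\<^sub>C unopp x" "unopp (star x) = star (unopp x)"
  by (simp_all add: zero_opp_def one_opp_def plus_opp_def times_opp_def scaleC_opp_def star_opp_def)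

lemma opp_eq_iff: "x = y \<longleftrightarrow> unopp x = unopp y"
  by (rule opp.expand[THEN iffI[rotated], simplified]) auto

lemma unopp_sum [simp]: "unopp (sum a S) = (\<Sum>k\<in>S. unopp (a k))"
  by (induction S rule: infinite_finite_induct) auto

instantiation fps :: (complex_star_algebra) complex_star_algebra
begin
definition scaleC_fps :: "complex \<Rightarrow> 'a fps \<Rightarrow> 'a fps" where
  "scaleC_fps c F = Abs_fps (\<lambda>n. c *\<^sub>C fps_nth F n)"
definition star_fps :: "'a fps \<Rightarrow> 'a fps" where
  "star_fps F = Abs_fps (\<lambda>n. star (fps_nth F n))"
instance
proof
  fix x y :: "'a fps" and c d :: complex
  show "(c *\<^sub>C x) * y = c *\<^sub>C (x * y)" "x * (c *\<^sub>C y) = c *\<^sub>C (x * y)"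
    by (auto simp: fps_eq_iff scaleC_fps_def fps_mult_nth mult_scaleC_left mult_scaleC_right scaleC_sum_right)
  have "star (fps_nth (x * y) n) = fps_nth (star y * star x) n" for n
  proof -
    have "star (fps_nth (x * y) n) = (\<Sum>i=0..n. star (fps_nth y (n - i)) * star (fps_nth x i))"
      by (simp add: fps_mult_nth star_sum star_mult)
    also have "\<dots> = (\<Sum>i=0..n. star (fps_nth y i) * star (fps_nth x (n - i)))"
      by (rule sum.reindex_bij_witness[where i = "\<lambda>i. n - i" and j = "\<lambda>i. n - i"]) auto
    finally show ?thesis by (simp add: fps_mult_nth star_fps_def)
  qed
  then show "star (x * y) = star y * star x" by (simp add: fps_eq_iff) (simp add: star_fps_def)
qed (auto simp: fps_eq_iff scaleC_fps_def star_fps_def scaleC_add_left scaleC_add_right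
       scaleC_scaleC scaleC_one star_star star_add star_scaleC)
end

text \<open>The \<open>2 \<times> 2\<close> matrices over a commutative algebra, with the involution that reflects a matrix in
  its antidiagonal.  Unlike the conjugate transpose, it makes every antidiagonal matrix with
  self-adjoint entries self-adjoint.\<close>

datatype 'k mat2 = Mat2 (m11: 'k) (m12: 'k) (m21: 'k) (m22: 'k)

instantiation mat2 :: ("{comm_ring_1, complex_star_algebra}") complex_star_algebra
begin
definition "0 = Mat2 0 0 0 0"
definition "1 = Mat2 1 0 0 1"
definition "x + y = Mat2 (m11 x + m11 y) (m12 x + m12 y) (m21 x + m21 y) (m22 x + m22 y)"
definition "x - y = Mat2 (m11 x - m11 y) (m12 x - m12 y) (m21 x - m21 y) (m22 x - m22 y)"
definition "- x = Mat2 (- m11 x) (- m12 x) (- m21 x) (- m22 x)"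
definition "x * y = Mat2 (m11 x * m11 y + m12 x * m21 y) (m11 x * m12 y + m12 x * m22 y)
  (m21 x * m11 y + m22 x * m21 y) (m21 x * m12 y + m22 x * m22 y)"
definition "c *\<^sub>C x = Mat2 (c *\<^sub>C m11 x) (c *\<^sub>C m12 x) (c *\<^sub>C m21 x) (c *\<^sub>C m22 x)"
definition "star x = Mat2 (star (m22 x)) (star (m12 x)) (star (m21 x)) (star (m11 x))"
instance
  by standard
     (auto simp: zero_mat2_def one_mat2_def plus_mat2_def minus_mat2_def uminus_mat2_def times_mat2_def
       scaleC_mat2_def star_mat2_def algebra_simps scaleC_add_left
       scaleC_add_right scaleC_scaleC scaleC_one mult_scaleC_left mult_scaleC_right star_star
       star_add star_mult star_scaleC)
end

lemma mat2_simps [simp]: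
  "m11 0 = 0" "m12 0 = 0" "m21 0 = 0" "m22 0 = 0" "m11 1 = 1" "m12 1 = 0" "m21 1 = 0" "m22 1 = 1"
  "m11 (x + y) = m11 x + m11 y" "m12 (x + y) = m12 x + m12 y"
  "m21 (x + y) = m21 x + m21 y" "m22 (x + y) = m22 x + m22 y"
  "m11 (x * y) = m11 x * m11 y + m12 x * m21 y" "m12 (x * y) = m11 x * m12 y + m12 x * m22 y"
  "m21 (x * y) = m21 x * m11 y + m22 x * m21 y" "m22 (x * y) = m21 x * m12 y + m22 x * m22 y"
  "m11 (c *\<^sub>C x) = c *\<^sub>C m11 x" "m12 (c *\<^sub>C x) = c *\<^sub>C m12 x"
  "m21 (c *\<^sub>C x) = c *\<^sub>C m21 x" "m22 (c *\<^sub>C x) = c *\<^sub>C m22 x"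
  by (simp_all add: zero_mat2_def one_mat2_def plus_mat2_def times_mat2_def scaleC_mat2_def)

lemma mat2_sum [simp]:
  "m11 (sum a S) = (\<Sum>k\<in>S. m11 (a k))" "m12 (sum a S) = (\<Sum>k\<in>S. m12 (a k))"
  "m21 (sum a S) = (\<Sum>k\<in>S. m21 (a k))" "m22 (sum a S) = (\<Sum>k\<in>S. m22 (a k))"
  by (induction S rule: infinite_finite_induct) auto

section \<open>Contractions of tensors\<close>

definition bilinear_map ::
  "('a::complex_star_algebra \<Rightarrow> 'b::complex_star_algebra \<Rightarrow> 'c::complex_star_algebra) \<Rightarrow> bool" where
  "bilinear_map \<beta> \<longleftrightarrow> (\<forall>b. C_linear (\<lambda>a. \<beta> a b)) \<and> (\<forall>a. C_linear (\<beta> a))"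

definition contract ::
  "('a::complex_star_algebra \<Rightarrow> 'b::complex_star_algebra \<Rightarrow> 'c::complex_star_algebra)
    \<Rightarrow> ('a, 'b) tensor \<Rightarrow> 'c" where
  "contract \<beta> t = (\<Sum>(a, b)\<leftarrow>rep_tensor t. \<beta> a b)"

lemma bilinear_map_simps:
  assumes "bilinear_map \<beta>"
  shows "\<beta> (a + a') b = \<beta> a b + \<beta> a' b" "\<beta> a (b + b') = \<beta> a b + \<beta> a b'"
    "\<beta> (c *\<^sub>C a) b = c *\<^sub>C \<beta> a b" "\<beta> a (c *\<^sub>C b) = c *\<^sub>C \<beta> a b" "\<beta> 0 b = 0" "\<beta> a 0 = 0"
proof -
  have l: "C_linear (\<lambda>a. \<beta> a b)" "C_linear (\<beta> a)" for a b
    using assms by (auto simp: bilinear_map_def)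
  show "\<beta> 0 b = 0" "\<beta> a 0 = 0" using C_linear_zero[OF l(1)] C_linear_zero[OF l(2)] by auto
qed (use assms in \<open>auto simp: bilinear_map_def C_linear_def\<close>)

lemma tensor_eq_contract:
  assumes "bilinear_map \<beta>" "tensor_eq x y"
  shows "(\<Sum>(a, b)\<leftarrow>x. \<beta> a b) = (\<Sum>(a, b)\<leftarrow>y. \<beta> a b)"
  using assms(2) by induction (auto simp: bilinear_map_simps[OF assms(1)] add.commute)

lemma contract_abs:
  assumes "bilinear_map \<beta>"
  shows "contract \<beta> (abs_tensor x) = (\<Sum>(a, b)\<leftarrow>x. \<beta> a b)"
proof -
  have "tensor_eq (rep_tensor (abs_tensor x)) x"
    by (metis Quotient_rep_abs Quotient_tensor tensor_refl)
  then show ?thesis unfolding contract_def by (rule tensor_eq_contract[OF assms])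
qed

lemma contract_simps:
  assumes "bilinear_map \<beta>"
  shows contract_pure: "contract \<beta> (a \<otimes>\<^sub>C b) = \<beta> a b"
    and contract_add: "contract \<beta> (s + t) = contract \<beta> s + contract \<beta> t"
    and contract_zero: "contract \<beta> 0 = 0"
proof -
  show "contract \<beta> (a \<otimes>\<^sub>C b) = \<beta> a b" by (simp add: pure_tensor.abs_eq contract_abs[OF assms])
  show "contract \<beta> 0 = 0" by (simp add: zero_tensor_def contract_abs[OF assms])
  show "contract \<beta> (s + t) = contract \<beta> s + contract \<beta> t"
    by (induction s rule: tensor.abs_induct, induction t rule: tensor.abs_induct)
       (simp add: plus_tensor.abs_eq contract_abs[OF assms])
qed

lemma contract_sum:
  "bilinear_map \<beta> \<Longrightarrow> contract \<beta> (sum h S) = (\<Sum>k\<in>S. contract \<beta> (h k))"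
  by (induction S rule: infinite_finite_induct) (auto simp: contract_simps)

lemma tensor_induct [case_names zero pure add]:
  assumes "P 0" "\<And>a b. P (a \<otimes>\<^sub>C b)" "\<And>s t. P s \<Longrightarrow> P t \<Longrightarrow> P (s + t)"
  shows "P (t :: ('a::complex_star_algebra, 'b::complex_star_algebra) tensor)"
proof (induction t rule: tensor.abs_induct)
  case (1 x)
  show ?case
    by (induction x) (auto simp: abs_tensor_eq_sum_list intro!: assms)
qed

lemma one_tensor_pure: "1 = 1 \<otimes>\<^sub>C 1"
  by transfer (simp add: tensor_refl)

lemma pure_tensor_scale: "c *\<^sub>C (a \<otimes>\<^sub>C b) = (c *\<^sub>C a) \<otimes>\<^sub>C b"
  by transfer (simp add: tensor_refl)

lemma contract_scale:
  assumes "bilinear_map \<beta>"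
  shows "contract \<beta> (c *\<^sub>C t) = c *\<^sub>C contract \<beta> t"
  by (induction t rule: tensor_induct)
     (simp_all add: contract_simps[OF assms] scaleC_zero_right scaleC_add_right pure_tensor_scale
       bilinear_map_simps[OF assms])

lemma contract_tensor_map:
  assumes "bilinear_map \<beta>" "C_linear f" "C_linear g"
  shows "contract \<beta> (tensor_map f g t) = contract (\<lambda>a b. \<beta> (f a) (g b)) t"
proof (induction t rule: tensor.abs_induct)
  case (1 x)
  have "bilinear_map (\<lambda>a b. \<beta> (f a) (g b))"
    using assms(2,3) by (auto simp: bilinear_map_def C_linear_def bilinear_map_simps[OF assms(1)])
  then show ?case
    by (simp add: tensor_map_abs[OF assms(2,3)] contract_abs)
       (induction x, auto simp: contract_simps[OF assms(1)])
qed

lemma pure_tensor_add: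
  "(a + a') \<otimes>\<^sub>C b = a \<otimes>\<^sub>C b + a' \<otimes>\<^sub>C b" "a \<otimes>\<^sub>C (b + b') = a \<otimes>\<^sub>C b + a \<otimes>\<^sub>C b'"
  "0 \<otimes>\<^sub>C b = 0" "a \<otimes>\<^sub>C 0 = 0"
  by (transfer, simp add: tensor_add_left tensor_add_right tensor_zero tensor_zero_right)+

lemma pure_tensor_sum:
  "sum h S \<otimes>\<^sub>C b = (\<Sum>k\<in>S. h k \<otimes>\<^sub>C b)" "a \<otimes>\<^sub>C sum h' S = (\<Sum>k\<in>S. a \<otimes>\<^sub>C h' k)"
  by (induction S rule: infinite_finite_induct) (auto simp: pure_tensor_add)

lemma contract_multiplicative:
  assumes "bilinear_map \<beta>" "\<And>a b c d. \<beta> (a * c) (b * d) = \<beta> a b * \<beta> c d"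
  shows "contract \<beta> (s * t) = contract \<beta> s * contract \<beta> t"
proof (induction s rule: tensor_induct)
  case (pure a b)
  show ?case
    by (induction t rule: tensor_induct)
       (simp_all add: contract_simps[OF assms(1)] pure_tensor_mult assms(2) distrib_left)
qed (simp_all add: contract_simps[OF assms(1)] distrib_right)

lemma contract_diff:
  assumes "bilinear_map \<beta>" "bilinear_map \<gamma>"
  shows "contract (\<lambda>a b. \<beta> a b - \<gamma> a b) w = contract \<beta> w - contract \<gamma> w"
proof -
  have "bilinear_map (\<lambda>a b. \<beta> a b - \<gamma> a b)"
    using assms by (simp add: bilinear_map_def C_linear_def scaleC_diff_right)
  note c = contract_simps[OF this] contract_simps[OF assms(1)] contract_simps[OF assms(2)]
  show ?thesis by (induction w rule: tensor_induct) (simp_all add: c)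
qed

inductive_set tensor_of :: "'a set \<Rightarrow> 'b set \<Rightarrow> ('a::complex_star_algebra, 'b::complex_star_algebra) tensor set"
  for E E' where
  zero: "0 \<in> tensor_of E E'"
| pure: "a \<in> E \<Longrightarrow> b \<in> E' \<Longrightarrow> a \<otimes>\<^sub>C b \<in> tensor_of E E'"
| add: "s \<in> tensor_of E E' \<Longrightarrow> t \<in> tensor_of E E' \<Longrightarrow> s + t \<in> tensor_of E E'"

lemma tensor_of_sum: "(\<And>k. k \<in> S \<Longrightarrow> h k \<in> tensor_of E E') \<Longrightarrow> sum h S \<in> tensor_of E E'"
  by (induction S rule: infinite_finite_induct) (auto intro: tensor_of.intros)

lemma tensor_of_mult:
  assumes "\<And>a b. a \<in> E \<Longrightarrow> b \<in> E \<Longrightarrow> a * b \<in> E" "\<And>a b. a \<in> E' \<Longrightarrow> b \<in> E' \<Longrightarrow> a * b \<in> E'"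
    and "s \<in> tensor_of E E'" "t \<in> tensor_of E E'"
  shows "s * t \<in> tensor_of E E'"
  using assms(3)
proof induction
  case (pure a b)
  from assms(4) show ?case
    by induction (use pure in \<open>auto simp: pure_tensor_mult distrib_left intro: tensor_of.intros assms(1,2)\<close>)
qed (auto simp: distrib_right intro: tensor_of.intros)

section \<open>The half-liberated algebra: even part and Hopf structure\<close>

lemma commute_mult:
  fixes a x y :: "'a::semigroup_mult"
  assumes "a * x = x * a" "a * y = y * a"
  shows "a * (x * y) = (x * y) * a"
proof -
  have "a * (x * y) = (a * x) * y" by (simp only: mult.assoc)
  also have "\<dots> = x * (a * y)" by (simp only: assms(1) mult.assoc)
  also have "\<dots> = (x * y) * a" by (simp only: assms(2) mult.assoc)
  finally show ?thesis .
qed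

lemma sum_rotate:
  "(\<Sum>k\<in>A. \<Sum>r\<in>B. \<Sum>s\<in>C. h k r s) = (\<Sum>r\<in>B. \<Sum>s\<in>C. \<Sum>k\<in>A. h k r s)"
  by (subst sum.swap) (intro sum.cong refl, rule sum.swap)

lemma sum_reverse:
  "(\<Sum>r\<in>A. \<Sum>s\<in>B. \<Sum>t\<in>C. h r s t) = (\<Sum>t\<in>C. \<Sum>s\<in>B. \<Sum>r\<in>A. h r s t)"
  by (subst sum_rotate) (rule sum.swap)

lemma sum_product3:
  "sum a A * sum b B * sum c C = (\<Sum>r\<in>A. \<Sum>s\<in>B. \<Sum>t\<in>C. a r * b s * (c t :: 'a::semiring_0))"
  by (simp only: sum_distrib_right, intro sum.cong refl)
     (simp only: sum_distrib_left[of _ b B] sum_product)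

abbreviation (input) gen :: "'n::finite \<Rightarrow> 'n \<Rightarrow> 'n half_liberated" where
  "gen i j \<equiv> half_liberated_matrix $ i $ j"

lemma half_liberated_relationI:
  fixes v :: "'a::complex_star_algebra^'n^'n"
  assumes "\<And>i j. star (v $ i $ j) = v $ i $ j"
    and "\<And>i j k l p q. v $ i $ j * v $ k $ l * v $ p $ q = v $ p $ q * v $ k $ l * v $ i $ j"
    and "\<And>i j. (\<Sum>k\<in>UNIV. v $ i $ k * v $ j $ k) = (if i = j then 1 else 0)"
    and "\<And>i j. (\<Sum>k\<in>UNIV. v $ k $ i * v $ k $ j) = (if i = j then 1 else 0)"
  shows "half_liberated_relation v"
  unfolding half_liberated_relation_def orthogonal_matrix_def
proof (intro conjI allI)
  show "transpose v ** v = mat 1" "v ** transpose v = mat 1"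
    using assms(3,4) by (simp_all add: vec_eq_iff matrix_matrix_mult_def mat_def)
qed (use assms(1,2) in auto)

lemma
  fixes i j k l p q :: "'n::finite"
  shows gen_star: "star (gen i j) = gen i j"
  and gen_half_commute: "gen i j * gen k l * gen p q = gen p q * gen k l * gen i j"
  and gen_rows: "(\<Sum>k\<in>UNIV. gen i k * gen j k) = (if i = j then 1 else 0)"
  and gen_cols: "(\<Sum>k\<in>UNIV. gen k i * gen k j) = (if i = j then 1 else 0)"
proof -
  note r = half_liberated_relation_matrix[where 'a = 'n, unfolded half_liberated_relation_def orthogonal_matrix_def]
  show "star (gen i j) = gen i j" "gen i j * gen k l * gen p q = gen p q * gen k l * gen i j"
    using r by blast+
  from r have "(half_liberated_matrix ** transpose half_liberated_matrix) $ i $ j = mat 1 $ i $ j"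
    "(transpose half_liberated_matrix ** half_liberated_matrix) $ i $ j = mat 1 $ i $ j"
    by (simp_all only:)
  then show "(\<Sum>k\<in>UNIV. gen i k * gen j k) = (if i = j then 1 else 0)"
    "(\<Sum>k\<in>UNIV. gen k i * gen k j) = (if i = j then 1 else 0)"
    by (simp_all add: matrix_matrix_mult_def mat_def)
qed

lemma generates_half_liberated: "generates (half_liberated_matrix :: 'n half_liberated^'n::finite^'n)"
proof -
  let ?H = "star_subalgebra hull {gen i j | i j :: 'n. True}"
  have H: "star_subalgebra ?H" by (rule hull_in) (auto simp: star_subalgebra_def)
  then have cl: "1 \<in> ?H" "x \<in> ?H \<Longrightarrow> y \<in> ?H \<Longrightarrow> x + y \<in> ?H" "x \<in> ?H \<Longrightarrow> y \<in> ?H \<Longrightarrow> x * y \<in> ?H"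
    "x \<in> ?H \<Longrightarrow> c *\<^sub>C x \<in> ?H" "x \<in> ?H \<Longrightarrow> star x \<in> ?H" for x y c
    by (auto simp: star_subalgebra_def)
  have z: "0 \<in> ?H" using cl(4)[OF cl(1), of 0] by (simp add: scaleC_zero_left)
  have m: "- x \<in> ?H" if "x \<in> ?H" for x using cl(4)[OF that, of "-1"] by (simp add: scaleC_minus_one)
  note h = star_hom_simps[OF star_hom_abs_half_liberated[where 'a = 'n]]
  have *: "abs_half_liberated (abs_free_star_algebra t) \<in> ?H" for t :: "('n \<times> 'n) star_term"
  proof (induction t)
    case (Gen p)
    have "gen (fst p) (snd p) \<in> ?H" by (rule hull_inc) blast
    then show ?case by (simp add: half_liberated_matrix_def free_matrix_def free_gen.abs_eq)
  next
    case Zero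
    show ?case using z h(4) by (simp add: zero_free_star_algebra_def)
  next
    case One
    show ?case using cl(1) h(3) by (simp add: one_free_star_algebra_def)
  next
    case (Scale c t)
    then show ?case using cl(4) by (simp add: scaleC_free_star_algebra.abs_eq[symmetric] h)
  next
    case (Neg t)
    then show ?case using m by (simp add: uminus_free_star_algebra.abs_eq[symmetric] h)
  next
    case (Add s t)
    then show ?case using cl(2) by (simp add: plus_free_star_algebra.abs_eq[symmetric] h)
  next
    case (Mul s t)
    then show ?case using cl(3) by (simp add: times_free_star_algebra.abs_eq[symmetric] h)
  next
    case (Star t)
    then show ?case using cl(5) by (simp add: star_free_star_algebra.abs_eq[symmetric] h)
  qed
  have "x \<in> ?H" for x
  proof (induction x rule: half_liberated.abs_induct)
    case (1 y)
    show ?case by (induction y rule: free_star_algebra.abs_induct) (rule *)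
  qed
  then show ?thesis unfolding generates_def by auto
qed

lemma half_liberated_induct [case_names scalar gen add mult]:
  assumes "\<And>c. P (c *\<^sub>C 1)" "\<And>i j. P (gen i j)"
    and add: "\<And>x y. P x \<Longrightarrow> P y \<Longrightarrow> P (x + y)" and mult: "\<And>x y. P x \<Longrightarrow> P y \<Longrightarrow> P (x * y)"
  shows "P (x :: 'n::finite half_liberated)"
proof -
  have "P x \<and> P (star x)"
  proof (rule generates_induct[OF generates_half_liberated, where P = "\<lambda>x. P x \<and> P (star x)"])
    have sc: "P (c *\<^sub>C x)" if "P x" for c x
      using mult[OF assms(1)[of c] that] by (simp add: mult_scaleC_left)
    have "P 1" using assms(1)[of 1] by (simp add: scaleC_one)
    then show "star_subalgebra {x. P x \<and> P (star x)}"
      by (auto simp: star_subalgebra_def star_one star_add star_mult star_scaleC star_star add mult sc)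
  qed (simp add: gen_star assms(2))
  then show ?thesis ..
qed

inductive_set even_part :: "'n::finite half_liberated set" where
  scalar: "c *\<^sub>C 1 \<in> even_part"
| gen: "gen i j * gen k l \<in> even_part"
| add: "x \<in> even_part \<Longrightarrow> y \<in> even_part \<Longrightarrow> x + y \<in> even_part"
| mult: "x \<in> even_part \<Longrightarrow> y \<in> even_part \<Longrightarrow> x * y \<in> even_part"

lemma even_part_one: "1 \<in> even_part" and even_part_zero: "0 \<in> even_part"
  using even_part.scalar[of 1] even_part.scalar[of 0] by (auto simp: scaleC_one scaleC_zero_left)

lemma even_part_scale: "x \<in> even_part \<Longrightarrow> c *\<^sub>C x \<in> even_part"
  using even_part.mult[OF even_part.scalar[of c]] by (simp add: mult_scaleC_left)

text \<open>Half-commutation moves a pair of adjacent generators past another pair, since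
  \<open>(abc)d = c(bad) = c(dab)\<close>.\<close>

lemma even_part_commute:
  assumes "x \<in> even_part" "y \<in> even_part"
  shows "x * y = y * x"
proof -
  have gg: "(gen i j * gen k l) * (gen p q * gen r s) = (gen p q * gen r s) * (gen i j * gen k l)"
    for i j k l p q r s :: 'a
  proof -
    have "(gen i j * gen k l) * (gen p q * gen r s) = (gen i j * gen k l * gen p q) * gen r s"
      by (simp add: mult.assoc)
    also have "\<dots> = gen p q * (gen k l * gen i j * gen r s)"
      by (subst gen_half_commute) (simp add: mult.assoc)
    also have "\<dots> = (gen p q * gen r s) * (gen i j * gen k l)"
      by (subst gen_half_commute) (simp add: mult.assoc)
    finally show ?thesis .
  qed
  from assms(1) show ?thesis
  proof induction
    case (gen i j k l)
    from assms(2) show ?case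
    proof induction
      case (mult x y)
      then show ?case by (intro commute_mult)
    qed (simp_all add: gg distrib_left distrib_right mult_scaleC_left mult_scaleC_right)
  next
    case (mult x x')
    then show ?case by (intro commute_mult[symmetric]) simp_all
  qed (simp_all add: distrib_left distrib_right mult_scaleC_left mult_scaleC_right)
qed

inductive_set odd_part :: "'n::finite half_liberated set" where
  zero: "0 \<in> odd_part"
| gen: "x \<in> even_part \<Longrightarrow> x * gen i j \<in> odd_part"
| add: "x \<in> odd_part \<Longrightarrow> y \<in> odd_part \<Longrightarrow> x + y \<in> odd_part"

lemma gen_odd: "gen i j \<in> odd_part"
  using odd_part.gen[OF even_part_one, of i j] by simp

lemma even_mult_odd: "y \<in> odd_part \<Longrightarrow> x \<in> even_part \<Longrightarrow> x * y \<in> odd_part"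
proof (induction rule: odd_part.induct)
  case (gen y i j)
  then show ?case using odd_part.gen[OF even_part.mult] by (simp add: mult.assoc)
qed (auto simp: distrib_left intro: odd_part.intros)

lemma odd_mult_gen: "x \<in> odd_part \<Longrightarrow> x * gen k l \<in> even_part"
proof (induction rule: odd_part.induct)
  case (gen x i j)
  then show ?case using even_part.mult[OF _ even_part.gen] by (simp add: mult.assoc)
qed (auto simp: distrib_right intro: even_part.add even_part_zero)

lemma odd_mult_even: "y \<in> even_part \<Longrightarrow> x \<in> odd_part \<Longrightarrow> x * y \<in> odd_part"
proof (induction arbitrary: x rule: even_part.induct)
  case (scalar c)
  then show ?case using even_mult_odd[OF _ even_part.scalar, of x c]
    by (simp add: mult_scaleC_left mult_scaleC_right)
next
  case (gen i j k l)
  then show ?case using odd_part.gen[OF odd_mult_gen] by (simp add: mult.assoc[symmetric])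
next
  case (mult y z)
  then show ?case by (simp add: mult.assoc[symmetric])
qed (auto simp: distrib_left intro: odd_part.add)

lemma odd_mult_odd: "y \<in> odd_part \<Longrightarrow> x \<in> odd_part \<Longrightarrow> x * y \<in> even_part"
proof (induction rule: odd_part.induct)
  case (gen y i j)
  then show ?case using odd_mult_gen[OF odd_mult_even] by (simp add: mult.assoc[symmetric])
qed (auto simp: distrib_left intro: even_part.add even_part_zero)

lemma even_odd_decomposition: "\<exists>e\<in>even_part. \<exists>d\<in>odd_part. x = e + d"
proof (induction x rule: half_liberated_induct)
  case (scalar c)
  show ?case using even_part.scalar odd_part.zero by force
next
  case (gen i j)
  show ?case using gen_odd even_part_zero by force
next
  case (add x y)
  then obtain e d e' d' where *: "e \<in> even_part" "d \<in> odd_part" "x = e + d"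
    "e' \<in> even_part" "d' \<in> odd_part" "y = e' + d'" by blast
  moreover have "x + y = (e + e') + (d + d')" using * by simp
  ultimately show ?case by (blast intro: even_part.add odd_part.add)
next
  case (mult x y)
  then obtain e d e' d' where *: "e \<in> even_part" "d \<in> odd_part" "x = e + d"
    "e' \<in> even_part" "d' \<in> odd_part" "y = e' + d'" by blast
  moreover have "x * y = (e * e' + d * d') + (e * d' + d * e')"
    using * by (simp add: distrib_left distrib_right add_ac)
  ultimately show ?case
    by (blast intro: even_part.add odd_part.add even_part.mult even_mult_odd odd_mult_even odd_mult_odd)
qed

definition universal_hom :: "'a::complex_star_algebra^'n::finite^'n \<Rightarrow> 'n half_liberated \<Rightarrow> 'a" where
  "universal_hom v = (SOME h. star_hom h \<and> (\<forall>i j. h (gen i j) = v $ i $ j))"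

lemma universal_hom:
  fixes v :: "'a::complex_star_algebra^'n::finite^'n"
  assumes "half_liberated_relation v"
  shows star_hom_universal_hom: "star_hom (universal_hom v)" and universal_hom_gen: "universal_hom v (gen i j) = v $ i $ j"
proof -
  have "\<exists>h. star_hom h \<and> (\<forall>i j. h (gen i j) = v $ i $ j)"
    using half_liberated_universal[OF assms] by blast
  from someI_ex[OF this] show "star_hom (universal_hom v)" "universal_hom v (gen i j) = v $ i $ j"
    unfolding universal_hom_def by auto
qed

definition comult :: "'n::finite half_liberated \<Rightarrow> ('n half_liberated, 'n half_liberated) tensor" where
  "comult = universal_hom (\<chi> i j. \<Sum>k\<in>UNIV. gen i k \<otimes>\<^sub>C gen k j)"

lemma comult_relation:
  "half_liberated_relation (\<chi> i j. \<Sum>k\<in>UNIV. gen i k \<otimes>\<^sub>C gen k (j::'n::finite))"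
proof (rule half_liberated_relationI, simp_all only: vec_lambda_beta)
  fix i j k l p q :: 'n
  let ?d = "\<lambda>i j. \<Sum>k\<in>UNIV. gen i k \<otimes>\<^sub>C gen k j"
  show "star (?d i j) = ?d i j"
    by (simp add: star_sum pure_tensor_star gen_star)
  have "?d i j * ?d k l * ?d p q
      = (\<Sum>r\<in>UNIV. \<Sum>s\<in>UNIV. \<Sum>t\<in>UNIV. (gen i r * gen k s * gen p t) \<otimes>\<^sub>C (gen r j * gen s l * gen t q))"
    by (simp only: sum_product3 pure_tensor_mult)
  also have "\<dots> = (\<Sum>r\<in>UNIV. \<Sum>s\<in>UNIV. \<Sum>t\<in>UNIV. (gen p t * gen k s * gen i r) \<otimes>\<^sub>C (gen t q * gen s l * gen r j))"
    by (intro sum.cong refl arg_cong2[of _ _ _ _ pure_tensor] gen_half_commute)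
  also have "\<dots> = (\<Sum>t\<in>UNIV. \<Sum>s\<in>UNIV. \<Sum>r\<in>UNIV. (gen p t * gen k s * gen i r) \<otimes>\<^sub>C (gen t q * gen s l * gen r j))"
    by (rule sum_reverse)
  also have "\<dots> = ?d p q * ?d k l * ?d i j"
    by (simp only: sum_product3 pure_tensor_mult)
  finally show "?d i j * ?d k l * ?d p q
    = ?d p q * ?d k l * ?d i j" .
  have "(\<Sum>k\<in>UNIV. ?d i k * ?d j k)
      = (\<Sum>k\<in>UNIV. \<Sum>r\<in>UNIV. \<Sum>s\<in>UNIV. (gen i r * gen j s) \<otimes>\<^sub>C (gen r k * gen s k))"
    by (simp only: sum_product pure_tensor_mult)
  also have "\<dots> = (\<Sum>r\<in>UNIV. \<Sum>s\<in>UNIV. \<Sum>k\<in>UNIV. (gen i r * gen j s) \<otimes>\<^sub>C (gen r k * gen s k))"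
    by (rule sum_rotate)
  also have "\<dots> = (\<Sum>r\<in>UNIV. \<Sum>s\<in>UNIV. (gen i r * gen j s) \<otimes>\<^sub>C (if r = s then 1 else 0))"
    by (simp only: gen_rows flip: pure_tensor_sum(2))
  also have "\<dots> = (\<Sum>r\<in>UNIV. (gen i r * gen j r) \<otimes>\<^sub>C 1)"
    by (intro sum.cong refl) (simp add: if_distrib[of "\<lambda>x. _ \<otimes>\<^sub>C x"] pure_tensor_add cong: if_cong)
  also have "\<dots> = (if i = j then 1 else 0)"
    by (simp add: gen_rows pure_tensor_add one_tensor_pure flip: pure_tensor_sum(1))
  finally show "(\<Sum>k\<in>UNIV. ?d i k * ?d j k)
    = (if i = j then 1 else 0)" .
  have "(\<Sum>k\<in>UNIV. ?d k i * ?d k j)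
      = (\<Sum>k\<in>UNIV. \<Sum>r\<in>UNIV. \<Sum>s\<in>UNIV. (gen k r * gen k s) \<otimes>\<^sub>C (gen r i * gen s j))"
    by (simp only: sum_product pure_tensor_mult)
  also have "\<dots> = (\<Sum>r\<in>UNIV. \<Sum>s\<in>UNIV. \<Sum>k\<in>UNIV. (gen k r * gen k s) \<otimes>\<^sub>C (gen r i * gen s j))"
    by (rule sum_rotate)
  also have "\<dots> = (\<Sum>r\<in>UNIV. \<Sum>s\<in>UNIV. (if r = s then 1 else 0) \<otimes>\<^sub>C (gen r i * gen s j))"
    by (simp only: gen_cols flip: pure_tensor_sum(1))
  also have "\<dots> = (\<Sum>r\<in>UNIV. 1 \<otimes>\<^sub>C (gen r i * gen r j))"
    by (intro sum.cong refl) (simp add: if_distrib[of "\<lambda>x. x \<otimes>\<^sub>C _"] pure_tensor_add cong: if_cong)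
  also have "\<dots> = (if i = j then 1 else 0)"
    by (simp add: gen_cols pure_tensor_add one_tensor_pure flip: pure_tensor_sum(2))
  finally show "(\<Sum>k\<in>UNIV. ?d k i * ?d k j)
    = (if i = j then 1 else 0)" .
qed

lemma star_hom_comult: "star_hom (comult :: 'n::finite half_liberated \<Rightarrow> _)"
  and comult_gen: "comult (gen i j) = (\<Sum>k\<in>UNIV. gen i k \<otimes>\<^sub>C gen k (j::'n))"
  unfolding comult_def using universal_hom[OF comult_relation] by auto

lemma comultiplication_half_liberated: "comultiplication half_liberated_matrix = comult"
  by (rule comultiplication_unique[OF generates_half_liberated])
     (simp add: is_comultiplication_def star_hom_comult comult_gen)

definition coinverse :: "'n::finite half_liberated \<Rightarrow> 'n half_liberated" where
  "coinverse x = unopp (universal_hom (\<chi> i j. Opp (gen j i)) x)"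

lemma coinverse_relation: "half_liberated_relation (\<chi> i j. Opp (gen j (i::'n::finite)))" (is "half_liberated_relation ?v")
proof (rule half_liberated_relationI)
  show "star (?v $ i $ j) = ?v $ i $ j" for i j :: 'n
    by (simp add: opp_eq_iff gen_star)
  show "?v $ i $ j * ?v $ k $ l * ?v $ p $ q
    = ?v $ p $ q * ?v $ k $ l * ?v $ i $ j"
    for i j k l p q :: 'n
    by (simp add: opp_eq_iff mult.assoc[symmetric]) (rule gen_half_commute)
  show "(\<Sum>k\<in>UNIV. ?v $ i $ k * ?v $ j $ k)
     = (if i = j then 1 else 0)" for i j :: 'n
    using gen_cols[of j i] by (auto simp: opp_eq_iff)
  show "(\<Sum>k\<in>UNIV. ?v $ k $ i * ?v $ k $ j)
     = (if i = j then 1 else 0)" for i j :: 'n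
    using gen_rows[of j i] by (auto simp: opp_eq_iff)
qed

lemma star_hom_op_coinverse: "star_hom_op (coinverse :: 'n::finite half_liberated \<Rightarrow> _)"
  and coinverse_gen: "coinverse (gen i (j::'n)) = gen j i"
proof -
  note h = star_hom_simps[OF star_hom_universal_hom[OF coinverse_relation]]
  show "star_hom_op (coinverse :: 'n half_liberated \<Rightarrow> _)"
    by (simp add: star_hom_op_def C_linear_def coinverse_def h)
  show "coinverse (gen i j) = gen j i" by (simp add: coinverse_def universal_hom_gen[OF coinverse_relation])
qed

lemma antipode_half_liberated: "antipode half_liberated_matrix = coinverse"
  by (rule antipode_unique[OF generates_half_liberated])
     (simp add: is_antipode_def star_hom_op_coinverse coinverse_gen gen_star)

lemma coinverse_simps:
  "coinverse (x + y) = coinverse x + coinverse y" "coinverse (x * y) = coinverse y * coinverse x"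
  "coinverse 1 = 1" "coinverse (c *\<^sub>C x) = c *\<^sub>C coinverse x"
  using star_hom_op_coinverse by (auto simp: star_hom_op_def C_linear_def)

lemma coinverse_even: "x \<in> even_part \<Longrightarrow> coinverse x \<in> even_part"
  by (induction rule: even_part.induct)
     (simp_all add: coinverse_simps coinverse_gen even_part.intros)

lemma comult_even: "x \<in> even_part \<Longrightarrow> comult x \<in> tensor_of even_part even_part"
proof (induction rule: even_part.induct)
  case (scalar c)
  show ?case
    by (simp add: star_hom_simps[OF star_hom_comult] one_tensor_pure pure_tensor_scale tensor_of.pure
        even_part.scalar even_part_one)
next
  case (gen i j k l)
  show ?case
    by (simp add: star_hom_simps[OF star_hom_comult] comult_gen sum_distrib_left sum_distrib_right
        pure_tensor_mult tensor_of_sum tensor_of.pure even_part.gen)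
qed (auto simp: star_hom_simps[OF star_hom_comult] tensor_of.add intro: tensor_of_mult even_part.mult)

section \<open>Points and tangent vectors\<close>

definition point :: "real^'n^'n \<Rightarrow> 'n::finite half_liberated \<Rightarrow> complex" where
  "point P = universal_hom (\<chi> i j. of_real (P $ i $ j))"

lemma orthogonal_matrix_entries:
  fixes P :: "real^'n^'n"
  assumes "orthogonal_matrix P"
  shows "(\<Sum>k\<in>UNIV. P $ i $ k * P $ j $ k) = (if i = j then 1 else 0)"
    "(\<Sum>k\<in>UNIV. P $ k $ i * P $ k $ j) = (if i = j then 1 else 0)"
proof -
  have "(P ** transpose P) $ i $ j = mat 1 $ i $ j" "(transpose P ** P) $ i $ j = mat 1 $ i $ j"
    using assms by (simp_all add: orthogonal_matrix_def)
  then show "(\<Sum>k\<in>UNIV. P $ i $ k * P $ j $ k) = (if i = j then 1 else 0)"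
    "(\<Sum>k\<in>UNIV. P $ k $ i * P $ k $ j) = (if i = j then 1 else 0)"
    by (simp_all add: matrix_matrix_mult_def mat_def)
qed

lemma
  fixes P :: "real^'n^'n"
  assumes "orthogonal_matrix P"
  shows star_hom_point: "star_hom (point P)" and point_gen: "point P (gen i j) = of_real (P $ i $ j)"
proof -
  have "half_liberated_relation (\<chi> i j. complex_of_real (P $ i $ j))"
    by (rule half_liberated_relationI)
       (simp_all add: star_complex_def orthogonal_matrix_entries[OF assms] flip: of_real_mult of_real_sum)
  from universal_hom[OF this] show "star_hom (point P)" "point P (gen i j) = of_real (P $ i $ j)"
    by (simp_all add: point_def)
qed

abbreviation unit_point :: "'n::finite half_liberated \<Rightarrow> complex" where
  "unit_point \<equiv> point (mat 1)"

lemmas star_hom_unit_point = star_hom_point[OF orthogonal_matrix_id]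
lemmas unit_point_simps = star_hom_simps[OF star_hom_unit_point]

lemma unit_point_gen: "unit_point (gen i j) = (if i = j then 1 else 0)"
  unfolding point_gen[OF orthogonal_matrix_id] by (simp add: mat_def)

text \<open>The determinant of \<open>A\<close> is a unit, so the adjugate provides a left inverse.\<close>

lemma matrix_right_inverse_comm_ring:
  fixes A B :: "'a::comm_ring_1^'n^'n"
  assumes "A ** B = mat 1"
  shows "B ** A = mat 1"
proof -
  have "det A * det B = 1" using assms by (simp flip: det_mul)
  define L where "L = mat (det B) ** cofactor_matrix (transpose A)"
  have "mat (det B) ** mat (det A) = (mat 1 :: 'a^'n^'n)"
    using \<open>det A * det B = 1\<close> by (simp add: vec_eq_iff mat_mult_entry) (simp add: mat_def mult.commute)
  then have "L ** A = mat 1"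
    by (simp add: L_def cofactor_matrix_left flip: matrix_mul_assoc)
  moreover have "L = B" by (metis assms calculation matrix_mul_assoc matrix_mul_lid matrix_mul_rid)
  ultimately show ?thesis by simp
qed

definition line :: "real^'n^'n \<Rightarrow> complex fps^'n^'n" where
  "line Z = (\<chi> i j. fps_const (if i = j then 1 else 0) + fps_X * fps_const (of_real (Z $ i $ j)))"

text \<open>The determinant of \<open>1 + t Z\<close> has constant term \<open>1\<close>, so it is invertible as a power series.\<close>

definition line_inverse :: "real^'n^'n \<Rightarrow> complex fps^'n^'n" where
  "line_inverse Z = transpose (cofactor_matrix (line Z)) ** mat (inverse (det (line Z)))"

lemma unital_ring_hom_fps_nth_0: "unital_ring_hom (\<lambda>F :: 'a::comm_ring_1 fps. fps_nth F 0)"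
  by (simp add: unital_ring_hom_def)

lemma line_nth:
  "fps_nth (line Z $ i $ j) 0 = (if i = j then 1 else 0)"
  "fps_nth (line Z $ i $ j) 1 = of_real (Z $ i $ j)"
  by (simp_all add: line_def)

lemma line_inverse_right: "line Z ** line_inverse Z = mat 1"
  and line_inverse_left: "line_inverse Z ** line Z = mat 1"
proof -
  have "fps_nth (det (line Z)) 0 = det (map_entries (\<lambda>F. fps_nth F 0) (line Z))"
    by (simp add: det_map_entries[OF unital_ring_hom_fps_nth_0])
  also have "map_entries (\<lambda>F. fps_nth F 0) (line Z) = mat 1"
    by (simp add: vec_eq_iff line_nth mat_def)
  finally have "inverse (det (line Z)) * det (line Z) = 1" by (intro inverse_mult_eq_1) simp
  then have "mat (det (line Z)) ** mat (inverse (det (line Z))) = (mat 1 :: complex fps^'a^'a)"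
    by (simp add: vec_eq_iff mat_mult_entry) (simp add: mat_def mult.commute)
  then show r: "line Z ** line_inverse Z = mat 1"
    by (simp add: line_inverse_def matrix_mul_assoc cofactor_matrix_right)
  show "line_inverse Z ** line Z = mat 1" by (rule matrix_right_inverse_comm_ring[OF r])
qed

lemma line_star: "star (line Z $ i $ j) = line Z $ i $ j"
  by (simp add: line_def star_fps_def fps_eq_iff star_complex_def)

lemma line_inverse_star: "star (line_inverse Z $ i $ j) = line_inverse Z $ i $ j"
proof -
  have h: "unital_ring_hom (star :: complex fps \<Rightarrow> complex fps)"
    by (simp add: unital_ring_hom_def star_add star_mult star_one mult.commute)
  have "map_entries star (line Z) = line Z" by (simp add: vec_eq_iff line_star)
  then have "line Z ** map_entries star (line_inverse Z) = map_entries star (line Z ** line_inverse Z)"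
    by (simp add: map_entries_simps(3)[OF h])
  then have "line Z ** map_entries star (line_inverse Z) = mat 1"
    by (simp add: line_inverse_right map_entries_simps[OF h] star_one)
  then have "map_entries star (line_inverse Z) = line_inverse Z"
    by (metis line_inverse_left matrix_mul_assoc matrix_mul_lid matrix_mul_rid)
  then show ?thesis by (metis map_entries_entry)
qed

lemma line_entries:
  "(\<Sum>k\<in>UNIV. line Z $ i $ k * line_inverse Z $ k $ j) = (if i = j then 1 else 0)"
  "(\<Sum>k\<in>UNIV. line_inverse Z $ i $ k * line Z $ k $ j) = (if i = j then 1 else 0)"
proof -
  have "(line Z ** line_inverse Z) $ i $ j = mat 1 $ i $ j" "(line_inverse Z ** line Z) $ i $ j = mat 1 $ i $ j"
    by (simp_all add: line_inverse_right line_inverse_left)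
  then show "(\<Sum>k\<in>UNIV. line Z $ i $ k * line_inverse Z $ k $ j) = (if i = j then 1 else 0)"
    "(\<Sum>k\<in>UNIV. line_inverse Z $ i $ k * line Z $ k $ j) = (if i = j then 1 else 0)"
    by (simp_all add: matrix_matrix_mult_def mat_def)
qed

lemma line_inverse_nth:
  "fps_nth (line_inverse Z $ i $ j) 0 = (if i = j then 1 else 0)"
  "fps_nth (line_inverse Z $ i $ j) 1 = - of_real (Z $ i $ j)"
proof -
  have "fps_nth (\<Sum>k\<in>UNIV. line Z $ i $ k * line_inverse Z $ k $ j) 0 = (if i = j then 1 else 0)" for i j
    by (simp add: line_entries)
  then show 0: "fps_nth (line_inverse Z $ i $ j) 0 = (if i = j then 1 else 0)" for i j
    by (simp add: fps_sum_nth line_nth if_distrib[of "\<lambda>x. x * _"] cong: if_cong)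
  have "0 = fps_nth (\<Sum>k\<in>UNIV. line Z $ i $ k * line_inverse Z $ k $ j) 1" by (simp add: line_entries)
  also have "\<dots> = (\<Sum>k\<in>UNIV. fps_nth (line Z $ i $ k) 0 * fps_nth (line_inverse Z $ k $ j) 1
      + fps_nth (line Z $ i $ k) 1 * fps_nth (line_inverse Z $ k $ j) 0)"
    by (simp add: fps_sum_nth fps_mult_nth)
  also have "\<dots> = fps_nth (line_inverse Z $ i $ j) 1 + of_real (Z $ i $ j)"
    by (simp add: line_nth[unfolded One_nat_def] 0 sum.distrib if_distrib[of "\<lambda>x. x * _"] if_distrib[of "\<lambda>x. _ * x"] cong: if_cong)
  finally show "fps_nth (line_inverse Z $ i $ j) 1 = - of_real (Z $ i $ j)"
    by (simp add: eq_neg_iff_add_eq_0)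
qed

lemma fps_deriv_line: "fps_deriv (line Z $ i $ j) = fps_const (of_real (Z $ i $ j))"
  by (simp add: line_def)

lemma fps_deriv_line_inverse:
  "map_entries fps_deriv (line_inverse Z)
    = - (line_inverse Z ** map_entries fps_const (map_entries of_real Z) ** line_inverse Z)"
proof -
  let ?V = "line_inverse Z" and ?Z = "map_entries fps_const (map_entries of_real Z)"
  have "(map_entries fps_deriv ?V ** line Z + ?V ** ?Z) $ i $ j = 0" for i j
  proof -
    have "(\<Sum>k\<in>UNIV. fps_deriv (?V $ i $ k * line Z $ k $ j))
        = fps_deriv (\<Sum>k\<in>UNIV. ?V $ i $ k * line Z $ k $ j)" by (rule fps_deriv_sum[symmetric])
    also have "\<dots> = 0" by (simp add: line_entries)
    finally show ?thesis
      by (simp add: matrix_matrix_mult_def sum.distrib[symmetric] fps_deriv_line add.commute)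
  qed
  then have 0: "map_entries fps_deriv ?V ** line Z + ?V ** ?Z = 0" by (simp add: vec_eq_iff)
  have "map_entries fps_deriv ?V ** line Z = - (?V ** ?Z)"
    using 0 by (simp add: eq_neg_iff_add_eq_0)
  then have "map_entries fps_deriv ?V ** (line Z ** ?V) = (- (?V ** ?Z)) ** ?V"
    by (simp add: matrix_mul_assoc)
  then show ?thesis
    by (simp add: line_inverse_right) (simp add: vec_eq_iff matrix_matrix_mult_def sum_negf)
qed

text \<open>For an invertible matrix \<open>w\<close>, the antidiagonal matrices with entries \<open>w\<^sub>i\<^sub>j\<close> and \<open>(w\<^sup>-\<^sup>t)\<^sub>i\<^sub>j\<close> satisfy the
  relations of \<open>A\<^sub>o\<^sup>*(n)\<close>.  Even words become diagonal, and the upper left entry of \<open>u\<^sub>i\<^sub>j u\<^sub>k\<^sub>l\<close> is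
  \<open>w\<^sub>i\<^sub>j (w\<^sup>-\<^sup>t)\<^sub>k\<^sub>l\<close>.  Here \<open>w = 1 + t Z\<close>; the matrix \<open>Z\<close> is real to make the generators self-adjoint.\<close>

definition line_rep :: "real^'n^'n \<Rightarrow> 'n::finite half_liberated \<Rightarrow> complex fps mat2" where
  "line_rep Z = universal_hom (\<chi> i j. Mat2 0 (line Z $ i $ j) (line_inverse Z $ j $ i) 0)"

lemma mat2_eqI: "m11 x = m11 y \<Longrightarrow> m12 x = m12 y \<Longrightarrow> m21 x = m21 y \<Longrightarrow> m22 x = m22 y \<Longrightarrow> x = y"
  by (rule mat2.expand) simp

lemma
  fixes Z :: "real^'n^'n"
  shows star_hom_line_rep: "star_hom (line_rep Z)"
    and line_rep_gen: "line_rep Z (gen i j) = Mat2 0 (line Z $ i $ j) (line_inverse Z $ j $ i) 0"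
proof -
  have r: "half_liberated_relation (\<chi> i j. Mat2 0 (line Z $ i $ j) (line_inverse Z $ j $ i) 0)"
  proof (rule half_liberated_relationI, simp_all only: vec_lambda_beta)
    let ?m = "\<lambda>i j. Mat2 0 (line Z $ i $ j) (line_inverse Z $ j $ i) 0"
    fix i j k l p q :: 'n
    show "star (?m i j) = ?m i j"
      by (simp add: star_mat2_def line_star line_inverse_star star_zero)
    show "?m i j * ?m k l *
       ?m p q =
       ?m p q * ?m k l *
       ?m i j"
      by (rule mat2_eqI) (simp_all add: mult_ac)
    show "(\<Sum>k\<in>UNIV. ?m i k * ?m j k)
      = (if i = j then 1 else 0)"
      using line_entries(1)[of Z i j] line_entries(1)[of Z j i] by (intro mat2_eqI) (auto simp: mult.commute)
    show "(\<Sum>k\<in>UNIV. ?m k i * ?m k j)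
      = (if i = j then 1 else 0)"
      using line_entries(2)[of Z i j] line_entries(2)[of Z j i] by (intro mat2_eqI) (auto simp: mult.commute)
  qed
  from universal_hom[OF r] show "star_hom (line_rep Z)"
    "line_rep Z (gen i j) = Mat2 0 (line Z $ i $ j) (line_inverse Z $ j $ i) 0"
    by (simp_all add: line_rep_def)
qed

definition line_char :: "real^'n^'n \<Rightarrow> 'n::finite half_liberated \<Rightarrow> complex fps" where
  "line_char Z p = m11 (line_rep Z p)"

lemmas line_rep_simps = star_hom_simps[OF star_hom_line_rep]

lemma line_rep_even: "p \<in> even_part \<Longrightarrow> m12 (line_rep Z p) = 0 \<and> m21 (line_rep Z p) = 0"
  by (induction rule: even_part.induct) (auto simp: line_rep_simps line_rep_gen scaleC_zero_right)

lemma line_char_odd: "p \<in> odd_part \<Longrightarrow> line_char Z p = 0"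
  by (induction rule: odd_part.induct) (auto simp: line_char_def line_rep_simps line_rep_gen line_rep_even)

lemma line_char_simps:
  "line_char Z (p + q) = line_char Z p + line_char Z q"
  "line_char Z (c *\<^sub>C p) = c *\<^sub>C line_char Z p" "line_char Z 1 = 1"
  "line_char Z (gen a b * gen c' d) = line Z $ a $ b * line_inverse Z $ d $ c'"
  by (simp_all add: line_char_def line_rep_simps line_rep_gen)

lemma line_char_mult: "p \<in> even_part \<Longrightarrow> line_char Z (p * q) = line_char Z p * line_char Z q"
  using line_rep_even[of p Z] by (simp add: line_char_def line_rep_simps)

lemma fps_scaleC: "c *\<^sub>C F = fps_const c * (F :: complex fps)"
  by (simp add: scaleC_fps_def fps_eq_iff scaleC_complex_def)

lemma line_char_nth_0: "p \<in> even_part \<Longrightarrow> fps_nth (line_char Z p) 0 = unit_point p"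
proof (induction rule: even_part.induct)
  case (gen i j k l)
  show ?case by (simp add: line_char_simps unit_point_simps unit_point_gen line_nth line_inverse_nth)
qed (simp_all add: line_char_simps line_char_mult fps_scaleC unit_point_simps scaleC_complex_def)

text \<open>The derivation of the even part at the counit in the direction of an elementary matrix.\<close>

definition tangent :: "'n::finite \<Rightarrow> 'n \<Rightarrow> 'n half_liberated \<Rightarrow> complex" where
  "tangent i j p = fps_nth (line_char (\<chi> a b. if a = i \<and> b = j then 1 else 0) p) 1"

lemma tangent_simps:
  "tangent i j (p + q) = tangent i j p + tangent i j q"
  "tangent i j (c *\<^sub>C p) = c * tangent i j p" "tangent i j 1 = 0" "tangent i j 0 = 0"
  "tangent i j (gen a b * gen c' d)
     = (if a = i \<and> b = j \<and> c' = d then 1 else 0) - (if a = b \<and> d = i \<and> c' = j then 1 else 0)"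
  by (auto simp: tangent_def line_char_simps fps_scaleC fps_mult_nth line_nth line_inverse_nth
      line_nth[unfolded One_nat_def] line_inverse_nth[unfolded One_nat_def])
     (simp add: line_char_def line_rep_simps)

lemma C_linear_tangent: "C_linear (tangent i j)"
  by (simp add: C_linear_def tangent_simps scaleC_complex_def)

lemma tangent_odd: "p \<in> odd_part \<Longrightarrow> tangent i j p = 0"
  by (simp add: tangent_def line_char_odd)

lemma tangent_mult:
  assumes "p \<in> even_part" "q \<in> even_part"
  shows "tangent i j (p * q) = tangent i j p * unit_point q + unit_point p * tangent i j q"
  using assms by (simp add: tangent_def line_char_mult fps_mult_nth line_char_nth_0)

lemma tangent_trace: "p \<in> even_part \<Longrightarrow> (\<Sum>i\<in>UNIV. tangent i i p) = 0"
proof (induction rule: even_part.induct)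
  case (gen a b c d)
  have "(\<Sum>i\<in>UNIV. if a = i \<and> b = i \<and> c = d then 1 else 0 :: complex)
      = (\<Sum>i\<in>UNIV. if i = a then (if a = b \<and> c = d then 1 else 0) else 0)"
    "(\<Sum>i\<in>UNIV. if a = b \<and> d = i \<and> c = i then 1 else 0 :: complex)
      = (\<Sum>i\<in>UNIV. if i = c then (if a = b \<and> c = d then 1 else 0) else 0)"
    by (intro sum.cong; auto)+
  then show ?case by (simp add: tangent_simps sum_subtractf)
next
  case (mult x y)
  then show ?case by (simp add: tangent_mult sum.distrib flip: sum_distrib_left sum_distrib_right)
qed (simp_all add: tangent_simps sum.distrib)

text \<open>For the angle \<open>\<theta>\<close>, with \<open>c = cos \<theta>\<close> and \<open>s = sin \<theta>\<close>, the derivative at \<open>\<theta> = 0\<close> is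
  \<open>E\<^sub>k\<^sub>l - E\<^sub>l\<^sub>k\<close>.\<close>

definition plane_rotation :: "'n::finite \<Rightarrow> 'n \<Rightarrow> real \<Rightarrow> real \<Rightarrow> real^'n^'n" where
  "plane_rotation k l c s = (\<chi> i. if i = k then c *\<^sub>R axis k 1 + s *\<^sub>R axis l 1
     else if i = l then - s *\<^sub>R axis k 1 + c *\<^sub>R axis l 1 else axis i 1)"

lemma orthogonal_plane_rotation:
  assumes "k \<noteq> l" "c\<^sup>2 + s\<^sup>2 = 1"
  shows "orthogonal_matrix (plane_rotation k l c s)"
proof -
  have "c * c + s * s = 1" using assms by (simp add: power2_eq_square)
  then have "plane_rotation k l c s $ i \<bullet> plane_rotation k l c s $ j = (if i = j then 1 else 0)" for i j
    using assms(1) by (auto simp: plane_rotation_def inner_add_left inner_add_right inner_diff_left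
        inner_diff_right inner_axis_axis algebra_simps)
  then have "plane_rotation k l c s ** transpose (plane_rotation k l c s) = mat 1"
    by (simp add: vec_eq_iff matrix_matrix_mult_def mat_def inner_vec_def)
  then show ?thesis by (metis matrix_left_right_inverse orthogonal_matrix)
qed

text \<open>The rotations form a curve in the orthogonal group, on which \<open>p\<close> vanishes, and the derivative of
  \<open>p\<close> along this curve is the difference of the two sides.\<close>

lemma tangent_symmetric:
  assumes p: "p \<in> even_part" and zero: "\<And>P. orthogonal_matrix P \<Longrightarrow> point P p = 0"
  shows "tangent k l p = tangent l k p"
proof (cases "k = l")
  case False
  let ?c = "\<lambda>\<theta>. plane_rotation k l (cos \<theta>) (sin \<theta>)"
  have orth: "orthogonal_matrix (?c \<theta>)" for \<theta>
    using False by (intro orthogonal_plane_rotation) auto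
  note h = star_hom_simps[OF star_hom_point[OF orth]] point_gen[OF orth]
  have c0: "?c 0 = mat 1" by (auto simp: plane_rotation_def vec_eq_iff axis_def mat_def)
  let ?X = "\<lambda>a b. (if a = k \<and> b = l then 1 else 0) - (if a = l \<and> b = k then 1 else 0)"
  have der: "((\<lambda>\<theta>. complex_of_real (?c \<theta> $ a $ b)) has_vector_derivative ?X a b) (at 0)" for a b
  proof -
    have "((\<lambda>\<theta>. ?c \<theta> $ a $ b) has_real_derivative ?X a b) (at 0)"
      using False unfolding plane_rotation_def
      by (cases "a = k"; cases "a = l"; cases "b = k"; cases "b = l")
         (auto simp: axis_def intro!: derivative_eq_intros)
    then have d: "((\<lambda>\<theta>. complex_of_real (?c \<theta> $ a $ b)) has_vector_derivative of_real (?X a b)) (at 0)"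
      by (rule has_vector_derivative_of_real)
    have eq: "complex_of_real (?X a b) = ?X a b"
      by (simp only: of_real_diff of_real_1 of_real_0 if_distrib[of complex_of_real])
    show ?thesis using d unfolding eq .
  qed
  have "((\<lambda>\<theta>. point (?c \<theta>) p) has_vector_derivative (tangent k l p - tangent l k p)) (at 0)"
    using p
  proof (induction rule: even_part.induct)
    case (scalar x)
    show ?case by (simp add: h tangent_simps)
  next
    case (gen a b c' d)
    have "((\<lambda>\<theta>. complex_of_real (?c \<theta> $ a $ b) * complex_of_real (?c \<theta> $ c' $ d)) has_vector_derivative
       (complex_of_real (?c 0 $ a $ b) * ?X c' d + ?X a b * complex_of_real (?c 0 $ c' $ d))) (at 0)"
      by (rule has_vector_derivative_mult[OF der der])
    moreover have "complex_of_real (?c 0 $ a $ b) * ?X c' d + ?X a b * complex_of_real (?c 0 $ c' $ d)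
        = tangent k l (gen a b * gen c' d) - tangent l k (gen a b * gen c' d)"
      using False unfolding c0 tangent_simps by (auto simp: mat_def)
    ultimately show ?case by (simp add: h)
  next
    case (add x y)
    from has_vector_derivative_add[OF add(3,4)] show ?case
      by (simp add: h tangent_simps algebra_simps)
  next
    case (mult x y)
    from has_vector_derivative_mult[OF mult(3,4)] mult(1,2) show ?case
      unfolding c0 by (simp add: h tangent_mult algebra_simps)
  qed
  moreover have "((\<lambda>\<theta>. point (?c \<theta>) p) has_vector_derivative 0) (at 0)"
    by (simp add: zero[OF orth])
  ultimately have "tangent k l p - tangent l k p = 0" by (rule vector_derivative_unique_at)
  then show ?thesis by simp
qed simp

section \<open>Invariant derivations and the adjoint coaction\<close>

lemma sum_delta_outer:
  "(\<Sum>k\<in>UNIV. \<Sum>l\<in>UNIV. if k = i then g k l else 0) = (\<Sum>l\<in>UNIV. g (i :: 'n::finite) (l :: 'm::finite))"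
  "(\<Sum>k\<in>UNIV. \<Sum>l\<in>UNIV. if i = k then g k l else 0) = (\<Sum>l\<in>UNIV. g i l)"
  by (subst sum.swap, simp)+

text \<open>This covers the Leibniz rule for \<open>(id \<otimes> D)\<Delta>\<close> with a derivation \<open>D\<close> as well as the
  multiplicativity of contractions.\<close>

lemma contract_bilinear_product:
  assumes \<beta>: "bilinear_map \<beta>" "bilinear_map \<beta>1" "bilinear_map \<beta>2" "bilinear_map \<beta>3" "bilinear_map \<beta>4"
    and eq: "\<And>a b c d. a \<in> E \<Longrightarrow> c \<in> E \<Longrightarrow> b \<in> E' \<Longrightarrow> d \<in> E' \<Longrightarrow>
      \<beta> (a * c) (b * d) = \<beta>1 a b * \<beta>2 c d + \<beta>3 a b * \<beta>4 c d"
    and s: "s \<in> tensor_of E E'" and t: "t \<in> tensor_of E E'"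
  shows "contract \<beta> (s * t) = contract \<beta>1 s * contract \<beta>2 t + contract \<beta>3 s * contract \<beta>4 t"
proof -
  note c = contract_simps[OF \<beta>(1)] contract_simps[OF \<beta>(2)] contract_simps[OF \<beta>(3)]
    contract_simps[OF \<beta>(4)] contract_simps[OF \<beta>(5)]
  from s show ?thesis
  proof induction
    case (pure a b)
    from t show ?case
      by induction (simp_all add: c pure_tensor_mult eq[OF pure(1) _ pure(2)] distrib_left add_ac)
  qed (simp_all add: c distrib_right add_ac)
qed

lemma bilinear_map_functional_right: "C_linear \<phi> \<Longrightarrow> bilinear_map (\<lambda>a b. \<phi> b *\<^sub>C a)"
  by (auto simp: bilinear_map_def C_linear_def scaleC_add_left scaleC_add_right scaleC_scaleC
      scaleC_complex_def mult.commute)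

lemma bilinear_map_functional_left: "C_linear \<phi> \<Longrightarrow> bilinear_map (\<lambda>a b. \<phi> a *\<^sub>C b)"
  by (auto simp: bilinear_map_def C_linear_def scaleC_add_left scaleC_add_right scaleC_scaleC
      scaleC_complex_def mult.commute)

lemma bilinear_map_mult:
  "C_linear h \<Longrightarrow> C_linear k \<Longrightarrow> bilinear_map (\<lambda>a b. h a * k b)"
  by (auto simp: bilinear_map_def C_linear_def distrib_left distrib_right mult_scaleC_left mult_scaleC_right)

lemma C_linear_point: "orthogonal_matrix P \<Longrightarrow> C_linear (point P)"
  using star_hom_point by (auto simp: star_hom_def)

lemmas comult_simps = star_hom_simps[OF star_hom_comult]

definition translate :: "real^'n^'n \<Rightarrow> 'n::finite half_liberated \<Rightarrow> 'n half_liberated" where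
  "translate P x = contract (\<lambda>a b. point P b *\<^sub>C a) (comult x)"

definition left_translate :: "real^'n^'n \<Rightarrow> 'n::finite half_liberated \<Rightarrow> 'n half_liberated" where
  "left_translate P x = contract (\<lambda>a b. point P a *\<^sub>C b) (comult x)"

lemma translate_simps:
  assumes "orthogonal_matrix P"
  shows "translate P (x + y) = translate P x + translate P y"
    "translate P (x * y) = translate P x * translate P y"
    "translate P (c *\<^sub>C 1) = c *\<^sub>C 1" "translate P 0 = 0"
    "translate P (gen i j) = (\<Sum>k\<in>UNIV. of_real (P $ k $ j) *\<^sub>C gen i k)"
proof -
  note b = bilinear_map_functional_right[OF C_linear_point[OF assms]]
  note c = contract_simps[OF b] contract_sum[OF b] contract_scale[OF b]
  note h = star_hom_simps[OF star_hom_point[OF assms]] point_gen[OF assms]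
  show "translate P (x + y) = translate P x + translate P y" "translate P 0 = 0"
    by (simp_all add: translate_def c comult_simps)
  show "translate P (x * y) = translate P x * translate P y"
    unfolding translate_def comult_simps(2) by (rule contract_multiplicative[OF b])
      (simp add: h mult_scaleC_left mult_scaleC_right scaleC_scaleC mult.commute)
  show "translate P (c *\<^sub>C 1) = c *\<^sub>C 1"
    by (simp add: translate_def comult_simps c one_tensor_pure h scaleC_one del: one_tensor_def)
  show "translate P (gen i j) = (\<Sum>k\<in>UNIV. of_real (P $ k $ j) *\<^sub>C gen i k)"
    by (simp add: translate_def comult_gen c h)
qed

lemma left_translate_simps:
  assumes "orthogonal_matrix P"
  shows "left_translate P (x + y) = left_translate P x + left_translate P y"
    "left_translate P (x * y) = left_translate P x * left_translate P y"
    "left_translate P (c *\<^sub>C x) = c *\<^sub>C left_translate P x" "left_translate P 0 = 0"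
    "left_translate P (gen i j) = (\<Sum>k\<in>UNIV. of_real (P $ i $ k) *\<^sub>C gen k j)"
proof -
  note b = bilinear_map_functional_left[OF C_linear_point[OF assms]]
  note c = contract_simps[OF b] contract_sum[OF b] contract_scale[OF b]
  note h = star_hom_simps[OF star_hom_point[OF assms]] point_gen[OF assms]
  show "left_translate P (x + y) = left_translate P x + left_translate P y" "left_translate P 0 = 0"
    "left_translate P (c *\<^sub>C x) = c *\<^sub>C left_translate P x"
    by (simp_all add: left_translate_def c comult_simps)
  show "left_translate P (x * y) = left_translate P x * left_translate P y"
    unfolding left_translate_def comult_simps(2) by (rule contract_multiplicative[OF b])
      (simp add: h mult_scaleC_left mult_scaleC_right scaleC_scaleC mult.commute)
  show "left_translate P (gen i j) = (\<Sum>k\<in>UNIV. of_real (P $ i $ k) *\<^sub>C gen k j)"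
    by (simp add: left_translate_def comult_gen c h)
qed

lemma translate_one: "translate (mat 1) x = x"
proof (induction x rule: half_liberated_induct)
  case (gen i j)
  have "(\<Sum>k\<in>UNIV. complex_of_real ((mat 1 :: real^'a^'a) $ k $ j) *\<^sub>C gen i k) = gen i j"
    by (simp add: mat_def if_distrib[of complex_of_real] if_distrib[of "\<lambda>x. x *\<^sub>C _"]
        scaleC_zero_left scaleC_one cong: if_cong)
  then show ?case by (simp add: translate_simps[OF orthogonal_matrix_id])
qed (simp_all add: translate_simps[OF orthogonal_matrix_id])

text \<open>The derivation \<open>(id \<otimes> D)\<Delta>\<close> of the even part; as a vector field it extends the tangent vector \<open>D\<close>
  at the identity by left translation.\<close>

definition invariant_derivation :: "'n::finite \<Rightarrow> 'n \<Rightarrow> 'n half_liberated \<Rightarrow> 'n half_liberated" where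
  "invariant_derivation i j x = contract (\<lambda>a b. tangent i j b *\<^sub>C a) (comult x)"

lemma invariant_derivation_simps:
  "invariant_derivation i j (x + y) = invariant_derivation i j x + invariant_derivation i j y"
  "invariant_derivation i j (c *\<^sub>C x) = c *\<^sub>C invariant_derivation i j x"
  "invariant_derivation i j 1 = 0"
  "invariant_derivation i j (gen a b * gen c' d)
    = (if b = j then gen a i * gen c' d else 0) - (if d = i then gen a b * gen c' j else 0)"
proof -
  note b = bilinear_map_functional_right[OF C_linear_tangent[of i j]]
  note c = contract_simps[OF b] contract_sum[OF b] contract_scale[OF b]
  show "invariant_derivation i j (x + y) = invariant_derivation i j x + invariant_derivation i j y"
    "invariant_derivation i j (c *\<^sub>C x) = c *\<^sub>C invariant_derivation i j x"
    by (simp_all add: invariant_derivation_def comult_simps c)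
  show "invariant_derivation i j 1 = 0"
    by (simp add: invariant_derivation_def comult_simps c one_tensor_pure tangent_simps scaleC_zero_left)
  have "invariant_derivation i j (gen a b * gen c' d)
      = (\<Sum>k\<in>UNIV. \<Sum>l\<in>UNIV. tangent i j (gen k b * gen l d) *\<^sub>C (gen a k * gen c' l))"
    by (simp add: invariant_derivation_def comult_simps comult_gen sum_product pure_tensor_mult c)
  also have "\<dots> = (\<Sum>k\<in>UNIV. \<Sum>l\<in>UNIV. (if b = j then (if k = i then (if l = d then gen a k * gen c' l else 0) else 0) else 0)
       - (if d = i then (if k = b then (if l = j then gen a k * gen c' l else 0) else 0) else 0))"
    by (intro sum.cong refl) (auto simp: tangent_simps scaleC_diff_left scaleC_zero_left scaleC_one)
  also have "\<dots> = (if b = j then gen a i * gen c' d else 0) - (if d = i then gen a b * gen c' j else 0)"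
    by (simp add: sum_subtractf sum_delta_outer)
  finally show "invariant_derivation i j (gen a b * gen c' d)
    = (if b = j then gen a i * gen c' d else 0) - (if d = i then gen a b * gen c' j else 0)" .
qed

lemma C_linear_invariant_derivation: "C_linear (invariant_derivation i j)"
  by (simp add: C_linear_def invariant_derivation_simps)

lemma invariant_derivation_even:
  assumes "x \<in> even_part"
  shows "invariant_derivation i j x \<in> even_part"
proof -
  note b = bilinear_map_functional_right[OF C_linear_tangent[of i j]]
  from comult_even[OF assms] have "contract (\<lambda>a b. tangent i j b *\<^sub>C a) (comult x) \<in> even_part"
    by induction (simp_all add: contract_simps[OF b] even_part_zero even_part.add even_part_scale)
  then show ?thesis by (simp add: invariant_derivation_def)
qed

lemma invariant_derivation_mult:
  assumes "x \<in> even_part" "y \<in> even_part"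
  shows "invariant_derivation i j (x * y)
    = invariant_derivation i j x * y + x * invariant_derivation i j y"
proof -
  let ?\<beta> = "\<lambda>a b. tangent i j b *\<^sub>C a" and ?\<epsilon> = "\<lambda>a b. unit_point b *\<^sub>C a"
  have b: "bilinear_map ?\<beta>" "bilinear_map ?\<epsilon>"
    by (intro bilinear_map_functional_right C_linear_tangent C_linear_point orthogonal_matrix_id)+
  have "contract ?\<beta> (comult x * comult y)
      = contract ?\<beta> (comult x) * contract ?\<epsilon> (comult y) + contract ?\<epsilon> (comult x) * contract ?\<beta> (comult y)"
    by (rule contract_bilinear_product[OF b(1) b(1) b(2) b(2) b(1) _ comult_even[OF assms(1)] comult_even[OF assms(2)]])
       (simp add: tangent_mult scaleC_add_left mult_scaleC_left mult_scaleC_right scaleC_scaleC mult.commute)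
  moreover have "contract ?\<epsilon> (comult z) = z" for z :: "'a half_liberated"
    using translate_one[of z] by (simp add: translate_def)
  ultimately show ?thesis by (simp add: invariant_derivation_def comult_simps)
qed

text \<open>The chain rule: the velocity \<open>Z\<close> of the line at the point \<open>w = 1 + t Z\<close> is the value at \<open>w\<close> of the
  left invariant vector field of \<open>w\<^sup>-\<^sup>1 Z\<close>.\<close>

lemma fps_deriv_line_char:
  assumes "p \<in> even_part"
  shows "fps_deriv (line_char Z p) = (\<Sum>i\<in>UNIV. \<Sum>j\<in>UNIV.
    (line_inverse Z ** map_entries fps_const (map_entries of_real Z)) $ i $ j * line_char Z (invariant_derivation i j p))"
  using assms
proof (induction rule: even_part.induct)
  case (scalar c)
  have "line_char Z 0 = 0" by (simp add: line_char_def line_rep_simps)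
  then show ?case by (simp add: line_char_simps invariant_derivation_simps fps_scaleC)
next
  case (gen a b c d)
  let ?V = "line_inverse Z" and ?Z = "map_entries fps_const (map_entries of_real Z)"
  let ?Y = "?V ** ?Z"
  have 0: "line_char Z 0 = 0" and minus: "line_char Z (x - y) = line_char Z x - line_char Z y" for x y
    by (simp_all add: line_char_def line_rep_simps minus_mat2_def)
  have if0: "line_char Z (if P then x else 0) = (if P then line_char Z x else 0)" for P x by (simp add: 0)
  have "(\<Sum>i\<in>UNIV. \<Sum>j\<in>UNIV. ?Y $ i $ j * line_char Z (invariant_derivation i j (gen a b * gen c d)))
      = (\<Sum>i\<in>UNIV. ?Y $ i $ b * (line Z $ a $ i * ?V $ d $ c))
        - (\<Sum>j\<in>UNIV. ?Y $ d $ j * (line Z $ a $ b * ?V $ j $ c))"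
    by (simp add: invariant_derivation_simps minus if0 line_char_simps right_diff_distrib sum_subtractf
        if_distrib[of "\<lambda>x. _ * x"] sum_delta_outer cong: if_cong)
  also have "(\<Sum>i\<in>UNIV. ?Y $ i $ b * (line Z $ a $ i * ?V $ d $ c)) = (line Z ** ?Y) $ a $ b * ?V $ d $ c"
    by (simp add: matrix_matrix_mult_def[of "line Z"] sum_distrib_left sum_distrib_right mult_ac)
  also have "line Z ** ?Y = ?Z" by (simp add: matrix_mul_assoc line_inverse_right)
  also have "(\<Sum>j\<in>UNIV. ?Y $ d $ j * (line Z $ a $ b * ?V $ j $ c)) = line Z $ a $ b * (?Y ** ?V) $ d $ c"
    by (simp add: matrix_matrix_mult_def[of ?Y] sum_distrib_left sum_distrib_right mult_ac)
  also have "(?Y ** ?V) $ d $ c = - fps_deriv (?V $ d $ c)"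
    using arg_cong[OF fps_deriv_line_inverse, of "\<lambda>M. M $ d $ c" Z] by simp
  finally show ?case by (simp add: line_char_simps fps_deriv_line)
next
  case (add x y)
  then show ?case by (simp add: line_char_simps invariant_derivation_simps distrib_left sum.distrib)
next
  case (mult x y)
  then show ?case
    by (simp add: line_char_mult invariant_derivation_mult invariant_derivation_even line_char_simps
        sum.distrib sum_distrib_left sum_distrib_right distrib_left mult_ac)
qed

text \<open>Both sides are multiplicative on the even part, the left one because the even part is
  commutative.\<close>

lemma antipode_identity:
  assumes "x \<in> even_part"
  shows "contract (\<lambda>a b. a * coinverse b) (comult x) = unit_point x *\<^sub>C 1"
proof -
  let ?\<mu> = "\<lambda>a b :: 'a half_liberated. a * coinverse b" and ?z = "\<lambda>a b :: 'a half_liberated. 0 :: 'a half_liberated"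
  have b: "bilinear_map ?\<mu>" using bilinear_map_mult[of id coinverse]
    by (simp add: C_linear_def coinverse_simps)
  have z: "bilinear_map ?z" by (simp add: bilinear_map_def C_linear_def scaleC_zero_right)
  note c = contract_simps[OF b] contract_sum[OF b] contract_scale[OF b]
  from assms show ?thesis
  proof (induction rule: even_part.induct)
    case (scalar x)
    show ?case
      by (simp add: comult_simps c one_tensor_pure coinverse_simps unit_point_simps scaleC_complex_def)
  next
    case (gen i j k l)
    have "contract ?\<mu> (comult (gen i j * gen k l))
        = (\<Sum>r\<in>UNIV. \<Sum>s\<in>UNIV. gen i r * (gen k s * gen l s) * gen j r)"
      by (simp add: comult_simps comult_gen sum_product pure_tensor_mult c coinverse_simps coinverse_gen mult.assoc)
    also have "\<dots> = (\<Sum>r\<in>UNIV. gen i r * (\<Sum>s\<in>UNIV. gen k s * gen l s) * gen j r)"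
      by (simp add: sum_distrib_left sum_distrib_right)
    finally show ?case
      by (auto simp: gen_rows unit_point_simps unit_point_gen scaleC_one scaleC_zero_left)
  next
    case (add x y)
    then show ?case by (simp add: comult_simps c unit_point_simps scaleC_add_left)
  next
    case (mult x y)
    have "contract ?\<mu> (comult x * comult y)
        = contract ?\<mu> (comult x) * contract ?\<mu> (comult y) + contract ?z (comult x) * contract ?z (comult y)"
    proof (rule contract_bilinear_product[OF b b b z z _ comult_even[OF mult(1)] comult_even[OF mult(2)]])
      fix a b c d :: "'a half_liberated"
      assume e: "a \<in> even_part" "c \<in> even_part" "b \<in> even_part" "d \<in> even_part"
      have "c * coinverse d * coinverse b = coinverse b * (c * coinverse d)"
        using e by (intro even_part_commute even_part.mult coinverse_even)
      then show "a * c * coinverse (b * d) = a * coinverse b * (c * coinverse d) + 0 * 0"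
        by (simp add: coinverse_simps mult.assoc)
    qed
    moreover have "contract ?z (comult x) = 0" by (simp add: contract_def case_prod_beta')
    ultimately show ?case using mult(3,4)
      by (simp add: comult_simps unit_point_simps mult_scaleC_left scaleC_scaleC)
  qed
qed

text \<open>The derivative of the adjoint coaction \<open>p \<mapsto> p\<^sub>2 \<otimes> p\<^sub>1 S(p\<^sub>3)\<close>: a tangent vector \<open>E\<^sub>s\<^sub>t\<close> at the
  identity is moved to \<open>u E\<^sub>s\<^sub>t u\<^sup>-\<^sup>1\<close>, whose entries are \<open>u\<^sub>i\<^sub>s u\<^sub>j\<^sub>t\<close>.  Both sides
  obey the Leibniz rule for derivations at the counit, so the formula is a computation on
  generators.\<close>

lemma adjoint_derivation:
  assumes "p \<in> even_part"
  shows "contract (\<lambda>a b. invariant_derivation s t a * coinverse b) (comult p)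
    = (\<Sum>i\<in>UNIV. \<Sum>j\<in>UNIV. tangent i j p *\<^sub>C (gen i s * gen j t))"
proof -
  let ?\<mu> = "\<lambda>a b :: 'a half_liberated. a * coinverse b"
  let ?\<beta> = "\<lambda>a b :: 'a half_liberated. invariant_derivation s t a * coinverse b"
  have S: "C_linear coinverse" by (simp add: C_linear_def coinverse_simps)
  have m: "bilinear_map ?\<mu>" using bilinear_map_mult[of id coinverse]
    by (simp add: C_linear_def coinverse_simps)
  have b: "bilinear_map ?\<beta>" by (intro bilinear_map_mult C_linear_invariant_derivation S)
  note c = contract_simps[OF b] contract_sum[OF b] contract_scale[OF b]
  from assms show ?thesis
  proof (induction rule: even_part.induct)
    case (scalar x)
    show ?case
      by (simp add: comult_simps c one_tensor_pure invariant_derivation_simps tangent_simps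
          scaleC_zero_left scaleC_zero_right)
  next
    case (gen a b c' d)
    have "contract ?\<beta> (comult (gen a b * gen c' d))
        = (\<Sum>k\<in>UNIV. \<Sum>l\<in>UNIV. ((if k = t then gen a s * gen c' l else 0) - (if l = s then gen a k * gen c' t else 0))
            * (gen d l * gen b k))"
      by (simp add: comult_simps comult_gen sum_product pure_tensor_mult c coinverse_simps coinverse_gen
          invariant_derivation_simps)
    also have "\<dots> = (\<Sum>k\<in>UNIV. \<Sum>l\<in>UNIV. (if k = t then gen a s * gen c' l * (gen d l * gen b k) else 0))
        - (\<Sum>k\<in>UNIV. \<Sum>l\<in>UNIV. (if l = s then gen a k * gen c' t * (gen d l * gen b k) else 0))"
      by (simp add: left_diff_distrib sum_subtractf if_distrib[of "\<lambda>x. x * _"] cong: if_cong)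
    also have "(\<Sum>k\<in>UNIV. \<Sum>l\<in>UNIV. (if k = t then gen a s * gen c' l * (gen d l * gen b k) else 0))
        = (\<Sum>l\<in>UNIV. gen a s * gen c' l * (gen d l * gen b t))"
      by (subst sum.swap) simp
    also have "\<dots> = gen a s * (\<Sum>l\<in>UNIV. gen c' l * gen d l) * gen b t"
      by (simp add: sum_distrib_left sum_distrib_right mult.assoc)
    also have "\<dots> = (if c' = d then gen a s * gen b t else 0)" by (simp add: gen_rows)
    also have "(\<Sum>k\<in>UNIV. \<Sum>l\<in>UNIV. (if l = s then gen a k * gen c' t * (gen d l * gen b k) else 0))
        = (\<Sum>k\<in>UNIV. gen a k * (gen c' t * gen d s * gen b k))"
      by (simp add: mult.assoc)
    also have "\<dots> = (\<Sum>k\<in>UNIV. gen a k * gen b k) * (gen d s * gen c' t)"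
      unfolding gen_half_commute[of c' t d s] by (simp add: sum_distrib_right mult.assoc)
    also have "\<dots> = (if a = b then gen d s * gen c' t else 0)" by (simp add: gen_rows)
    also have "(if c' = d then gen a s * gen b t else 0) - (if a = b then gen d s * gen c' t else 0)
        = (\<Sum>i\<in>UNIV. \<Sum>j\<in>UNIV. (if c' = d then (if i = a then (if j = b then gen i s * gen j t else 0) else 0) else 0)
           - (if a = b then (if i = d then (if j = c' then gen i s * gen j t else 0) else 0) else 0))"
      by (simp add: sum_subtractf sum_delta_outer)
    also have "\<dots> = (\<Sum>i\<in>UNIV. \<Sum>j\<in>UNIV. tangent i j (gen a b * gen c' d) *\<^sub>C (gen i s * gen j t))"
      by (intro sum.cong refl) (auto simp: tangent_simps scaleC_diff_left scaleC_zero_left scaleC_one)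
    finally show ?case .
  next
    case (add x y)
    then show ?case by (simp add: comult_simps c tangent_simps scaleC_add_left sum.distrib)
  next
    case (mult x y)
    have "contract ?\<beta> (comult x * comult y)
        = contract ?\<mu> (comult x) * contract ?\<beta> (comult y) + contract ?\<beta> (comult x) * contract ?\<mu> (comult y)"
    proof (rule contract_bilinear_product[OF b m b b m _ comult_even[OF mult(1)] comult_even[OF mult(2)]])
      fix a b c d :: "'a half_liberated"
      assume e: "a \<in> even_part" "c \<in> even_part" "b \<in> even_part" "d \<in> even_part"
      let ?d = "invariant_derivation s t"
      have *: "w * coinverse d * coinverse b = coinverse b * (w * coinverse d)" if "w \<in> even_part" for w
        using e that by (intro even_part_commute even_part.mult coinverse_even)
      show "?d (a * c) * coinverse (b * d) = a * coinverse b * (?d c * coinverse d) + ?d a * coinverse b * (c * coinverse d)"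
        using *[of c] *[of "?d c"] e invariant_derivation_even[of c s t]
        by (simp add: invariant_derivation_mult coinverse_simps distrib_left distrib_right mult.assoc)
    qed
    then show ?case using mult
      by (simp add: comult_simps antipode_identity tangent_mult mult_scaleC_left mult_scaleC_right
          scaleC_add_left sum.distrib scaleC_sum_right scaleC_scaleC mult.commute add.commute)
  qed
qed

section \<open>Formal lines through the identity separate the even part\<close>

text \<open>By the formula for the derivative, the coefficient of \<open>t\<^sup>k\<^sup>+\<^sup>1\<close> for an element of \<open>J\<close> is a
  combination of coefficients up to \<open>t\<^sup>k\<close> for other elements of \<open>J\<close>.\<close>

lemma line_char_zero_of_invariant:
  assumes J: "\<And>p. p \<in> J \<Longrightarrow> p \<in> even_part \<and> unit_point p = 0"
    and inv: "\<And>p i j. p \<in> J \<Longrightarrow> invariant_derivation i j p \<in> J" and "p \<in> J"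
  shows "line_char Z p = 0"
proof -
  have "\<forall>p\<in>J. fps_nth (line_char Z p) m = 0" for m
  proof (induction m rule: less_induct)
    case (less m)
    show ?case
    proof
      fix p assume p: "p \<in> J"
      show "fps_nth (line_char Z p) m = 0"
      proof (cases m)
        case 0
        then show ?thesis using J[OF p] by (simp add: line_char_nth_0)
      next
        case (Suc k)
        have "fps_nth (fps_deriv (line_char Z p)) k = 0"
          using less inv[OF p] J[OF p] Suc
          by (simp add: fps_deriv_line_char fps_sum_nth fps_mult_nth)
        then show ?thesis using Suc by (simp del: of_nat_Suc)
      qed
    qed
  qed
  with \<open>p \<in> J\<close> show ?thesis by (simp add: fps_eq_iff)
qed

lemma commuting_comm: "commuting (\<rho> :: 'i \<Rightarrow> 'a::comm_ring_1)"
  by (simp add: commuting_def mult.commute)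

lemma polyfun_formal_line:
  fixes F :: "'i::finite polyfun" and a b :: "'i \<Rightarrow> complex"
  defines "M \<equiv> poly_lift (\<lambda>i. fps_const (a i) + fps_X * fps_const (b i)) :: 'i polyfun \<Rightarrow> complex fps"
  shows "\<exists>g. M F = fps_of_poly g \<and> (\<forall>s. peval F (\<lambda>i. a i + s * b i) = poly g s)"
proof -
  note M = poly_hom_simps[OF poly_hom_lift(1)[OF commuting_comm]] poly_lift_Var[OF commuting_comm]
  show ?thesis
  proof (induction F)
    case (Const c)
    show ?case by (rule exI[of _ "[:c:]"]) (simp add: M_def M fps_scaleC fps_of_poly_const)
  next
    case (Var i)
    show ?case
      by (rule exI[of _ "[:a i, b i:]"]) (simp add: M_def M fps_of_poly_pCons mult.commute)
  next
    case (add F G)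
    then obtain g h where "M F = fps_of_poly g \<and> (\<forall>s. peval F (\<lambda>i. a i + s * b i) = poly g s)"
      "M G = fps_of_poly h \<and> (\<forall>s. peval G (\<lambda>i. a i + s * b i) = poly h s)" by blast
    then show ?case by (intro exI[of _ "g + h"]) (simp add: M_def M fps_of_poly_add)
  next
    case (mult F G)
    then obtain g h where "M F = fps_of_poly g \<and> (\<forall>s. peval F (\<lambda>i. a i + s * b i) = poly g s)"
      "M G = fps_of_poly h \<and> (\<forall>s. peval G (\<lambda>i. a i + s * b i) = poly h s)" by blast
    then show ?case by (intro exI[of _ "g * h"]) (simp add: M_def M fps_of_poly_mult)
  qed
qed

lemma poly_hom_unital_ring_hom: "poly_hom h \<Longrightarrow> unital_ring_hom (h :: 'i polyfun \<Rightarrow> 'b::{comm_ring_1, complex_star_algebra})"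
  by (simp add: unital_ring_hom_def poly_hom_simps)

definition even_gens :: "'n \<times> 'n \<times> 'n \<times> 'n \<Rightarrow> 'n::finite half_liberated" where
  "even_gens = (\<lambda>(i, j, k, l). gen i j * gen k l)"

lemma even_gens_apply: "even_gens (i, j, k, l) = gen i j * gen k l"
  by (simp add: even_gens_def)

lemma commuting_even_gens: "commuting even_gens"
  by (auto simp: commuting_def even_gens_def intro!: even_part_commute even_part.gen)

lemmas even_lift_hom = poly_hom_lift(1)[OF commuting_even_gens]
lemmas even_lift_simps = poly_hom_simps[OF even_lift_hom] poly_lift_Var[OF commuting_even_gens]

lemma even_lift_even: "poly_lift even_gens F \<in> even_part"
proof (induction F)
  case (Var q)
  show ?case by (cases q) (simp add: even_lift_simps even_gens_apply even_part.gen)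
qed (simp_all add: even_lift_simps even_part.intros)

lemma even_lift_surj: "p \<in> even_part \<Longrightarrow> \<exists>F. p = poly_lift even_gens F"
proof (induction rule: even_part.induct)
  case (scalar c)
  show ?case by (rule exI[of _ "Const c"]) (simp add: even_lift_simps)
next
  case (gen i j k l)
  show ?case by (rule exI[of _ "Var (i, j, k, l)"]) (simp add: even_lift_simps even_gens_apply)
next
  case (add x y)
  then show ?case by (metis even_lift_simps(1))
next
  case (mult x y)
  then show ?case by (metis even_lift_simps(2))
qed

lemma gen_square_move:
  "gen i j * gen p q * (gen p q * gen k l) = gen p q * gen p q * (gen i j * gen k l)"
proof -
  have "gen i j * gen p q * (gen p q * gen k l) = gen i j * (gen p q * gen p q * gen k l)"
    by (simp add: mult.assoc)
  also have "\<dots> = (gen i j * gen k l) * (gen p q * gen p q)"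
    unfolding gen_half_commute[of p q p q k l] by (simp add: mult.assoc)
  also have "\<dots> = (gen p q * gen p q) * (gen i j * gen k l)"
    by (intro even_part_commute even_part.gen)
  finally show ?thesis .
qed

lemma line_char_eq_lift:
  fixes Z :: "real^'n^'n"
  shows "line_char Z (poly_lift even_gens F)
    = poly_lift (\<lambda>(i, j, k, l). line Z $ i $ j * line_inverse Z $ l $ k) F"
proof -
  note M = poly_hom_simps[OF poly_hom_lift(1)[OF commuting_comm]] poly_lift_Var[OF commuting_comm]
  show ?thesis
  proof (induction F)
    case (Var q)
    show ?case by (cases q) (simp add: even_lift_simps even_gens_apply line_char_simps M)
  qed (simp_all add: even_lift_simps M line_char_simps line_char_mult even_lift_even)
qed

text \<open>Fix a generator \<open>u\<^sub>r\<^sub>q\<close> and put \<open>s = u\<^sub>r\<^sub>q u\<^sub>r\<^sub>q\<close>.  Up to powers of \<open>s\<close>, all \<open>u\<^sub>i\<^sub>j u\<^sub>k\<^sub>l\<close> are determined by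
  the matrix \<open>t\<close> with entries \<open>u\<^sub>i\<^sub>j u\<^sub>r\<^sub>q\<close>, since \<open>s u\<^sub>i\<^sub>j u\<^sub>k\<^sub>l = (u\<^sub>i\<^sub>j u\<^sub>r\<^sub>q) (u\<^sub>r\<^sub>q u\<^sub>k\<^sub>l)\<close> and the matrix of the
  \<open>u\<^sub>r\<^sub>q u\<^sub>k\<^sub>l\<close> is \<open>s t\<^sup>-\<^sup>t\<close>.  So \<open>t \<mapsto> t \<otimes> t\<^sup>-\<^sup>t\<close> is a retraction of the space of all arrays \<open>(y\<^sub>i\<^sub>j\<^sub>k\<^sub>l)\<close>.  A
  polynomial representing \<open>p\<close>, composed with the retraction, vanishes along the lines on which
  \<open>t\<close> starts at the identity, hence everywhere.  As \<open>\<Sum>\<^sub>q u\<^sub>r\<^sub>q u\<^sub>r\<^sub>q = 1\<close>, the elements \<open>s\<close> for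
  fixed \<open>r\<close> form a partition of unity.\<close>

lemma line_chars_separate:
  fixes p :: "'n::finite half_liberated"
  assumes "p \<in> even_part" and zero: "\<And>Z. line_char Z p = 0"
  shows "p = 0"
proof -
  let ?\<Lambda> = "poly_lift even_gens :: ('n \<times> 'n \<times> 'n \<times> 'n) polyfun \<Rightarrow> _"
  note \<Lambda> = even_lift_simps
  let ?I = "{F. ?\<Lambda> F = 0}"
  note I = poly_hom_kernel_ideal[OF even_lift_hom]
  obtain F where F: "p = ?\<Lambda> F" using even_lift_surj[OF assms(1)] by blast
  define p0 :: 'n where "p0 = undefined"
  let ?s = "\<lambda>q. Var (p0, q, p0, q) :: ('n \<times> 'n \<times> 'n \<times> 'n) polyfun"
  show ?thesis
  proof (rule partition_of_unity_nilpotent[of UNIV "\<lambda>q. ?\<Lambda> (?s q)"])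
    show "(\<Sum>q\<in>UNIV. ?\<Lambda> (?s q)) = 1" by (simp add: \<Lambda> even_gens_apply gen_rows)
    show "?\<Lambda> (?s q) * ?\<Lambda> (?s q') = ?\<Lambda> (?s q') * ?\<Lambda> (?s q)" for q q'
      by (rule poly_hom_commute[OF even_lift_hom])
    fix q :: 'n
    define s where "s = ?s q"
    define t :: "('n \<times> 'n \<times> 'n \<times> 'n) polyfun^'n^'n" where "t = (\<chi> i j. Var (i, j, p0, q))"
    define tb :: "('n \<times> 'n \<times> 'n \<times> 'n) polyfun^'n^'n" where "tb = (\<chi> i j. Var (p0, q, i, j))"
    define \<delta> where "\<delta> = det t"
    define r where "r = (\<lambda>(i, j, k, l). t $ i $ j * cofactor_matrix t $ k $ l)"
    have t_tb: "?\<Lambda> (t $ i $ j * tb $ k $ l) = ?\<Lambda> (s * Var (i, j, k, l))" for i j k l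
      by (simp add: t_def tb_def s_def \<Lambda> even_gens_apply) (rule gen_square_move)
    have cols: "?\<Lambda> (\<Sum>i\<in>UNIV. t $ i $ j * tb $ i $ l) = (if j = l then ?\<Lambda> s else 0)" for j l
      by (simp add: poly_hom_sum[OF even_lift_hom] t_tb)
         (simp add: \<Lambda> even_gens_apply gen_cols flip: sum_distrib_left)
    have rows: "?\<Lambda> (\<Sum>j\<in>UNIV. t $ i $ j * tb $ k $ j) = (if i = k then ?\<Lambda> s else 0)" for i k
      by (simp add: poly_hom_sum[OF even_lift_hom] t_tb)
         (simp add: \<Lambda> even_gens_apply gen_rows flip: sum_distrib_left)
    have cof: "?\<Lambda> (tb $ k $ l * \<delta>) = ?\<Lambda> (s * cofactor_matrix t $ k $ l)" for k l
    proof -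
      have "(t ** transpose (cofactor_matrix t)) $ i $ k = mat \<delta> $ i $ k" for i
        by (simp add: cofactor_matrix_right \<delta>_def)
      then have e: "(\<Sum>j\<in>UNIV. t $ i $ j * cofactor_matrix t $ k $ j) = (if i = k then \<delta> else 0)" for i
        by (simp add: matrix_matrix_mult_def mat_def)
      have "(\<Sum>j\<in>UNIV. (\<Sum>i\<in>UNIV. t $ i $ j * tb $ i $ l) * cofactor_matrix t $ k $ j)
          = (\<Sum>i\<in>UNIV. tb $ i $ l * (\<Sum>j\<in>UNIV. t $ i $ j * cofactor_matrix t $ k $ j))"
        by (simp add: sum_distrib_left sum_distrib_right mult_ac) (rule sum.swap)
      also have "\<dots> = tb $ k $ l * \<delta>"
        by (simp add: e if_distrib[of "\<lambda>x. _ * x"] cong: if_cong)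
      finally have "?\<Lambda> (tb $ k $ l * \<delta>)
          = (\<Sum>j\<in>UNIV. ?\<Lambda> (\<Sum>i\<in>UNIV. t $ i $ j * tb $ i $ l) * ?\<Lambda> (cofactor_matrix t $ k $ j))"
        by (simp only: \<Lambda>(2)[symmetric] poly_hom_sum[OF even_lift_hom, symmetric])
      also have "\<dots> = ?\<Lambda> (s * cofactor_matrix t $ k $ l)"
        by (simp add: cols \<Lambda>(2) if_distrib[of "\<lambda>x. x * _"] cong: if_cong)
      finally show ?thesis .
    qed
    have "?\<Lambda> (s * (r x - \<delta> * Var x)) = 0" for x
    proof -
      obtain i j k l where x: "x = (i, j, k, l)" by (cases x)
      have "?\<Lambda> (s * (r x - \<delta> * Var x))
          = ?\<Lambda> (t $ i $ j) * ?\<Lambda> (s * cofactor_matrix t $ k $ l) - ?\<Lambda> (\<delta>) * ?\<Lambda> (s * Var x)"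
        unfolding \<Lambda>(2)[symmetric] \<Lambda>(7)[symmetric] by (simp add: r_def x algebra_simps)
      also have "\<dots> = ?\<Lambda> (t $ i $ j * (tb $ k $ l * \<delta>)) - ?\<Lambda> (\<delta> * (t $ i $ j * tb $ k $ l))"
        unfolding x cof[symmetric] t_tb[symmetric] by (simp only: \<Lambda>(2))
      also have "\<dots> = 0" by (simp add: mult_ac)
      finally show ?thesis .
    qed
    from clear_denominators[OF even_lift_hom this, where F = F and 'b = "complex fps"] obtain k G where
      G: "?\<Lambda> (s * (G - \<delta> ^ k * F)) = 0"
      and ev: "\<And>h h' :: ('n \<times> 'n \<times> 'n \<times> 'n) polyfun \<Rightarrow> complex fps. poly_hom h \<Longrightarrow> poly_hom h' \<Longrightarrow>
         (\<And>i. h (r i) = h \<delta> * h' (Var i)) \<Longrightarrow> h G = h \<delta> ^ k * h' F"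
      by (auto simp: mult.commute)
    have "G = 0"
    proof (rule polyfun_eq_zero)
      fix y :: "'n \<times> 'n \<times> 'n \<times> 'n \<Rightarrow> real"
      \<comment> \<open>\<open>a\<close> is an array whose matrix \<open>t\<close> is the identity, and \<open>y\<close> is reached from it at time \<open>1\<close>.\<close>
      define a where "a = (\<lambda>(i :: 'n, j, k :: 'n, l :: 'n). if i = j then 1 else 0 :: complex)"
      define b where "b x = complex_of_real (y x) - a x" for x
      define Z :: "real^'n^'n" where "Z = (\<chi> i j. y (i, j, p0, q) - (if i = j then 1 else 0))"
      define M where "M = poly_lift (\<lambda>x. fps_const (a x) + fps_X * fps_const (b x))"
      define M' where "M' = poly_lift (\<lambda>(i, j, k, l). line Z $ i $ j * line_inverse Z $ l $ k)"
      have hM: "poly_hom M" and hM': "poly_hom M'"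
        unfolding M_def M'_def by (intro poly_hom_lift(1) commuting_comm)+
      note uM = poly_hom_unital_ring_hom[OF hM]
      have Mt: "map_entries M t = line Z"
        by (simp add: vec_eq_iff t_def M_def poly_lift_Var[OF commuting_comm] line_def a_def b_def Z_def)
      have M\<delta>: "M \<delta> = det (line Z)" by (simp add: \<delta>_def Mt flip: det_map_entries[OF uM])
      have "transpose (map_entries M (cofactor_matrix t)) = line_inverse Z ** mat (M \<delta>)"
      proof -
        have "line Z ** transpose (map_entries M (cofactor_matrix t)) = mat (M \<delta>)"
          by (simp add: map_entries_simps[OF uM] Mt cofactor_matrix_right M\<delta>)
        then have "line_inverse Z ** (line Z ** transpose (map_entries M (cofactor_matrix t))) = line_inverse Z ** mat (M \<delta>)"
          by simp
        then show ?thesis by (simp add: matrix_mul_assoc line_inverse_left)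
      qed
      then have "transpose (map_entries M (cofactor_matrix t)) $ l $ k = (line_inverse Z ** mat (M \<delta>)) $ l $ k" for k l
        by simp
      then have "M (cofactor_matrix t $ k $ l) = line_inverse Z $ l $ k * M \<delta>" for k l
        by (simp add: mat_mult_entry)
      moreover have "M (t $ i $ j) = line Z $ i $ j" for i j
        using Mt by (metis map_entries_entry)
      ultimately have "M (r x) = M \<delta> * M' (Var x)" for x
        by (cases x) (simp add: r_def poly_hom_simps[OF hM] M'_def poly_lift_Var[OF commuting_comm])
      from ev[OF hM hM' this] have "M G = M \<delta> ^ k * line_char Z p"
        by (simp add: F line_char_eq_lift M'_def)
      then have "M G = 0" by (simp add: zero)
      moreover obtain g where "M G = fps_of_poly g" and g: "\<And>s. peval G (\<lambda>i. a i + s * b i) = poly g s"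
        using polyfun_formal_line[of a b G] unfolding M_def by blast
      ultimately have "g = 0" by simp
      with g[of 1] show "peval G (\<lambda>i. of_real (y i)) = 0" by (simp add: b_def)
    qed
    with G have "?\<Lambda> (s * (\<delta> ^ k * F)) = 0" by (simp add: \<Lambda>)
    then have "?\<Lambda> (det tb ^ k * (s * (\<delta> ^ k * F))) = 0" by (simp add: \<Lambda>(2))
    moreover have "det tb ^ k * (s * (\<delta> ^ k * F)) = (\<delta> * det tb) ^ k * (s * F)"
      by (simp add: power_mult_distrib mult_ac)
    ultimately have 0: "?\<Lambda> (\<delta> * det tb) ^ k * ?\<Lambda> (s * F) = 0" by (simp only: \<Lambda>(2,8))
    \<comment> \<open>The denominator \<open>\<delta>\<close> is removed by \<open>t tb\<^sup>t = s\<close>, which makes it a divisor of \<open>s\<^sup>n\<close>.\<close>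
    have "det (t ** transpose tb) - det (mat s :: _^'n^'n) \<in> ?I"
    proof (rule det_cong_ideal[OF I])
      show "(t ** transpose tb) $ i $ j - mat s $ i $ j \<in> ?I" for i j
        using rows[of i j] by (simp add: matrix_matrix_mult_def mat_def \<Lambda>)
    qed
    then have "?\<Lambda> (\<delta> * det tb) = ?\<Lambda> s ^ CARD('n)"
      by (simp add: det_mul det_transpose det_mat \<Lambda> \<delta>_def)
    with 0 have "(?\<Lambda> s ^ CARD('n)) ^ k * (?\<Lambda> s * ?\<Lambda> F) = 0" by (simp only: \<Lambda>(2))
    then have "?\<Lambda> (?s q) ^ (CARD('n) * k + 1) * p = 0"
      by (simp only: F s_def power_mult power_add power_one_right mult.assoc)
    then show "\<exists>N. ?\<Lambda> (?s q) ^ N * p = 0" by blast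
  qed simp
qed

section \<open>Traceless symmetric matrices under orthogonal conjugation\<close>

definition conjugate_by :: "real^'n^'n \<Rightarrow> complex^'n^'n \<Rightarrow> complex^'n::finite^'n" where
  "conjugate_by P Y = (\<chi> a b. \<Sum>c\<in>UNIV. \<Sum>d\<in>UNIV. of_real (P $ c $ a * P $ d $ b) * Y $ c $ d)"

definition sym_unit :: "'n::finite \<Rightarrow> 'n \<Rightarrow> complex^'n^'n" where
  "sym_unit i j = (\<chi> a b. (if a = i \<and> b = j then 1 else 0) + (if a = j \<and> b = i then 1 else 0))"

definition diag_unit :: "'n::finite \<Rightarrow> 'n \<Rightarrow> complex^'n^'n" where
  "diag_unit i j = (\<chi> a b. (if a = i \<and> b = i then 1 else 0) - (if a = j \<and> b = j then 1 else 0))"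

lemma sum_sum_delta:
  fixes h :: "'n::finite \<Rightarrow> 'n \<Rightarrow> complex"
  shows "(\<Sum>c\<in>UNIV. \<Sum>d\<in>UNIV. h c d * (if c = i \<and> d = j then 1 else 0)) = h i j"
proof -
  have "(\<Sum>c\<in>UNIV. \<Sum>d\<in>UNIV. h c d * (if c = i \<and> d = j then 1 else 0))
      = (\<Sum>c\<in>UNIV. \<Sum>d\<in>UNIV. if c = i then (if d = j then h c d else 0) else 0)"
    by (intro sum.cong) auto
  then show ?thesis by (simp add: sum_delta_outer)
qed

lemma conjugate_by_units:
  "conjugate_by P (sym_unit i j) $ a $ b = of_real (P $ i $ a * P $ j $ b + P $ j $ a * P $ i $ b)"
  "conjugate_by P (diag_unit i j) $ a $ b = of_real (P $ i $ a * P $ i $ b - P $ j $ a * P $ j $ b)"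
  by (simp_all only: conjugate_by_def sym_unit_def diag_unit_def vec_lambda_beta distrib_left
      right_diff_distrib sum.distrib sum_subtractf sum_sum_delta of_real_add of_real_diff)

definition signed_permutation :: "('n \<Rightarrow> 'n) \<Rightarrow> ('n \<Rightarrow> real) \<Rightarrow> real^'n^'n" where
  "signed_permutation \<sigma> \<epsilon> = (\<chi> c a. if c = \<sigma> a then \<epsilon> a else 0)"

lemma orthogonal_signed_permutation:
  fixes \<sigma> :: "'n::finite \<Rightarrow> 'n"
  assumes "inj \<sigma>" "\<And>a. \<epsilon> a * \<epsilon> a = 1"
  shows "orthogonal_matrix (signed_permutation \<sigma> \<epsilon>)"
proof -
  have "(transpose (signed_permutation \<sigma> \<epsilon>) ** signed_permutation \<sigma> \<epsilon>) $ a $ b = mat 1 $ a $ b" for a b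
  proof -
    have "(transpose (signed_permutation \<sigma> \<epsilon>) ** signed_permutation \<sigma> \<epsilon>) $ a $ b
        = (\<Sum>c\<in>UNIV. if c = \<sigma> a then (if \<sigma> a = \<sigma> b then \<epsilon> a * \<epsilon> b else 0) else 0)"
      by (simp only: matrix_matrix_mult_def vec_lambda_beta transpose_entry signed_permutation_def)
         (intro sum.cong, auto)
    also have "\<dots> = mat 1 $ a $ b" using assms by (auto simp: mat_def inj_eq)
    finally show ?thesis .
  qed
  then show ?thesis by (simp add: orthogonal_matrix vec_eq_iff)
qed

lemma conjugate_by_signed_permutation:
  "conjugate_by (signed_permutation \<sigma> \<epsilon>) Y $ a $ b = of_real (\<epsilon> a * \<epsilon> b) * Y $ \<sigma> a $ \<sigma> b"
proof -
  have "conjugate_by (signed_permutation \<sigma> \<epsilon>) Y $ a $ b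
      = (\<Sum>c\<in>UNIV. \<Sum>d\<in>UNIV. (of_real (\<epsilon> a * \<epsilon> b) * Y $ c $ d) * (if c = \<sigma> a \<and> d = \<sigma> b then 1 else 0))"
    unfolding conjugate_by_def vec_lambda_beta signed_permutation_def by (intro sum.cong refl) auto
  then show ?thesis by (simp only: sum_sum_delta)
qed

text \<open>The traceless symmetric matrices form an irreducible representation of the orthogonal group.
  Sign changes isolate an off-diagonal entry, a transposition isolates a difference of diagonal
  entries, rotations by \<open>45\<close> degrees exchange the two kinds of unit matrices, and transpositions
  move them around.\<close>

lemma traceless_symmetric_irreducible:
  fixes W :: "(complex^'n::finite^'n) set" and Y :: "complex^'n^'n"
  assumes diff: "\<And>A B. A \<in> W \<Longrightarrow> B \<in> W \<Longrightarrow> A - B \<in> W"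
    and scale: "\<And>c A. A \<in> W \<Longrightarrow> mat c ** A \<in> W"
    and conj: "\<And>A P. A \<in> W \<Longrightarrow> orthogonal_matrix P \<Longrightarrow> conjugate_by P A \<in> W"
    and Y: "Y \<in> W" "Y \<noteq> 0" "\<And>i j. Y $ i $ j = Y $ j $ i" "(\<Sum>i\<in>UNIV. Y $ i $ i) = 0"
    and "i \<noteq> j"
  shows "sym_unit i j \<in> W" "diag_unit i j \<in> W"
proof -
  have unscale: "A \<in> W" if "mat c ** A \<in> W" "c \<noteq> 0" for c :: complex and A :: "complex^'n^'n"
  proof -
    have "mat (inverse c) ** (mat c ** A) = A" using that(2) by (simp add: vec_eq_iff mat_mult_entry)
    then show ?thesis using scale[OF that(1), of "inverse c"] by simp
  qed
  define h where "h = 1 / sqrt 2"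
  have hh: "h * h = 1 / 2" by (simp add: h_def)
  have hhc: "complex_of_real h * complex_of_real h = 1 / 2"
    using arg_cong[OF hh, of complex_of_real] by simp
  have rot: "orthogonal_matrix (plane_rotation k l h h)" if "k \<noteq> l" for k l :: 'n
    using that by (intro orthogonal_plane_rotation) (auto simp: power2_eq_square hh)
  have D_S: "sym_unit k l \<in> W" if "diag_unit k l \<in> W" "k \<noteq> l" for k l
  proof -
    have "conjugate_by (plane_rotation k l h h) (diag_unit k l) = sym_unit k l"
      using that(2) by (auto simp: hhc vec_eq_iff conjugate_by_units sym_unit_def plane_rotation_def axis_def)
    then show ?thesis using conj[OF that(1) rot[OF that(2)]] by simp
  qed
  have S_D: "diag_unit k l \<in> W" if "sym_unit k l \<in> W" "k \<noteq> l" for k l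
  proof -
    have "conjugate_by (plane_rotation k l h h) (sym_unit k l) = mat (- 1) ** diag_unit k l"
      using that(2) by (auto simp: hhc vec_eq_iff mat_mult_entry conjugate_by_units diag_unit_def plane_rotation_def axis_def)
    then have "mat (- 1) ** diag_unit k l \<in> W" using conj[OF that(1) rot[OF that(2)]] by simp
    from unscale[OF this] show ?thesis by simp
  qed
  have S_comm: "sym_unit k l = sym_unit l k" for k l :: 'n by (auto simp: vec_eq_iff sym_unit_def)
  have move: "sym_unit k m \<in> W" if "sym_unit k l \<in> W" "k \<noteq> l" "m \<noteq> k" for k l m
  proof -
    have inj: "inj (Transposition.transpose l m)" by (simp add: bij_is_inj)
    have "conjugate_by (signed_permutation (Transposition.transpose l m) (\<lambda>_. 1)) (sym_unit k l) = sym_unit k m"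
      using that(2,3) by (auto simp: vec_eq_iff conjugate_by_signed_permutation sym_unit_def Transposition.transpose_def)
    moreover have "conjugate_by (signed_permutation (Transposition.transpose l m) (\<lambda>_. 1)) (sym_unit k l) \<in> W"
      by (intro conj that(1) orthogonal_signed_permutation inj) simp
    ultimately show ?thesis by simp
  qed
  have "\<exists>k l. k \<noteq> l \<and> sym_unit k l \<in> W"
  proof (cases "\<exists>k l. k \<noteq> l \<and> Y $ k $ l \<noteq> 0")
    case True
    then obtain k l where kl: "k \<noteq> l" "Y $ k $ l \<noteq> 0" by blast
    define R where "R k = signed_permutation (\<lambda>a. a) (\<lambda>a. if a = k then - 1 else 1)" for k :: 'n
    have R: "orthogonal_matrix (R k)" for k
      unfolding R_def by (intro orthogonal_signed_permutation) (auto simp: inj_on_def)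
    define A where "A = Y - conjugate_by (R k) Y"
    have "A \<in> W" unfolding A_def by (intro diff conj Y R)
    then have "A - conjugate_by (R l) A \<in> W" by (intro diff conj R)
    moreover have "A - conjugate_by (R l) A = mat (4 * Y $ k $ l) ** sym_unit k l"
      using kl(1) Y(3)[of k l]
      by (auto simp: vec_eq_iff mat_mult_entry A_def R_def conjugate_by_signed_permutation sym_unit_def)
    ultimately have "sym_unit k l \<in> W" using unscale[of "4 * Y $ k $ l"] kl(2) by simp
    with kl(1) show ?thesis by blast
  next
    case False
    then have off: "Y $ k $ l = 0" if "k \<noteq> l" for k l using that by blast
    have "\<exists>k l. Y $ k $ k \<noteq> Y $ l $ l"
    proof (rule ccontr)
      assume "\<not> ?thesis"
      then have eq: "Y $ k $ k = Y $ i $ i" for k by blast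
      have "(\<Sum>k\<in>UNIV. Y $ k $ k) = (\<Sum>k\<in>(UNIV :: 'n set). Y $ i $ i)"
        by (intro sum.cong refl eq)
      then have "Y $ i $ i = 0" using Y(4) by simp
      then have "Y $ k $ l = 0" for k l using off[of k l] eq[of k] by (cases "k = l") auto
      then show False using Y(2) by (simp add: vec_eq_iff)
    qed
    then obtain k l where kl: "Y $ k $ k \<noteq> Y $ l $ l" by blast
    then have "k \<noteq> l" by blast
    have inj: "inj (Transposition.transpose k l)" by (simp add: bij_is_inj)
    let ?P = "signed_permutation (Transposition.transpose k l) (\<lambda>_. 1)"
    have "Y - conjugate_by ?P Y \<in> W" by (intro diff conj Y orthogonal_signed_permutation inj) simp
    moreover have "Y - conjugate_by ?P Y = mat (Y $ k $ k - Y $ l $ l) ** diag_unit k l"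
    proof -
      have "(Y - conjugate_by ?P Y) $ a $ b = (mat (Y $ k $ k - Y $ l $ l) ** diag_unit k l) $ a $ b" for a b
      proof (cases "a = b")
        case True
        then show ?thesis using \<open>k \<noteq> l\<close>
          by (auto simp: mat_mult_entry conjugate_by_signed_permutation diag_unit_def Transposition.transpose_def)
      next
        case False
        then have "Transposition.transpose k l a \<noteq> Transposition.transpose k l b" using inj by (simp add: inj_eq)
        with False show ?thesis by (auto simp: mat_mult_entry conjugate_by_signed_permutation diag_unit_def off)
      qed
      then show ?thesis by (simp add: vec_eq_iff)
    qed
    ultimately have "diag_unit k l \<in> W" using unscale kl by (metis right_minus_eq)
    from D_S[OF this \<open>k \<noteq> l\<close>] \<open>k \<noteq> l\<close> show ?thesis by blast
  qed
  then obtain k l where kl: "k \<noteq> l" "sym_unit k l \<in> W" by blast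
  show S: "sym_unit i j \<in> W"
  proof (cases "i = k")
    case True
    then show ?thesis using move[OF kl(2,1), of j] \<open>i \<noteq> j\<close> by auto
  next
    case False
    from move[OF kl(2,1) this] have "sym_unit i k \<in> W" by (simp add: S_comm)
    from move[OF this False, of j] \<open>i \<noteq> j\<close> show ?thesis by simp
  qed
  show "diag_unit i j \<in> W" by (rule S_D[OF S \<open>i \<noteq> j\<close>])
qed

section \<open>Quantum groups between the classical and the half-liberated one\<close>

locale intermediate_hopf_algebra =
  fixes v :: "'a::complex_star_algebra^'m::finite^'m"
    and f :: "'n::finite half_liberated \<Rightarrow> 'a"
    and g :: "'a \<Rightarrow> 'n rep_orthogonal"
  assumes hopf: "unitary_hopf_algebra v"
    and f: "hopf_star_hom half_liberated_matrix v f" and surj_f: "surj f"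
    and g: "star_hom g"
    and gf: "\<And>i j. g (f (gen i j)) = coordinate_matrix $ i $ j"
begin

lemma f_hom: "star_hom f" using f by (simp add: hopf_star_hom_def)

lemmas f_simps = star_hom_simps[OF f_hom]

lemma C_linear_f: "C_linear f" using f_hom by (simp add: star_hom_def)

lemma comultiplication_f: "comultiplication v (f x) = tensor_map f f (comult x)"
  using f by (simp add: hopf_star_hom_def comultiplication_half_liberated)

lemma antipode_f: "antipode v (f x) = f (coinverse x)"
  using f by (simp add: hopf_star_hom_def antipode_half_liberated)

lemma bilinear_map_f: "bilinear_map \<beta> \<Longrightarrow> bilinear_map (\<lambda>a b. f (\<beta> a b))"
  by (auto simp: bilinear_map_def C_linear_def f_simps)

lemma f_contract: "bilinear_map \<beta> \<Longrightarrow> f (contract \<beta> t) = contract (\<lambda>a b. f (\<beta> a b)) t"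
proof (induction t rule: tensor_induct)
  assume \<beta>: "bilinear_map \<beta>"
  then have b: "bilinear_map (\<lambda>a b. f (\<beta> a b))" by (rule bilinear_map_f)
  note c = contract_simps[OF \<beta>] contract_simps[OF b]
  {
    case zero
    show ?case by (simp add: c f_simps)
  next
    case (pure a b)
    show ?case by (simp add: c)
  next
    case (add s t)
    then show ?case by (simp add: c f_simps)
  }
qed

text \<open>Functionals that vanish on the kernel of \<open>f\<close> are closed under convolution; more generally,
  any bilinear map that descends along \<open>f\<close> in both arguments contracts \<open>\<Delta> x\<close> to zero for \<open>x\<close> in
  the kernel.\<close>

lemma kernel_coideal:
  assumes \<beta>: "bilinear_map \<beta>" and l: "\<And>a b. f a = 0 \<Longrightarrow> \<beta> a b = 0" and r: "\<And>a b. f b = 0 \<Longrightarrow> \<beta> a b = 0"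
    and x: "f x = 0"
  shows "contract \<beta> (comult x) = 0"
proof -
  define s where "s = inv f"
  have fs: "f (s y) = y" for y unfolding s_def using surj_f by (rule surj_f_inv_f)
  note b = bilinear_map_simps[OF \<beta>]
  have \<beta>_diff: "\<beta> (a - a') c = \<beta> a c - \<beta> a' c" "\<beta> a (c - c') = \<beta> a c - \<beta> a c'" for a a' c c'
    using b(1)[of "a - a'" a' c] b(2)[of a "c - c'" c'] by (simp_all add: eq_diff_eq)
  have desc: "\<beta> a c = \<beta> a' c'" if "f a = f a'" "f c = f c'" for a a' c c'
  proof -
    have "\<beta> (a - a') c = 0" by (rule l) (simp add: f_simps that)
    moreover have "\<beta> a' (c - c') = 0" by (rule r) (simp add: f_simps that)
    ultimately show ?thesis by (simp add: \<beta>_diff)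
  qed
  define \<beta>' where "\<beta>' y z = \<beta> (s y) (s z)" for y z
  have \<beta>': "\<beta>' (f a) (f c) = \<beta> a c" for a c unfolding \<beta>'_def by (rule desc) (simp_all add: fs)
  have "bilinear_map \<beta>'"
    unfolding bilinear_map_def C_linear_def
  proof (intro conjI allI)
    fix y y' z z' c
    show "\<beta>' (y + y') z = \<beta>' y z + \<beta>' y' z"
      using \<beta>'[of "s y + s y'" "s z"] \<beta>'[of "s y" "s z"] \<beta>'[of "s y'" "s z"] by (simp add: f_simps fs b)
    show "\<beta>' (c *\<^sub>C y) z = c *\<^sub>C \<beta>' y z"
      using \<beta>'[of "c *\<^sub>C s y" "s z"] \<beta>'[of "s y" "s z"] by (simp add: f_simps fs b)
    show "\<beta>' y (z + z') = \<beta>' y z + \<beta>' y z'"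
      using \<beta>'[of "s y" "s z + s z'"] \<beta>'[of "s y" "s z"] \<beta>'[of "s y" "s z'"] by (simp add: f_simps fs b)
    show "\<beta>' y (c *\<^sub>C z) = c *\<^sub>C \<beta>' y z"
      using \<beta>'[of "s y" "c *\<^sub>C s z"] \<beta>'[of "s y" "s z"] by (simp add: f_simps fs b)
  qed
  have "contract \<beta> (comult x) = contract \<beta>' (tensor_map f f (comult x))"
    by (simp add: contract_tensor_map[OF \<open>bilinear_map \<beta>'\<close> C_linear_f C_linear_f] \<beta>')
  also have "tensor_map f f (comult x) = comultiplication v 0" by (simp add: x flip: comultiplication_f)
  also have "\<dots> = 0"
  proof -
    obtain \<Delta> where "is_comultiplication v \<Delta>" and "generates v"
      using hopf by (auto simp: unitary_hopf_algebra_def)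
    then have "comultiplication v = \<Delta>" "star_hom \<Delta>"
      by (auto simp: comultiplication_unique is_comultiplication_def)
    then show ?thesis by (simp add: star_hom_simps)
  qed
  finally show ?thesis by (simp add: contract_zero[OF \<open>bilinear_map \<beta>'\<close>])
qed

lemma kernel_coinverse: "f x = 0 \<Longrightarrow> f (coinverse x) = 0"
proof -
  assume "f x = 0"
  obtain S where "is_antipode v S" and "generates v"
    using hopf by (auto simp: unitary_hopf_algebra_def)
  then have "antipode v = S" "C_linear S"
    by (auto simp: antipode_unique is_antipode_def star_hom_op_def)
  then have "antipode v 0 = 0" by (simp add: C_linear_zero)
  then show ?thesis using \<open>f x = 0\<close> antipode_f[of x] by simp
qed

lemma g_f_value:
  assumes "orthogonal_matrix P"
  shows "Rep_rep_orthogonal (g (f x)) P = point P x"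
proof -
  note h = star_hom_simps[OF star_hom_point[OF assms]] point_gen[OF assms]
  have P: "P \<in> orthogonal_group" using assms by (simp add: orthogonal_group_def)
  note g = star_hom_simps[OF g]
  show ?thesis
  proof (induction x rule: half_liberated_induct)
    case (scalar c)
    show ?case
      by (simp add: f_simps g h scaleC_rep_orthogonal.rep_eq one_rep_orthogonal.rep_eq P scaleC_complex_def)
  next
    case (gen i j)
    show ?case by (simp add: gf h coordinate_matrix_def coordinate_function.rep_eq P)
  next
    case (add x y)
    then show ?case by (simp add: f_simps g h plus_rep_orthogonal.rep_eq)
  next
    case (mult x y)
    then show ?case by (simp add: f_simps g h times_rep_orthogonal.rep_eq)
  qed
qed

lemma kernel_point: "f x = 0 \<Longrightarrow> orthogonal_matrix P \<Longrightarrow> point P x = 0"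
  using g_f_value[of P x] by (simp add: star_hom_simps[OF g] zero_rep_orthogonal.rep_eq)

lemma kernel_translate:
  assumes "orthogonal_matrix P" "f x = 0"
  shows "f (translate P x) = 0" "f (left_translate P x) = 0"
proof -
  have r: "bilinear_map (\<lambda>a b. point P b *\<^sub>C a)" and l: "bilinear_map (\<lambda>a b. point P a *\<^sub>C b)"
    by (intro bilinear_map_functional_right bilinear_map_functional_left C_linear_point assms)+
  have r': "bilinear_map (\<lambda>a b. f (point P b *\<^sub>C a))" and l': "bilinear_map (\<lambda>a b. f (point P a *\<^sub>C b))"
    by (rule bilinear_map_f[OF r], rule bilinear_map_f[OF l])
  have p: "f b = 0 \<Longrightarrow> point P b = 0" for b using kernel_point assms(1) by blast
  show "f (translate P x) = 0"
    unfolding translate_def f_contract[OF r]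
    by (rule kernel_coideal[OF r' _ _ assms(2)]) (auto simp: f_simps p scaleC_zero_left scaleC_zero_right)
  show "f (left_translate P x) = 0"
    unfolding left_translate_def f_contract[OF l]
    by (rule kernel_coideal[OF l' _ _ assms(2)]) (auto simp: f_simps p scaleC_zero_left scaleC_zero_right)
qed

text \<open>The kernel is graded, because translation by \<open>-1\<close> changes the sign of odd elements.\<close>

lemma kernel_graded:
  assumes "e \<in> even_part" "d \<in> odd_part" "f (e + d) = 0"
  shows "f e = 0" "f d = 0"
proof -
  define P :: "real^'n^'n" where "P = signed_permutation (\<lambda>a. a) (\<lambda>_. - 1)"
  have P: "orthogonal_matrix P" unfolding P_def by (intro orthogonal_signed_permutation) (auto simp: inj_on_def)
  note t = translate_simps[OF P]
  have gen: "translate P (gen i j) = - gen i j" for i j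
  proof -
    have "complex_of_real (P $ k $ j) *\<^sub>C gen i k = (if k = j then - gen i j else 0)" for k
      by (simp add: P_def signed_permutation_def scaleC_minus_one scaleC_zero_left)
    then show ?thesis by (simp add: t)
  qed
  have even: "translate P x = x" if "x \<in> even_part" for x
    using that by induction (simp_all add: t(1-4) gen)
  have odd: "translate P x = - x" if "x \<in> odd_part" for x
    using that by induction (simp_all add: t(1-4) gen even)
  have "f e - f d = 0"
    using kernel_translate(1)[OF P assms(3)] by (simp add: t(1) even odd assms f_simps)
  moreover have "f e + f d = 0" using assms(3) by (simp add: f_simps)
  ultimately have "2 *\<^sub>C f e = 0"
    using scaleC_add_left[of 1 1 "f e"] by (simp add: scaleC_one eq_neg_iff_add_eq_0)
  then have "(1 / 2) *\<^sub>C 2 *\<^sub>C f e = 0" by (simp add: scaleC_zero_right)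
  then show "f e = 0" by (simp only: scaleC_scaleC) (simp add: scaleC_one)
  then show "f d = 0" using \<open>f e + f d = 0\<close> by simp
qed

lemma kernel_convolution:
  fixes \<phi> :: "'n half_liberated \<Rightarrow> complex"
  assumes "C_linear \<phi>" "\<And>b. f b = 0 \<Longrightarrow> \<phi> b = 0" "f x = 0"
  shows "f (contract (\<lambda>a b. \<phi> b *\<^sub>C a) (comult x)) = 0"
proof -
  have r: "bilinear_map (\<lambda>a b. \<phi> b *\<^sub>C a)" by (intro bilinear_map_functional_right assms)
  have r': "bilinear_map (\<lambda>a b. f (\<phi> b *\<^sub>C a))"
    by (rule bilinear_map_f[OF r])
  show ?thesis
    unfolding f_contract[OF r]
    by (rule kernel_coideal[OF r' _ _ assms(3)])
       (auto simp: f_simps assms scaleC_zero_left scaleC_zero_right)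
qed

text \<open>The case of the full tangent space.  The kernel is then stable under the invariant derivations; odd
  elements reduce to even ones on multiplication by generators.\<close>

lemma inj_if_tangent_vanishes:
  assumes "\<And>p i j. p \<in> even_part \<Longrightarrow> f p = 0 \<Longrightarrow> tangent i j p = 0"
  shows "inj f"
proof -
  have t: "tangent i j x = 0" if x: "f x = 0" for i j x
  proof -
    obtain e d where ed: "e \<in> even_part" "d \<in> odd_part" "x = e + d" using even_odd_decomposition by blast
    then have "f e = 0" using kernel_graded(1) x by blast
    then show ?thesis using ed assms by (simp add: tangent_simps tangent_odd)
  qed
  have even: "p = 0" if "p \<in> even_part" "f p = 0" for p
  proof (rule line_chars_separate[OF that(1)])
    fix Z
    show "line_char Z p = 0"
    proof (rule line_char_zero_of_invariant[where J = "{p \<in> even_part. f p = 0}"])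
      show "p \<in> {p \<in> even_part. f p = 0}" using that by simp
      show "q \<in> even_part \<and> unit_point q = 0" if "q \<in> {p \<in> even_part. f p = 0}" for q
        using that kernel_point[OF _ orthogonal_matrix_id] by simp
      show "invariant_derivation i j q \<in> {p \<in> even_part. f p = 0}" if "q \<in> {p \<in> even_part. f p = 0}" for q i j
        using that kernel_convolution[OF C_linear_tangent[of i j] t]
        by (simp add: invariant_derivation_even) (simp add: invariant_derivation_def)
    qed
  qed
  have "x = 0" if x: "f x = 0" for x
  proof -
    obtain e d where ed: "e \<in> even_part" "d \<in> odd_part" "x = e + d" using even_odd_decomposition by blast
    then have 0: "f e = 0" "f d = 0" using kernel_graded x by blast+
    fix i0 :: 'n
    have "d * gen i0 k = 0" for k using even[OF odd_mult_gen[OF ed(2)]] 0 by (simp add: f_simps)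
    then have "(\<Sum>k\<in>UNIV. d * gen i0 k * gen i0 k) = 0" by simp
    then have "d = 0" using gen_rows[of i0 i0] by (simp add: mult.assoc flip: sum_distrib_left)
    then show ?thesis using ed(3) even[OF ed(1)] 0 by simp
  qed
  then show ?thesis by (intro injI) (metis f_simps(6) right_minus_eq)
qed

lemma kernel_tangent_symmetric:
  assumes "p \<in> even_part" "f p = 0"
  shows "tangent i j p = tangent j i p"
  using tangent_symmetric[OF assms(1)] kernel_point[OF assms(2)] by blast

text \<open>With \<open>X = E\<^sub>s\<^sub>t - E\<^sub>t\<^sub>s\<close>, the derivation at \<open>X\<close> vanishes on the kernel and is moved by the adjoint
  coaction to the derivation at \<open>u X u\<^sup>-\<^sup>1\<close>, which therefore also vanishes on \<open>p\<close> modulo the kernel.\<close>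

lemma kernel_normalizer:
  assumes p: "p \<in> even_part" "f p = 0"
  shows "(\<Sum>i\<in>UNIV. \<Sum>j\<in>UNIV. tangent i j p *\<^sub>C f (gen i s * gen j t - gen i t * gen j s)) = 0"
proof -
  let ?\<phi> = "\<lambda>x. tangent s t x - tangent t s x"
  let ?\<delta> = "\<lambda>x. invariant_derivation s t x - invariant_derivation t s x"
  have lin: "C_linear ?\<phi>" by (simp add: C_linear_def tangent_simps scaleC_complex_def right_diff_distrib)
  have \<phi>: "?\<phi> x = 0" if "f x = 0" for x
  proof -
    obtain e d where ed: "e \<in> even_part" "d \<in> odd_part" "x = e + d" using even_odd_decomposition by blast
    then have "f e = 0" using kernel_graded(1) that by blast
    then show ?thesis using ed kernel_tangent_symmetric by (simp add: tangent_simps tangent_odd)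
  qed
  have \<delta>_eq: "?\<delta> x = contract (\<lambda>a b. ?\<phi> b *\<^sub>C a) (comult x)" for x
  proof -
    note b = bilinear_map_functional_right[OF C_linear_tangent]
    show ?thesis
      by (simp only: invariant_derivation_def contract_diff[OF b b, symmetric] scaleC_diff_left)
  qed
  have \<delta>: "f (?\<delta> x) = 0" if "f x = 0" for x
    unfolding \<delta>_eq by (rule kernel_convolution[OF lin \<phi> that])
  have S: "C_linear coinverse" by (simp add: C_linear_def coinverse_simps)
  have \<delta>_lin: "C_linear ?\<delta>" by (simp add: C_linear_def invariant_derivation_simps scaleC_diff_right)
  have b: "bilinear_map (\<lambda>a b. ?\<delta> a * coinverse b)" by (intro bilinear_map_mult \<delta>_lin S)
  have b': "bilinear_map (\<lambda>a b. f (?\<delta> a * coinverse b))"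
    by (rule bilinear_map_f[OF b])
  have b_st: "bilinear_map (\<lambda>a b. invariant_derivation s t a * coinverse b)" for s t
    by (intro bilinear_map_mult C_linear_invariant_derivation S)
  have "contract (\<lambda>a b. f (?\<delta> a * coinverse b)) (comult p) = 0"
  proof (rule kernel_coideal[OF b' _ _ p(2)])
    show "f (?\<delta> a * coinverse b) = 0" if "f a = 0" for a b using \<delta>[OF that] by (simp add: f_simps(2))
    show "f (?\<delta> a * coinverse b) = 0" if "f b = 0" for a b
      using kernel_coinverse[OF that] by (simp add: f_simps(2))
  qed
  then have "f (contract (\<lambda>a b. ?\<delta> a * coinverse b) (comult p)) = 0" by (simp add: f_contract[OF b])
  moreover have "contract (\<lambda>a b. ?\<delta> a * coinverse b) w
      = contract (\<lambda>a b. invariant_derivation s t a * coinverse b) w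
       - contract (\<lambda>a b. invariant_derivation t s a * coinverse b) w" for w
    by (simp only: contract_diff[OF b_st b_st, symmetric] left_diff_distrib)
  ultimately have "f ((\<Sum>i\<in>UNIV. \<Sum>j\<in>UNIV. tangent i j p *\<^sub>C (gen i s * gen j t))
      - (\<Sum>i\<in>UNIV. \<Sum>j\<in>UNIV. tangent i j p *\<^sub>C (gen i t * gen j s))) = 0"
    by (simp add: adjoint_derivation[OF p(1)])
  then show ?thesis
    by (simp add: f_simps star_hom_sum[OF f_hom] scaleC_diff_right sum_subtractf)
qed

lemma double_zero: "x + x = 0 \<Longrightarrow> x = (0 :: 'a)"
proof -
  assume "x + x = 0"
  then have "(1 / 2) *\<^sub>C (x + x) = 0" by (simp add: scaleC_zero_right)
  moreover have "(1 / 2) *\<^sub>C (x + x) = (1 / 2 + 1 / 2) *\<^sub>C x" by (simp only: scaleC_add_right scaleC_add_left)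
  ultimately show "x = 0" by (simp add: scaleC_one)
qed

text \<open>The case of the small tangent space.  The derivatives of \<open>p\<close> form a nonzero traceless symmetric
  matrix \<open>Y\<close>, and \<open>\<Sum> Y\<^sub>i\<^sub>j (u\<^sub>i\<^sub>s u\<^sub>j\<^sub>t - u\<^sub>i\<^sub>t u\<^sub>j\<^sub>s)\<close> lies in the kernel.  Left translation by \<open>O\<^sub>n\<close> shows that the
  matrices with this property are stable under conjugation, so they include all traceless symmetric
  matrices.  This makes the commutator \<open>N\<close> of \<open>u\<^sub>i\<^sub>s\<close> and \<open>u\<^sub>j\<^sub>t\<close> antisymmetric under the exchange of \<open>i\<close> and
  \<open>j\<close>, and by the antipode also under the exchange of \<open>s\<close> and \<open>t\<close>.  The two signs
  cancel if both are exchanged, but this amounts to exchanging the two factors, so \<open>N = -N\<close>.\<close>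

lemma commutative_if_tangent_nonzero:
  assumes p: "p \<in> even_part" "f p = 0" and nz: "tangent i0 j0 p \<noteq> 0"
  shows "f (gen i s) * f (gen j t) = f (gen j t) * f (gen i s)"
proof -
  define q where "q Y s t = (\<Sum>i\<in>UNIV. \<Sum>j\<in>UNIV. (Y :: complex^'n^'n) $ i $ j *\<^sub>C (gen i s * gen j t - gen i t * gen j s))" for Y s t
  define W where "W = {Y. \<forall>s t. f (q Y s t) = 0}"
  define Y :: "complex^'n^'n" where "Y = (\<chi> i j. tangent i j p)"
  have Y: "Y \<in> W" using kernel_normalizer[OF p]
    by (simp add: W_def q_def Y_def star_hom_sum[OF f_hom] f_simps(7))
  have "Y \<noteq> 0" using nz by (auto simp: Y_def vec_eq_iff)
  have W_conj: "conjugate_by P A \<in> W" if "A \<in> W" and P: "orthogonal_matrix P" for A P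
  proof -
    note l = left_translate_simps[OF P]
    have l_sum: "left_translate P (sum h S) = (\<Sum>k\<in>S. left_translate P (h k))" for h and S :: "'n set"
      by (induction S rule: infinite_finite_induct) (simp_all add: l)
    have l_diff: "left_translate P (x - y) = left_translate P x - left_translate P y" for x y
      using l(1)[of "x - y" y] by (simp add: eq_diff_eq)
    have prod: "left_translate P (gen i s * gen j t)
        = (\<Sum>a\<in>UNIV. \<Sum>b\<in>UNIV. of_real (P $ i $ a * P $ j $ b) *\<^sub>C (gen a s * gen b t))" for i j s t
      by (simp add: l sum_product mult_scaleC_left mult_scaleC_right scaleC_scaleC mult.commute)
    have "left_translate P (q A s t) = q (conjugate_by P A) s t" for s t
    proof -
      have "left_translate P (q A s t) = (\<Sum>i\<in>UNIV. \<Sum>j\<in>UNIV. \<Sum>a\<in>UNIV. \<Sum>b\<in>UNIV.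
          (of_real (P $ i $ a * P $ j $ b) * A $ i $ j) *\<^sub>C (gen a s * gen b t - gen a t * gen b s))"
        by (simp add: q_def l_sum l(3) l_diff prod scaleC_diff_right scaleC_sum_right sum_subtractf
            scaleC_scaleC mult.commute)
      also have "\<dots> = (\<Sum>a\<in>UNIV. \<Sum>b\<in>UNIV. \<Sum>i\<in>UNIV. \<Sum>j\<in>UNIV.
          (of_real (P $ i $ a * P $ j $ b) * A $ i $ j) *\<^sub>C (gen a s * gen b t - gen a t * gen b s))"
      proof -
        have swap4: "(\<Sum>i\<in>UNIV. \<Sum>j\<in>UNIV. \<Sum>a\<in>UNIV. \<Sum>b\<in>UNIV. h i j a b)
          = (\<Sum>a\<in>UNIV. \<Sum>b\<in>UNIV. \<Sum>i\<in>UNIV. \<Sum>j\<in>UNIV. h i j a b)" for h :: "'n \<Rightarrow> 'n \<Rightarrow> 'n \<Rightarrow> 'n \<Rightarrow> 'n half_liberated"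
        proof -
          have "(\<Sum>i\<in>UNIV. \<Sum>j\<in>UNIV. \<Sum>a\<in>UNIV. \<Sum>b\<in>UNIV. h i j a b)
              = (\<Sum>i\<in>UNIV. \<Sum>a\<in>UNIV. \<Sum>b\<in>UNIV. \<Sum>j\<in>UNIV. h i j a b)"
            by (intro sum.cong refl sum_rotate)
          also have "\<dots> = (\<Sum>a\<in>UNIV. \<Sum>b\<in>UNIV. \<Sum>i\<in>UNIV. \<Sum>j\<in>UNIV. h i j a b)"
            by (rule sum_rotate)
          finally show ?thesis .
        qed
        show ?thesis by (rule swap4)
      qed
      also have "\<dots> = q (conjugate_by P A) s t"
      proof -
        have sc: "sum h S *\<^sub>C x = (\<Sum>k\<in>S. h k *\<^sub>C x)" for h :: "'n \<Rightarrow> complex" and S and x :: "'n half_liberated"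
          by (induction S rule: infinite_finite_induct) (auto simp: scaleC_zero_left scaleC_add_left)
        show ?thesis by (simp add: q_def conjugate_by_def sc)
      qed
      finally show ?thesis .
    qed
    then show ?thesis using that kernel_translate(2)[OF P] by (fastforce simp: W_def)
  qed
  have W_diff: "A - B \<in> W" if "A \<in> W" "B \<in> W" for A B
  proof -
    have "q (A - B) s t = q A s t - q B s t" for s t
      by (simp add: q_def scaleC_diff_left sum_subtractf)
    then show ?thesis using that by (simp add: W_def f_simps)
  qed
  have W_scale: "mat c ** A \<in> W" if "A \<in> W" for c A
  proof -
    have "q (mat c ** A) s t = c *\<^sub>C q A s t" for s t
      by (simp add: q_def scaleC_sum_right scaleC_scaleC mat_mult_entry)
    then show ?thesis using that by (simp add: W_def f_simps scaleC_zero_right)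
  qed
  have sym: "Y $ i $ j = Y $ j $ i" for i j using kernel_tangent_symmetric[OF p] by (simp add: Y_def)
  have tr: "(\<Sum>i\<in>UNIV. Y $ i $ i) = 0" using tangent_trace[OF p(1)] by (simp add: Y_def)
  have irr: "sym_unit i j \<in> W" "diag_unit i j \<in> W" if "i \<noteq> j" for i j
    by (rule traceless_symmetric_irreducible[where W = W and Y = Y];
        fact W_diff W_scale W_conj Y \<open>Y \<noteq> 0\<close> sym tr that)+
  define r where "r i j s t = f (gen i s * gen j t - gen i t * gen j s)" for i j s t
  have fq: "f (q Z s t) = (\<Sum>i\<in>UNIV. \<Sum>j\<in>UNIV. Z $ i $ j *\<^sub>C r i j s t)" for Z s t
    by (simp add: q_def star_hom_sum[OF f_hom] f_simps(7) r_def)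
  have pick: "(\<Sum>a\<in>UNIV. \<Sum>b\<in>UNIV. (if a = i \<and> b = j then 1 else 0 :: complex) *\<^sub>C h a b) = h i j" for i j and h :: "'n \<Rightarrow> 'n \<Rightarrow> 'a"
  proof -
    have "(\<Sum>a\<in>UNIV. \<Sum>b\<in>UNIV. (if a = i \<and> b = j then 1 else 0 :: complex) *\<^sub>C h a b)
        = (\<Sum>a\<in>UNIV. \<Sum>b\<in>UNIV. if a = i then (if b = j then h a b else 0) else 0)"
      by (intro sum.cong) (auto simp: scaleC_one scaleC_zero_left)
    then show ?thesis by (simp add: sum_delta_outer)
  qed
  have off: "r i j s t + r j i s t = 0" if "i \<noteq> j" for i j s t
  proof -
    have "f (q (sym_unit i j) s t) = 0" using irr(1)[OF that] by (simp add: W_def)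
    then show ?thesis
      by (simp only: fq sym_unit_def vec_lambda_beta scaleC_add_left sum.distrib pick)
  qed
  have diag: "r i i s t = 0" for i s t
  proof -
    have eq: "r i i s t = r j j s t" for j
    proof (cases "i = j")
      case False
      have "f (q (diag_unit i j) s t) = 0" using irr(2)[OF False] by (simp add: W_def)
      then show ?thesis
        by (simp only: fq diag_unit_def vec_lambda_beta scaleC_diff_left sum_subtractf pick) simp
    qed simp
    \<comment> \<open>The trace direction is not covered by irreducibility; it comes from orthogonality of the columns.\<close>
    have "(\<Sum>j\<in>UNIV. r j j s t) = f ((\<Sum>j\<in>UNIV. gen j s * gen j t) - (\<Sum>j\<in>UNIV. gen j t * gen j s))"
      by (simp add: r_def star_hom_sum[OF f_hom] f_simps(6) sum_subtractf)
    also have "\<dots> = 0" by (simp add: gen_cols f_simps(4))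
    finally have "(\<Sum>j\<in>UNIV. r j j s t) = 0" .
    moreover have "(\<Sum>j\<in>(UNIV :: 'n set). r i i s t) = (\<Sum>j\<in>UNIV. r j j s t)"
      by (intro sum.cong refl eq)
    moreover have "(\<Sum>j\<in>(UNIV :: 'n set). r i i s t) = of_nat CARD('n) *\<^sub>C r i i s t"
    proof -
      have const: "(\<Sum>j\<in>S. x) = of_nat (card S) *\<^sub>C x" if "finite S" for S :: "'n set" and x :: 'a
        using that by induction (auto simp: scaleC_zero_left scaleC_add_left scaleC_one simp del: sum_constant)
      show ?thesis by (rule const) simp
    qed
    ultimately have "(1 / of_nat CARD('n)) *\<^sub>C of_nat CARD('n) *\<^sub>C r i i s t = 0"
      by (simp only: scaleC_zero_right)
    then show ?thesis by (simp add: scaleC_scaleC scaleC_one)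
  qed
  have rel: "r i j s t + r j i s t = 0" for i j s t
    using off diag by (cases "i = j") auto
  define N where "N i s j t = f (gen i s) * f (gen j t) - f (gen j t) * f (gen i s)" for i s j t
  have N1: "N i s j t + N j s i t = 0" for i s j t
    using rel[of i j s t] by (simp add: N_def r_def f_simps algebra_simps)
  have N2: "N t j s i + N t i s j = 0" for i s j t
  proof -
    let ?x = "(gen i s * gen j t - gen i t * gen j s) + (gen j s * gen i t - gen j t * gen i s)"
    have "f ?x = 0" using rel[of i j s t] by (simp add: r_def f_simps(1))
    from kernel_coinverse[OF this] have "f (coinverse ?x) = 0" .
    moreover have c_diff: "coinverse (x - y) = coinverse x - coinverse y" for x y :: "'n half_liberated"
      using coinverse_simps(1)[of "x - y" y] by (simp add: eq_diff_eq)
    ultimately show ?thesis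
      by (simp add: coinverse_simps coinverse_gen f_simps N_def algebra_simps)
  qed
  have anti: "N i s j t = - N j t i s" for i s j t by (simp add: N_def)
  have "N i s j t = N i t j s"
    using N1[of i s j t] anti[of j s i t] by (simp add: eq_neg_iff_add_eq_0)
  moreover have "N i s j t + N i t j s = 0" using N2[of i s j t] by simp
  ultimately have "N i s j t + N i s j t = 0" by simp
  from double_zero[OF this] show ?thesis by (simp add: N_def)
qed

text \<open>Every element of the quotient is then a polynomial in the entries of an orthogonal matrix with
  commuting entries.  If \<open>g\<close> annihilates the element, the polynomial vanishes on \<open>O\<^sub>n\<close>.\<close>

lemma inj_if_commutative:
  assumes comm: "\<And>i s j t. f (gen i s) * f (gen j t) = f (gen j t) * f (gen i s)"
  shows "inj g"
proof -
  define \<rho> where "\<rho> = (\<lambda>(i, j). f (gen i j))"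
  have \<rho>_apply: "\<rho> (i, j) = f (gen i j)" for i j by (simp add: \<rho>_def)
  have \<rho>: "commuting \<rho>" by (auto simp: commuting_def \<rho>_def comm)
  note \<Lambda> = poly_hom_simps[OF poly_hom_lift(1)[OF \<rho>]] poly_lift_Var[OF \<rho>]
  note gs = star_hom_simps[OF g]
  have ex: "\<exists>F. f x = poly_lift \<rho> F" for x
  proof (induction x rule: half_liberated_induct)
    case (scalar c)
    show ?case by (rule exI[of _ "Const c"]) (simp add: \<Lambda> f_simps)
  next
    case (gen i j)
    show ?case by (rule exI[of _ "Var (i, j)"]) (simp add: \<Lambda> \<rho>_apply)
  next
    case (add x y)
    then show ?case by (metis \<Lambda>(1) f_simps(1))
  next
    case (mult x y)
    then show ?case by (metis \<Lambda>(2) f_simps(2))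
  qed
  have at_point: "Rep_rep_orthogonal (g (poly_lift \<rho> F)) Q = peval F (\<lambda>(i, j). of_real (Q $ i $ j))"
    if "orthogonal_matrix Q" for F Q
  proof -
    have Q: "Q \<in> orthogonal_group" using that by (simp add: orthogonal_group_def)
    show ?thesis
    proof (induction F)
      case (Const c)
      show ?case by (simp add: \<Lambda> gs scaleC_rep_orthogonal.rep_eq one_rep_orthogonal.rep_eq Q)
    next
      case (Var x)
      show ?case by (cases x) (simp add: \<Lambda> \<rho>_apply gf coordinate_matrix_def coordinate_function.rep_eq Q)
    next
      case (add F G)
      then show ?case by (simp add: \<Lambda> gs plus_rep_orthogonal.rep_eq)
    next
      case (mult F G)
      then show ?case by (simp add: \<Lambda> gs times_rep_orthogonal.rep_eq)
    qed
  qed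
  have "y = 0" if y: "g y = 0" for y
  proof -
    obtain F where F: "y = poly_lift \<rho> F" using ex surj_f by (metis surjD)
    have "poly_lift \<rho> F = 0"
    proof (rule orthogonal_point_determined[OF \<rho>])
      show "(\<Sum>k\<in>UNIV. \<rho> (i, k) * \<rho> (j, k)) = (if i = j then 1 else 0)" for i j
        using gen_rows[of i j]
        by (auto simp: \<rho>_apply f_simps simp flip: f_simps(2) star_hom_sum[OF f_hom])
      show "peval F (\<lambda>(i, j). of_real (Q $ i $ j)) = 0" if "orthogonal_matrix Q" for Q
        using at_point[OF that, of F] y by (simp add: F[symmetric] zero_rep_orthogonal.rep_eq)
    qed
    then show ?thesis by (simp add: F)
  qed
  then show ?thesis by (intro injI) (metis gs(6) right_minus_eq)
qed

lemma inj_or_inj: "inj f \<or> inj g"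
  using inj_if_tangent_vanishes commutative_if_tangent_nonzero inj_if_commutative by metis

end

theorem theorem4p1:
  fixes v :: "'a::complex_star_algebra^'m^'m"
    and f :: "'n::finite half_liberated \<Rightarrow> 'a"
    and g :: "'a \<Rightarrow> 'n rep_orthogonal"
  assumes "CARD('n) \<ge> 2"
    and "unitary_hopf_algebra v"
    and "hopf_star_hom half_liberated_matrix v f" and "surj f"
    and "hopf_star_hom v coordinate_matrix g" and "surj g"
    and "\<forall>i j. (g \<circ> f) (half_liberated_matrix $ i $ j) = coordinate_matrix $ i $ j"
  shows "bij f \<or> bij g"
proof -
  interpret intermediate_hopf_algebra v f g
    using assms by unfold_locales (auto simp: hopf_star_hom_def)
  show ?thesis using inj_or_inj \<open>surj f\<close> \<open>surj g\<close> by (auto simp: bij_def)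
qed

end
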